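(* Let $p\in(1,\infty)$. Let $\mathcal{E}$ be a regular conservative pure-jump Dirichlet form on $L^2(m)$, given by $$\mathcal{E}(u,v)=\frac12\iint_{E\times E\setminus\mathrm{diag}}(u(y)-u(x))(v(y)-v(x))\,J(dx,dy),$$ and let $(P_t)_{t\ge 0}$ be the associated semigroup. Assume that: (i) for every $t>0$ and $f\in L^p(m)$ we have $P_tf\in C(E)$, that is, $P_tf$ is continuous on $E$; (ii) the semigroup $(P_t)_{t\ge0}$ is strongly stable on $L^p(m)$, i.e., for every $f\in L^p(m)$, $\|P_Tf\|_p\to0$ as $T\to\infty$. If $f\in L^p(m)$, then $$\int_E|f|^p\,dm=\int_0^\infty\ \iint_{E\times E\setminus\mathrm{diag}}F_p(P_tf(x),P_tf(y))\,J(dx,dy)\,dt,$$ where $F_p(a,b):=|b|^p-|a|^p-pa^{\langle p-1\rangle}(b-a)$ is the Bregman divergence.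
   Context: $E$ is a locally compact separable metric space with Borel $\sigma$-algebra $\mathcal{B}$, and $m$ is a positive Radon measure on $E$ with $\mathrm{supp}(m)=E$. Write $L^p(m):=L^p(E,\mathcal{B},m)$ with norm $\|\cdot\|_p$, and $C(E)$ for the continuous real functions on $E$. $\mathrm{diag}:=\{(x,y)\in E\times E: x=y\}$. $J$ (the jumping measure) is a symmetric positive Radon measure on $E\times E\setminus\mathrm{diag}$. The formula for $\mathcal{E}(u,v)$ holds for $u,v$ in the domain $\mathcal{D}(\mathcal{E})\subseteq L^2(m)$ (with the usual convention that quasi-continuous versions of $u,v$ are used in the integral). $(P_t)_{t\ge0}$ is the strongly continuous symmetric Markovian semigroup of contractions on $L^2(m)$ associated with $\mathcal{E}$; it extends to a strongly continuous semigroup of contractions on $L^p(m)$ for every $p\in[1,\infty)$, and $P_tu(x)=\int_E u(y)\,P_t(x,dy)$ for $u\in L^p(m)$, where $P_t(x,dy)$ is the kernel of $P_t$. Conservative means $P_t1=1$ for all $t\geq 0$. For real $a$ and $\kappa>0$, $a^{\langle\kappa\rangle}:=|a|^\kappa\,\mathrm{sgn}\,a$. *)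

theory Defs
  imports "HOL-Probability.Probability"
begin

(* Elements of function spaces are Borel functions (representatives); all identities
   between elements of L^p(m) are stated m-almost everywhere. A separable metric space is
   rendered by the classes metric_space and second_countable_topology. *)

definition radon_measure_on :: "'a::metric_space set \<Rightarrow> 'a measure \<Rightarrow> bool" where
  "radon_measure_on S M \<longleftrightarrow>
     sets M = sets (restrict_space borel S) \<and>
     (\<forall>K. compact K \<and> K \<subseteq> S \<longrightarrow> emeasure M K < \<infinity>) \<and>
     (\<forall>A\<in>sets M. emeasure M A = (SUP K\<in>{K. compact K \<and> K \<subseteq> A}. emeasure M K))"

definition measure_supp :: "'a::topological_space measure \<Rightarrow> 'a set" where
  "measure_supp M = {x. \<forall>U. open U \<and> x \<in> U \<longrightarrow> emeasure M U > 0}"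

definition diag :: "('a \<times> 'a) set" where
  "diag = {(x, y). x = y}"

definition Lp :: "real \<Rightarrow> 'a measure \<Rightarrow> ('a \<Rightarrow> real) set" where
  "Lp p m = {f \<in> borel_measurable m. integrable m (\<lambda>x. \<bar>f x\<bar> powr p)}"

definition Lp_norm :: "real \<Rightarrow> 'a measure \<Rightarrow> ('a \<Rightarrow> real) \<Rightarrow> real" where
  "Lp_norm p m f = (\<integral>x. \<bar>f x\<bar> powr p \<partial>m) powr (1 / p)"

definition L2_inner :: "'a measure \<Rightarrow> ('a \<Rightarrow> real) \<Rightarrow> ('a \<Rightarrow> real) \<Rightarrow> real" where
  "L2_inner m u v = (\<integral>x. u x * v x \<partial>m)"

definition Cc :: "('a::topological_space \<Rightarrow> real) set" where
  "Cc = {u. continuous_on UNIV u \<and> compact (closure {x. u x \<noteq> 0})}"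


(* A form is a pair (D, Q): its domain D, saturated under m-a.e. equality of Borel
   functions, and its values Q u v for u, v in D. *)

definition form1 ::
  "'a measure \<Rightarrow> (('a \<Rightarrow> real) \<Rightarrow> ('a \<Rightarrow> real) \<Rightarrow> real) \<Rightarrow> ('a \<Rightarrow> real) \<Rightarrow> ('a \<Rightarrow> real) \<Rightarrow> real" where
  "form1 m Q u v = Q u v + L2_inner m u v"

definition symmetric_form ::
  "'a measure \<Rightarrow> ('a \<Rightarrow> real) set \<Rightarrow> (('a \<Rightarrow> real) \<Rightarrow> ('a \<Rightarrow> real) \<Rightarrow> real) \<Rightarrow> bool" where
  "symmetric_form m D Q \<longleftrightarrow>
     D \<subseteq> Lp 2 m \<and>
     (\<forall>u\<in>D. \<forall>u'\<in>borel_measurable m. (AE x in m. u x = u' x) \<longrightarrow>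
        u' \<in> D \<and> (\<forall>v\<in>D. Q u v = Q u' v)) \<and>
     (\<lambda>x. 0) \<in> D \<and>
     (\<forall>u\<in>D. \<forall>v\<in>D. \<forall>a b. (\<lambda>x. a * u x + b * v x) \<in> D) \<and>
     (\<forall>u\<in>Lp 2 m. \<forall>\<epsilon>>0. \<exists>v\<in>D. Lp_norm 2 m (\<lambda>x. u x - v x) < \<epsilon>) \<and>
     (\<forall>u\<in>D. \<forall>v\<in>D. \<forall>w\<in>D. \<forall>a b. Q (\<lambda>x. a * u x + b * v x) w = a * Q u w + b * Q v w) \<and>
     (\<forall>u\<in>D. \<forall>v\<in>D. Q u v = Q v u) \<and>
     (\<forall>u\<in>D. Q u u \<ge> 0)"

definition closed_form ::
  "'a measure \<Rightarrow> ('a \<Rightarrow> real) set \<Rightarrow> (('a \<Rightarrow> real) \<Rightarrow> ('a \<Rightarrow> real) \<Rightarrow> real) \<Rightarrow> bool" where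
  "closed_form m D Q \<longleftrightarrow>
     (\<forall>u::nat \<Rightarrow> 'a \<Rightarrow> real. (\<forall>n. u n \<in> D) \<and>
        (\<forall>\<epsilon>>0. \<exists>N. \<forall>k\<ge>N. \<forall>l\<ge>N. form1 m Q (\<lambda>x. u k x - u l x) (\<lambda>x. u k x - u l x) < \<epsilon>) \<longrightarrow>
        (\<exists>v\<in>D. (\<lambda>n. form1 m Q (\<lambda>x. u n x - v x) (\<lambda>x. u n x - v x)) \<longlonglongrightarrow> 0))"

definition dirichlet_form ::
  "'a measure \<Rightarrow> ('a \<Rightarrow> real) set \<Rightarrow> (('a \<Rightarrow> real) \<Rightarrow> ('a \<Rightarrow> real) \<Rightarrow> real) \<Rightarrow> bool" where
  "dirichlet_form m D Q \<longleftrightarrow>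
     symmetric_form m D Q \<and> closed_form m D Q \<and>
     (\<forall>u\<in>D. (\<lambda>x. min (max (u x) 0) 1) \<in> D \<and>
        Q (\<lambda>x. min (max (u x) 0) 1) (\<lambda>x. min (max (u x) 0) 1) \<le> Q u u)"

definition regular_form ::
  "'a::topological_space measure \<Rightarrow> ('a \<Rightarrow> real) set \<Rightarrow> (('a \<Rightarrow> real) \<Rightarrow> ('a \<Rightarrow> real) \<Rightarrow> real) \<Rightarrow> bool" where
  "regular_form m D Q \<longleftrightarrow>
     (\<forall>u\<in>D. \<forall>\<epsilon>>0. \<exists>g\<in>D \<inter> Cc. form1 m Q (\<lambda>x. u x - g x) (\<lambda>x. u x - g x) < \<epsilon>) \<and>
     (\<forall>h\<in>Cc. \<forall>\<epsilon>>0. \<exists>g\<in>D \<inter> Cc. \<forall>x. \<bar>h x - g x\<bar> < \<epsilon>)"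

(* The 1-capacity of an open set; the infimum over the empty set is infinite. *)
definition open_capacity ::
  "'a measure \<Rightarrow> ('a \<Rightarrow> real) set \<Rightarrow> (('a \<Rightarrow> real) \<Rightarrow> ('a \<Rightarrow> real) \<Rightarrow> real) \<Rightarrow> 'a set \<Rightarrow> ennreal" where
  "open_capacity m D Q G =
     (INF u\<in>{u\<in>D. AE x in m. x \<in> G \<longrightarrow> u x \<ge> 1}. ennreal (form1 m Q u u))"

definition quasi_continuous ::
  "'a::topological_space measure \<Rightarrow> ('a \<Rightarrow> real) set \<Rightarrow> (('a \<Rightarrow> real) \<Rightarrow> ('a \<Rightarrow> real) \<Rightarrow> real) \<Rightarrow>
     ('a \<Rightarrow> real) \<Rightarrow> bool" where
  "quasi_continuous m D Q u \<longleftrightarrow>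
     (\<forall>\<epsilon>>0. \<exists>G. open G \<and> open_capacity m D Q G < \<epsilon> \<and> continuous_on (- G) u)"

definition quasi_continuous_version ::
  "'a::topological_space measure \<Rightarrow> ('a \<Rightarrow> real) set \<Rightarrow> (('a \<Rightarrow> real) \<Rightarrow> ('a \<Rightarrow> real) \<Rightarrow> real) \<Rightarrow>
     ('a \<Rightarrow> real) \<Rightarrow> ('a \<Rightarrow> real) \<Rightarrow> bool" where
  "quasi_continuous_version m D Q u u' \<longleftrightarrow>
     u' \<in> borel_measurable m \<and> (AE x in m. u' x = u x) \<and> quasi_continuous m D Q u'"

(* J is a measure whose underlying space is the complement of the diagonal, so integrals
   with respect to J are integrals over E x E without the diagonal. *)
definition jumping_measure :: "('a::metric_space \<times> 'a) measure \<Rightarrow> bool" where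
  "jumping_measure J \<longleftrightarrow>
     radon_measure_on (- diag) J \<and>
     (\<forall>A\<in>sets J. emeasure J (prod.swap -` A) = emeasure J A)"

definition pure_jump_form ::
  "'a::topological_space measure \<Rightarrow> ('a \<Rightarrow> real) set \<Rightarrow> (('a \<Rightarrow> real) \<Rightarrow> ('a \<Rightarrow> real) \<Rightarrow> real) \<Rightarrow>
     ('a \<times> 'a) measure \<Rightarrow> bool" where
  "pure_jump_form m D Q J \<longleftrightarrow>
     (\<forall>u\<in>D. \<forall>v\<in>D. \<forall>u' v'.
        quasi_continuous_version m D Q u u' \<longrightarrow> quasi_continuous_version m D Q v v' \<longrightarrow>
        integrable J (\<lambda>(x, y). (u' y - u' x) * (v' y - v' x)) \<and>
        Q u v = 1/2 * (\<integral>(x, y). (u' y - u' x) * (v' y - v' x) \<partial>J))"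


definition sub_markov_kernels :: "(real \<Rightarrow> 'a::topological_space \<Rightarrow> 'a measure) \<Rightarrow> bool" where
  "sub_markov_kernels K \<longleftrightarrow> (\<forall>t\<ge>0. K t \<in> borel \<rightarrow>\<^sub>M subprob_algebra borel)"

(* The operators P_t u (x) = int u(y) P_t(x, dy), for every u for which the integral makes
   sense; on L^p(m) this is the extension of the L^2(m)-semigroup. *)
definition kernel_op :: "(real \<Rightarrow> 'a \<Rightarrow> 'a measure) \<Rightarrow> real \<Rightarrow> ('a \<Rightarrow> real) \<Rightarrow> 'a \<Rightarrow> real" where
  "kernel_op K t u x = (\<integral>y. u y \<partial>K t x)"

(* Strongly continuous symmetric Markovian semigroup of contractions on L^2(m). That P t
   respects m-a.e. equality follows from linearity and contractivity. *)
definition symmetric_markov_semigroup ::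
  "'a measure \<Rightarrow> (real \<Rightarrow> ('a \<Rightarrow> real) \<Rightarrow> 'a \<Rightarrow> real) \<Rightarrow> bool" where
  "symmetric_markov_semigroup m P \<longleftrightarrow>
     (\<forall>t\<ge>0. \<forall>u\<in>Lp 2 m. P t u \<in> Lp 2 m \<and> Lp_norm 2 m (P t u) \<le> Lp_norm 2 m u) \<and>
     (\<forall>t\<ge>0. \<forall>u\<in>Lp 2 m. \<forall>v\<in>Lp 2 m. \<forall>a b.
        AE x in m. P t (\<lambda>y. a * u y + b * v y) x = a * P t u x + b * P t v x) \<and>
     (\<forall>u\<in>Lp 2 m. AE x in m. P 0 u x = u x) \<and>
     (\<forall>s\<ge>0. \<forall>t\<ge>0. \<forall>u\<in>Lp 2 m. AE x in m. P (s + t) u x = P s (P t u) x) \<and>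
     (\<forall>t\<ge>0. \<forall>u\<in>Lp 2 m. \<forall>v\<in>Lp 2 m. L2_inner m (P t u) v = L2_inner m u (P t v)) \<and>
     (\<forall>t\<ge>0. \<forall>u\<in>Lp 2 m. (AE x in m. 0 \<le> u x \<and> u x \<le> 1) \<longrightarrow>
        (AE x in m. 0 \<le> P t u x \<and> P t u x \<le> 1)) \<and>
     (\<forall>u\<in>Lp 2 m. ((\<lambda>t. Lp_norm 2 m (\<lambda>x. P t u x - u x)) \<longlongrightarrow> 0) (at_right 0))"

definition approx_form ::
  "'a measure \<Rightarrow> (real \<Rightarrow> ('a \<Rightarrow> real) \<Rightarrow> 'a \<Rightarrow> real) \<Rightarrow> real \<Rightarrow> ('a \<Rightarrow> real) \<Rightarrow> ('a \<Rightarrow> real) \<Rightarrow> real" where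
  "approx_form m P t u v = 1 / t * L2_inner m (\<lambda>x. u x - P t u x) v"

(* (D, Q) is the form of the semigroup P, defined through the approximating forms as in
   Chen and Fukushima, Symmetric Markov Processes, Section 1.1; for each u in L^2(m) the
   quantity approx_form m P t u u is nonnegative and nonincreasing in t > 0, so finiteness
   of its limit at 0 means convergence in the reals. *)
definition associated_semigroup ::
  "'a measure \<Rightarrow> ('a \<Rightarrow> real) set \<Rightarrow> (('a \<Rightarrow> real) \<Rightarrow> ('a \<Rightarrow> real) \<Rightarrow> real) \<Rightarrow>
     (real \<Rightarrow> ('a \<Rightarrow> real) \<Rightarrow> 'a \<Rightarrow> real) \<Rightarrow> bool" where
  "associated_semigroup m D Q P \<longleftrightarrow>
     symmetric_markov_semigroup m P \<and>
     D = {u \<in> Lp 2 m. \<exists>c. ((\<lambda>t. approx_form m P t u u) \<longlongrightarrow> c) (at_right 0)} \<and>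
     (\<forall>u\<in>D. \<forall>v\<in>D. ((\<lambda>t. approx_form m P t u v) \<longlongrightarrow> Q u v) (at_right 0))"

definition conservative :: "'a measure \<Rightarrow> (real \<Rightarrow> ('a \<Rightarrow> real) \<Rightarrow> 'a \<Rightarrow> real) \<Rightarrow> bool" where
  "conservative m P \<longleftrightarrow> (\<forall>t\<ge>0. AE x in m. P t (\<lambda>y. 1) x = 1)"

definition strongly_stable ::
  "real \<Rightarrow> 'a measure \<Rightarrow> (real \<Rightarrow> ('a \<Rightarrow> real) \<Rightarrow> 'a \<Rightarrow> real) \<Rightarrow> bool" where
  "strongly_stable p m P \<longleftrightarrow> (\<forall>f\<in>Lp p m. ((\<lambda>T. Lp_norm p m (P T f)) \<longlongrightarrow> 0) at_top)"


definition signed_powr :: "real \<Rightarrow> real \<Rightarrow> real" where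
  "signed_powr a \<kappa> = \<bar>a\<bar> powr \<kappa> * sgn a"

definition bregman :: "real \<Rightarrow> real \<Rightarrow> real \<Rightarrow> real" where
  "bregman p a b = \<bar>b\<bar> powr p - \<bar>a\<bar> powr p - p * signed_powr a (p - 1) * (b - a)"

(* Hence the integrals of the Bregman divergence may be taken as integrals of
   nonnegative functions. *)
lemma bregman_nonneg:
  assumes "1 < p"
  shows "0 \<le> bregman p a b"
proof -
  have "\<bar>a\<bar> powr (p - 1) * \<bar>b\<bar> \<le> (\<bar>a\<bar> powr (p - 1)) powr (p / (p - 1)) / (p / (p - 1)) + \<bar>b\<bar> powr p / p"
    using assms by (intro Youngs_inequality) (auto simp: field_simps)
  also have "(\<bar>a\<bar> powr (p - 1)) powr (p / (p - 1)) = \<bar>a\<bar> powr p"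
    using assms by (simp add: powr_powr)
  finally have young: "p * (\<bar>a\<bar> powr (p - 1) * \<bar>b\<bar>) \<le> (p - 1) * \<bar>a\<bar> powr p + \<bar>b\<bar> powr p"
    using assms by (simp add: field_simps)
  have "signed_powr a (p - 1) * b \<le> \<bar>a\<bar> powr (p - 1) * \<bar>b\<bar>"
  proof -
    have "signed_powr a (p - 1) * b \<le> \<bar>signed_powr a (p - 1) * b\<bar>" by simp
    also have "\<dots> \<le> \<bar>a\<bar> powr (p - 1) * \<bar>b\<bar>"
      by (simp add: signed_powr_def abs_mult sgn_if)
    finally show ?thesis .
  qed
  then have "p * (signed_powr a (p - 1) * b) \<le> p * (\<bar>a\<bar> powr (p - 1) * \<bar>b\<bar>)"
    using assms by (intro mult_left_mono) auto
  moreover have "signed_powr a (p - 1) * a = \<bar>a\<bar> powr p"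
  proof -
    have "signed_powr a (p - 1) * a = \<bar>a\<bar> powr (p - 1) * \<bar>a\<bar>"
      by (simp add: signed_powr_def sgn_if)
    also have "\<dots> = \<bar>a\<bar> powr p"
      by (cases "a = 0") (use assms in \<open>simp_all add: powr_diff\<close>)
    finally show ?thesis .
  qed
  ultimately show ?thesis
    using young by (simp add: bregman_def algebra_simps)
qed

end

theory Submission
  imports Defs
begin

text \<open>
Write \<open>u\<^sub>t = P t f\<close>, let \<open>v\<^sub>t\<close> be the signed power \<open>u\<^sub>t\<close> to the exponent \<open>p/2\<close>, let
\<open>\<phi> t\<close> be the integral of \<open>\<bar>u\<^sub>t\<bar> powr p\<close>, and let \<open>I t\<close> be the integral of \<open>F (u\<^sub>t x) (u\<^sub>t y)\<close> against
\<open>J\<close>, where \<open>F\<close> is the Bregman divergence. The identity is the fundamental theorem of calculus for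
\<open>\<phi>\<close>: stability makes \<open>\<phi>\<close> decrease from the integral of \<open>\<bar>f\<bar> powr p\<close> to 0, and at almost every \<open>t\<close>
the difference quotients \<open>(\<phi> t - \<phi> (t + h)) / h\<close> tend to \<open>I t\<close> along a sequence \<open>h \<rightarrow> 0\<close>.

The quotients are themselves Bregman integrals. For almost every \<open>x\<close> the measure \<open>K h x\<close> is a
probability measure under which \<open>u\<^sub>t\<close> has mean \<open>u\<^sub>t\<^sub>+\<^sub>h x\<close>, and \<open>m\<close> is invariant; so \<open>\<phi> t - \<phi> (t + h)\<close>
is the integral of \<open>F (u\<^sub>t\<^sub>+\<^sub>h x) (u\<^sub>t y)\<close> with respect to \<open>K h x (dy) m(dx)\<close>
(\<open>joint_bregman_energy\<close>). Since the mean minimises \<open>c \<mapsto> \<integral> F c (u\<^sub>t y) K h x (dy)\<close>, replacing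
\<open>u\<^sub>t\<^sub>+\<^sub>h x\<close> by any other value can only enlarge this integral (\<open>joint_bregman_mean_le\<close>).

\<^emph>\<open>Lower bound.\<close> Off the diagonal the measures \<open>K h x (dy) m(dx) / h\<close> converge to \<open>J\<close>. This is
tested on products \<open>g x * k y\<close> of cutoff functions with disjoint supports, where it is the
convergence of the approximating forms, and a partition of unity turns it into a Fatou lemma
(\<open>rate_liminf\<close>) for integrands that converge locally uniformly. It applies because
\<open>u\<^sub>t\<^sub>+\<^sub>h \<rightarrow> u\<^sub>t\<close> locally uniformly (\<open>P_locally_uniform\<close>): continuity of all \<open>P t g\<close> makes
\<open>g \<mapsto> P t g\<close> uniformly small on compact sets for small \<open>g\<close>.

\<^emph>\<open>Upper bound.\<close> No mass may be lost at the diagonal or at infinity. The integrand \<open>F a b\<close> is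
comparable to the square of the increment of the signed \<open>p/2\<close>-th power (\<open>bregman_bounds\<close>). If
\<open>v\<^sub>t\<close> lies in the domain of the form, the integrals of \<open>(v\<^sub>t y - v\<^sub>t x)\<^sup>2\<close> against
\<open>K h x (dy) m(dx) / h\<close> converge to the integral against \<open>J\<close>, and the Fatou lemma for the
difference of this majorant and \<open>F\<close> gives the missing inequality
(\<open>loss_tendsto_jump_energy\<close>).

\<^emph>\<open>Domain and domination.\<close> The variance of \<open>v\<^sub>t\<close> under \<open>K h x\<close> is at most the mean square
distance of \<open>v\<^sub>t\<close> to the signed \<open>p/2\<close>-th power of \<open>u\<^sub>t\<^sub>+\<^sub>h x\<close>, so the approximating form of
\<open>v\<^sub>t\<close> at time \<open>2 h\<close> is at most a constant times the difference quotient of \<open>\<phi>\<close>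
(\<open>approx_form_le_loss\<close>). Up to a factor that tends to 1, approximating
forms grow as the time shrinks. Hence the lower limit
of the difference quotients, which by Fatou's lemma in \<open>t\<close> is finite for almost every \<open>t\<close>, decides
that \<open>v\<^sub>t\<close> is in the domain, and a constant multiple of it dominates all quotients at \<open>t\<close>
(\<open>loss_dominated\<close>). This takes the place of analyticity of the semigroup on \<open>Lp p m\<close>. The
integral of the quotient over \<open>t \<ge> 0\<close> telescopes to the mean of \<open>\<phi>\<close> over \<open>{0..<h}\<close>, which tends to
the integral of \<open>\<bar>f\<bar> powr p\<close>, and dominated convergence finishes the proof.
\<close>

section \<open>Comparison of the Bregman divergence with a squared increment\<close>

lemma signed_powr_minus: "signed_powr (- a) k = - signed_powr a k"
  by (simp add: signed_powr_def sgn_minus)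

lemma bregman_minus: "bregman p (- a) (- b) = bregman p a b"
  by (simp add: bregman_def signed_powr_minus algebra_simps)

lemma signed_powr_mult_self:
  assumes "0 < k" shows "signed_powr a (k - 1) * a = \<bar>a\<bar> powr k"
  using assms by (cases "a = 0") (auto simp: signed_powr_def sgn_if powr_diff)

lemma signed_powr_half_squared: "(signed_powr a (p / 2))\<^sup>2 = \<bar>a\<bar> powr p"
proof -
  have "(signed_powr a (p / 2))\<^sup>2 = (\<bar>a\<bar> powr (p / 2)) * (\<bar>a\<bar> powr (p / 2)) * (sgn a)\<^sup>2"
    by (simp add: signed_powr_def power2_eq_square)
  also have "\<dots> = \<bar>a\<bar> powr p"
    by (cases "a = 0") (auto simp: powr_add[symmetric] sgn_if)
  finally show ?thesis .
qed

lemma bregman_expand: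
  assumes "1 < p"
  shows "bregman p a b = \<bar>b\<bar> powr p + (p - 1) * \<bar>a\<bar> powr p - p * (signed_powr a (p - 1) * b)"
  using signed_powr_mult_self[of p a] assms by (simp add: bregman_def algebra_simps)

text \<open>Weighted arithmetic-geometric mean inequality for monomials in \<open>a\<close> and
\<open>b\<close>: the assumptions on the exponents say that the left monomial is the weighted
geometric mean of the two on the right.\<close>

lemma weighted_powr_mean_le:
  fixes a b :: real
  assumes "0 < a" "0 < b" "0 \<le> u" "0 \<le> v" "0 < w" "u + v = w"
    and "w * k = u * r1 + v * r2" "w * l = u * s1 + v * s2"
  shows "w * (a powr k * b powr l) \<le> u * (a powr r1 * b powr s1) + v * (a powr r2 * b powr s2)"
proof -
  have k: "k = r1 * (u / w) + r2 * (v / w)" "l = s1 * (u / w) + s2 * (v / w)"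
    using assms by (auto simp: field_simps)
  have "(a powr r1 * b powr s1) powr (u / w) * (a powr r2 * b powr s2) powr (v / w)
      \<le> (u / w) * (a powr r1 * b powr s1) + (v / w) * (a powr r2 * b powr s2)"
    using assms by (intro Youngs_inequality_0) (auto simp: add_divide_distrib[symmetric])
  also have "(a powr r1 * b powr s1) powr (u / w) * (a powr r2 * b powr s2) powr (v / w)
      = a powr k * b powr l"
    using assms(1,2) unfolding k by (simp add: powr_mult powr_powr powr_add ac_simps)
  finally show ?thesis
    using assms by (simp add: field_simps)
qed

text \<open>Expanding both sides in the monomials \<open>a powr p\<close>, \<open>b powr p\<close>, \<open>a
powr (p/2) * b powr (p/2)\<close> and \<open>a powr (p - 1) * b\<close>, each of the two
inequalities, for \<open>p \<ge> 2\<close> and for \<open>p < 2\<close>, is a single weighted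
mean inequality between three of them.\<close>

lemma bregman_bounds_pos:
  assumes p: "1 < p" and ab: "0 < a" "0 < b"
  shows "min 1 (p - 1) * (signed_powr b (p / 2) - signed_powr a (p / 2))\<^sup>2 \<le> bregman p a b"
    and "bregman p a b \<le> max 1 (p - 1) * (signed_powr b (p / 2) - signed_powr a (p / 2))\<^sup>2"
proof -
  define X Y Z W where "X = a powr p" "Y = b powr p" "Z = a powr (p/2) * b powr (p/2)"
    "W = a powr (p - 1) * b powr 1"
  note d = this
  have F: "bregman p a b = Y + (p - 1) * X - p * W"
    using ab p by (simp add: bregman_expand signed_powr_def d)
  have Q: "(signed_powr b (p / 2) - signed_powr a (p / 2))\<^sup>2 = Y - 2 * Z + X"
    using ab signed_powr_half_squared[of a p] signed_powr_half_squared[of b p]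
    by (simp add: power2_diff d) (simp add: signed_powr_def)
  have b0: "b powr 0 = 1" "a powr 0 = 1" using ab by auto
  show "min 1 (p - 1) * (signed_powr b (p / 2) - signed_powr a (p / 2))\<^sup>2 \<le> bregman p a b"
  proof (cases "2 \<le> p")
    case True
    have "p * (a powr (p - 1) * b powr 1)
        \<le> (p - 2) * (a powr p * b powr 0) + 2 * (a powr (p/2) * b powr (p/2))"
      using ab True by (intro weighted_powr_mean_le) (auto simp: algebra_simps)
    then show ?thesis using True ab unfolding F Q by (simp add: d b0 algebra_simps)
  next
    case False
    have "p * (a powr (p - 1) * b powr 1)
        \<le> (2 - p) * (a powr 0 * b powr p) + (2 * (p - 1)) * (a powr (p/2) * b powr (p/2))"
      using ab False p by (intro weighted_powr_mean_le) (auto simp: algebra_simps)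
    then show ?thesis using False ab unfolding F Q by (simp add: d b0 algebra_simps)
  qed
  show "bregman p a b \<le> max 1 (p - 1) * (signed_powr b (p / 2) - signed_powr a (p / 2))\<^sup>2"
  proof (cases "2 \<le> p")
    case True
    have "(2 * (p - 1)) * (a powr (p/2) * b powr (p/2))
        \<le> (p - 2) * (a powr 0 * b powr p) + p * (a powr (p - 1) * b powr 1)"
      using ab True by (intro weighted_powr_mean_le) (auto simp: algebra_simps)
    then show ?thesis using True ab unfolding F Q by (simp add: d b0 algebra_simps)
  next
    case False
    have "2 * (a powr (p/2) * b powr (p/2))
        \<le> (2 - p) * (a powr p * b powr 0) + p * (a powr (p - 1) * b powr 1)"
      using ab False p by (intro weighted_powr_mean_le) (auto simp: algebra_simps)
    then show ?thesis using False ab unfolding F Q by (simp add: d b0 algebra_simps)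
  qed
qed

text \<open>For arguments of opposite sign all terms of the divergence are nonnegative, and both sides are
comparable to \<open>\<bar>a\<bar> powr p + \<bar>b\<bar> powr p\<close>.\<close>

lemma bregman_bounds_opposite:
  assumes p: "1 < p" and ab: "a * b \<le> 0"
  shows "min 1 (p - 1) / 2 * (signed_powr b (p / 2) - signed_powr a (p / 2))\<^sup>2 \<le> bregman p a b"
    and "bregman p a b \<le> 2 * max 1 (p - 1) * (signed_powr b (p / 2) - signed_powr a (p / 2))\<^sup>2"
proof -
  define X Y where "X = \<bar>a\<bar> powr p" "Y = \<bar>b\<bar> powr p"
  note d = this
  define s t where "s = signed_powr a (p / 2)" "t = signed_powr b (p / 2)"
  have st: "s\<^sup>2 = X" "t\<^sup>2 = Y" unfolding s_t_def d by (auto simp: signed_powr_half_squared)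
  have "s * t = \<bar>a\<bar> powr (p / 2) * \<bar>b\<bar> powr (p / 2) * sgn (a * b)"
    unfolding s_t_def signed_powr_def by (simp add: sgn_mult)
  then have neg: "s * t \<le> 0" using ab by (auto simp: mult_nonneg_nonpos sgn_if)
  have W: "signed_powr a (p - 1) * b = - (\<bar>a\<bar> powr (p - 1) * \<bar>b\<bar>)"
    using ab by (auto simp: signed_powr_def sgn_if mult_le_0_iff abs_if)
  have F: "bregman p a b = Y + (p - 1) * X + p * (\<bar>a\<bar> powr (p - 1) * \<bar>b\<bar>)"
    using p by (simp add: bregman_expand W d)
  have yg: "p * (\<bar>a\<bar> powr (p - 1) * \<bar>b\<bar>) \<le> Y + (p - 1) * X"
    using bregman_nonneg[OF p, of "\<bar>a\<bar>" "\<bar>b\<bar>"] p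
    by (cases "a = 0") (auto simp: bregman_expand d signed_powr_def)
  have sq: "0 \<le> (s + t)\<^sup>2" by simp
  have Q1: "(t - s)\<^sup>2 \<le> 2 * (X + Y)" "X + Y \<le> (t - s)\<^sup>2"
    using neg sq st by (simp_all add: power2_diff power2_sum algebra_simps)
  have XY: "0 \<le> X" "0 \<le> Y" by (auto simp: d)
  have l: "min 1 (p - 1) * (X + Y) \<le> Y + (p - 1) * X"
    using mult_right_mono[of "min 1 (p-1)" 1 Y] mult_right_mono[of "min 1 (p-1)" "p-1" X] XY p
    unfolding distrib_left by fastforce
  have u: "Y + (p - 1) * X \<le> max 1 (p - 1) * (X + Y)"
    using mult_right_mono[of 1 "max 1 (p-1)" Y] mult_right_mono[of "p-1" "max 1 (p-1)" X] XY p
    unfolding distrib_left by fastforce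
  have "min 1 (p - 1) / 2 * (t - s)\<^sup>2 \<le> min 1 (p - 1) / 2 * (2 * (X + Y))"
    using Q1 p by (intro mult_left_mono) auto
  also have "\<dots> = min 1 (p - 1) * (X + Y)" by (simp only: times_divide_eq_left)
  also have "\<dots> \<le> Y + (p - 1) * X" using l .
  also have "\<dots> \<le> bregman p a b" using F p by simp
  finally show "min 1 (p - 1) / 2 * (signed_powr b (p / 2) - signed_powr a (p / 2))\<^sup>2 \<le> bregman p a b"
    unfolding s_t_def .
  have "bregman p a b \<le> 2 * (max 1 (p - 1) * (X + Y))" using F yg u by linarith
  also have "\<dots> \<le> 2 * (max 1 (p - 1) * (t - s)\<^sup>2)"
    using Q1 by (intro mult_left_mono) auto
  finally show "bregman p a b \<le> 2 * max 1 (p - 1) * (signed_powr b (p / 2) - signed_powr a (p / 2))\<^sup>2"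
    unfolding s_t_def by simp
qed

text \<open>The two-point inequality that links the \<open>p\<close>-energy to the quadratic form: it makes
squared increments of the signed \<open>p/2\<close>-th power both a minorant and a majorant of
the Bregman divergence.\<close>

lemma bregman_bounds:
  assumes p: "1 < p"
  shows "min 1 (p - 1) / 2 * (signed_powr b (p / 2) - signed_powr a (p / 2))\<^sup>2 \<le> bregman p a b"
    and "bregman p a b \<le> 2 * max 1 (p - 1) * (signed_powr b (p / 2) - signed_powr a (p / 2))\<^sup>2"
proof -
  let ?Q = "(signed_powr b (p / 2) - signed_powr a (p / 2))\<^sup>2"
  have pos: "min 1 (p - 1) / 2 * ?Q \<le> min 1 (p - 1) * ?Q" "max 1 (p - 1) * ?Q \<le> 2 * max 1 (p - 1) * ?Q"
    using p by (auto intro!: mult_right_mono)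
  have m: "(signed_powr (-b) (p / 2) - signed_powr (-a) (p / 2))\<^sup>2 = ?Q"
    by (simp add: signed_powr_minus power2_commute)
  consider "a * b \<le> 0" | "0 < a" "0 < b" | "0 < -a" "0 < -b"
    by (smt (verit) mult_le_0_iff)
  then have "min 1 (p - 1) / 2 * ?Q \<le> bregman p a b \<and> bregman p a b \<le> 2 * max 1 (p - 1) * ?Q"
  proof cases
    case 1 then show ?thesis using bregman_bounds_opposite[OF p] by blast
  next
    case 2 then show ?thesis using bregman_bounds_pos[OF p 2] pos by linarith
  next
    case 3 then show ?thesis
      using bregman_bounds_pos[OF p 3] pos unfolding m bregman_minus by linarith
  qed
  then show "min 1 (p - 1) / 2 * ?Q \<le> bregman p a b" "bregman p a b \<le> 2 * max 1 (p - 1) * ?Q" by auto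
qed

text \<open>Splitting into positive and negative part makes continuity at 0 visible.\<close>

lemma signed_powr_eq:
  assumes "0 < k"
  shows "signed_powr a k = max 0 a powr k - max 0 (- a) powr k"
  using assms by (auto simp: signed_powr_def sgn_if max_def)

lemma continuous_on_signed_powr [continuous_intros]:
  assumes "0 < k" "continuous_on S f"
  shows "continuous_on S (\<lambda>x. signed_powr (f x) k)"
  unfolding signed_powr_eq[OF assms(1)] using assms
  by (auto intro!: continuous_intros continuous_on_powr')

lemma continuous_on_bregman [continuous_intros]:
  assumes "1 < p" "continuous_on S f" "continuous_on S g"
  shows "continuous_on S (\<lambda>x. bregman p (f x) (g x))"
  unfolding bregman_def using assms
  by (auto intro!: continuous_intros continuous_on_powr')

lemma signed_powr_measurable [measurable]:
  assumes "f \<in> borel_measurable M"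
  shows "(\<lambda>x. signed_powr (f x) k) \<in> borel_measurable M"
  using assms unfolding signed_powr_def by measurable

lemma bregman_measurable [measurable]:
  assumes "f \<in> borel_measurable M" "g \<in> borel_measurable M"
  shows "(\<lambda>x. bregman p (f x) (g x)) \<in> borel_measurable M"
  using assms unfolding bregman_def by measurable

section \<open>Bregman integrals over a probability measure\<close>

lemma abs_le_powr:
  fixes a :: real assumes "1 \<le> p" shows "\<bar>a\<bar> \<le> 1 + \<bar>a\<bar> powr p"
proof (cases "\<bar>a\<bar> \<le> 1")
  case False
  then have "\<bar>a\<bar> powr 1 \<le> \<bar>a\<bar> powr p" using assms by (intro powr_mono) auto
  then show ?thesis by auto
qed (auto intro: add_increasing2)

lemma (in prob_space) integrable_of_powr:
  fixes g :: "'a \<Rightarrow> real"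
  assumes "1 < p" "g \<in> borel_measurable M" "integrable M (\<lambda>x. \<bar>g x\<bar> powr p)"
  shows "integrable M g"
proof (rule Bochner_Integration.integrable_bound)
  show "integrable M (\<lambda>x. 1 + \<bar>g x\<bar> powr p)" using assms by simp
  show "AE x in M. norm (g x) \<le> norm (1 + \<bar>g x\<bar> powr p)"
    using abs_le_powr[of p] assms by (auto intro!: AE_I2 simp: abs_of_nonneg)
qed (use assms in auto)

text \<open>For fixed \<open>c\<close> the divergence is an affine function of \<open>\<bar>g y\<bar> powr
p\<close> and \<open>g y\<close>, so its integral only sees the \<open>p\<close>-th absolute
moment and the mean.\<close>

lemma (in prob_space) nn_integral_bregman:
  fixes g :: "'a \<Rightarrow> real"
  assumes p: "1 < p" and g [measurable]: "g \<in> borel_measurable M" and i: "integrable M (\<lambda>x. \<bar>g x\<bar> powr p)"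
  shows "(\<integral>\<^sup>+y. ennreal (bregman p c (g y)) \<partial>M) =
    ennreal ((\<integral>y. \<bar>g y\<bar> powr p \<partial>M) - \<bar>c\<bar> powr p - p * signed_powr c (p - 1) * ((\<integral>y. g y \<partial>M) - c))"
proof -
  note ig = integrable_of_powr[OF p g i]
  have 1: "integrable M (\<lambda>y. bregman p c (g y))"
    unfolding bregman_def using i ig by simp
  have "(\<integral>\<^sup>+y. ennreal (bregman p c (g y)) \<partial>M) = ennreal (\<integral>y. bregman p c (g y) \<partial>M)"
    using bregman_nonneg[OF p] by (intro nn_integral_eq_integral[OF 1]) auto
  also have "(\<integral>y. bregman p c (g y) \<partial>M) =
     (\<integral>y. \<bar>g y\<bar> powr p \<partial>M) - \<bar>c\<bar> powr p - p * signed_powr c (p - 1) * ((\<integral>y. g y \<partial>M) - c)"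
    unfolding bregman_def using i ig by (simp add: prob_space)
  finally show ?thesis .
qed

text \<open>Jensen's inequality for the \<open>p\<close>-th power, as nonnegativity of the integrated
divergence from the mean.\<close>

lemma (in prob_space) abs_mean_powr_le:
  fixes g :: "'a \<Rightarrow> real"
  assumes p: "1 < p" and g [measurable]: "g \<in> borel_measurable M" and i: "integrable M (\<lambda>x. \<bar>g x\<bar> powr p)"
  shows "\<bar>\<integral>y. g y \<partial>M\<bar> powr p \<le> (\<integral>y. \<bar>g y\<bar> powr p \<partial>M)"
proof -
  note ig = integrable_of_powr[OF p g i]
  have "0 \<le> (\<integral>y. bregman p (\<integral>y. g y \<partial>M) (g y) \<partial>M)"
    by (intro Bochner_Integration.integral_nonneg) (auto intro!: bregman_nonneg p)
  also have "\<dots> = (\<integral>y. \<bar>g y\<bar> powr p \<partial>M) - \<bar>\<integral>y. g y \<partial>M\<bar> powr p"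
    unfolding bregman_def using i ig by (simp add: prob_space)
  finally show ?thesis by simp
qed

lemma (in prob_space) nn_integral_bregman_mean:
  fixes g :: "'a \<Rightarrow> real"
  assumes p: "1 < p" and g [measurable]: "g \<in> borel_measurable M" and i: "integrable M (\<lambda>x. \<bar>g x\<bar> powr p)"
  shows "(\<integral>\<^sup>+y. ennreal (bregman p (\<integral>y. g y \<partial>M) (g y)) \<partial>M) + ennreal (\<bar>\<integral>y. g y \<partial>M\<bar> powr p)
    = (\<integral>\<^sup>+y. ennreal (\<bar>g y\<bar> powr p) \<partial>M)"
proof -
  have "(\<integral>\<^sup>+y. ennreal (\<bar>g y\<bar> powr p) \<partial>M) = ennreal (\<integral>y. \<bar>g y\<bar> powr p \<partial>M)"
    by (intro nn_integral_eq_integral[OF i]) auto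
  then show ?thesis
    unfolding nn_integral_bregman[OF assms] using abs_mean_powr_le[OF assms]
    by (simp add: ennreal_plus[symmetric] del: ennreal_plus)
qed

text \<open>The two sides differ by the divergence between \<open>c\<close> and the mean. Thus the mean is
the best constant approximation, as it is for \<open>p = 2\<close>.\<close>

lemma (in prob_space) nn_integral_bregman_mean_le:
  fixes g :: "'a \<Rightarrow> real"
  assumes p: "1 < p" and g [measurable]: "g \<in> borel_measurable M" and i: "integrable M (\<lambda>x. \<bar>g x\<bar> powr p)"
  shows "(\<integral>\<^sup>+y. ennreal (bregman p (\<integral>y. g y \<partial>M) (g y)) \<partial>M) \<le> (\<integral>\<^sup>+y. ennreal (bregman p c (g y)) \<partial>M)"
  unfolding nn_integral_bregman[OF assms]
  using bregman_nonneg[OF p, of c "\<integral>y. g y \<partial>M"] by (intro ennreal_leI) (simp add: bregman_def)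

section \<open>Invariance of the reference measure under the kernels\<close>

lemma radon_measure_on_UNIV_sets:
  assumes "radon_measure_on UNIV m" shows "sets m = sets borel" "space m = UNIV"
proof -
  show s: "sets m = sets borel"
    using assms by (simp add: radon_measure_on_def)
  then show "space m = UNIV" using sets_eq_imp_space_eq[OF s] by simp
qed

lemma locally_compact_cball:
  fixes x :: "'a :: metric_space"
  assumes "locally compact (UNIV :: 'a set)"
  obtains s where "0 < s" "compact (cball x s)"
proof -
  obtain U V where U: "open U" "compact V" "x \<in> U" "U \<subseteq> V"
    using assms unfolding locally_def by (auto dest!: spec[of _ UNIV] spec[of _ x])
  then obtain s where s: "0 < s" "cball x s \<subseteq> U"
    using open_contains_cball by blast
  have "compact (cball x s)"
  proof -
    have "V \<inter> cball x s = cball x s" using s U(4) by blast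
    then show ?thesis using compact_Int_closed[OF U(2) closed_cball, of x s] by simp
  qed
  then show ?thesis using that s by blast
qed

text \<open>By local compactness the open sets of finite measure cover the space, and countably many of them
suffice by second countability.\<close>

lemma radon_sigma_finite:
  fixes m :: "'a :: {metric_space, second_countable_topology} measure"
  assumes lc: "locally compact (UNIV :: 'a set)" and r: "radon_measure_on UNIV m"
  shows "sigma_finite_measure m"
proof
  note [simp] = radon_measure_on_UNIV_sets[OF r]
  let ?F = "{U. open U \<and> emeasure m U < \<infinity>}"
  obtain F where F: "F \<subseteq> ?F" "countable F" "\<Union>F = \<Union>?F"
    using Lindelof[of ?F] by blast
  have "x \<in> \<Union>?F" for x :: 'a
  proof -
    obtain s where s: "0 < s" "compact (cball x s)" using locally_compact_cball[OF lc] .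
    have "emeasure m (ball x s) \<le> emeasure m (cball x s)"
      using s by (intro emeasure_mono) auto
    also have "\<dots> < \<infinity>" using r s by (auto simp: radon_measure_on_def)
    finally show ?thesis using s by (intro UnionI[of "ball x s"]) auto
  qed
  then have "\<Union>F = UNIV" using F by auto
  then show "\<exists>A. countable A \<and> A \<subseteq> sets m \<and> \<Union> A = space m \<and> (\<forall>a\<in>A. emeasure m a \<noteq> \<infinity>)"
    using F by (intro exI[of _ F]) (auto simp: less_top)
qed

locale markov_semigroup_kernels =
  fixes m :: "'a::{metric_space, second_countable_topology} measure"
    and K :: "real \<Rightarrow> 'a \<Rightarrow> 'a measure"
  assumes sets_m [measurable_cong]: "sets m = sets borel"
    and sf: "sigma_finite_measure m"
    and kernels: "sub_markov_kernels K"
    and semigroup: "symmetric_markov_semigroup m (kernel_op K)"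
    and conserv: "conservative m (kernel_op K)"
begin

abbreviation "P \<equiv> kernel_op K"

definition energy :: "real \<Rightarrow> ('a \<Rightarrow> real) \<Rightarrow> ennreal" where
  "energy p g = (\<integral>\<^sup>+x. ennreal (\<bar>g x\<bar> powr p) \<partial>m)"

text \<open>Integration with respect to the measure \<open>K t x (dy) m(dx)\<close> on pairs, the joint law
of the states at times 0 and \<open>t\<close> under the initial measure \<open>m\<close>.\<close>

definition joint :: "real \<Rightarrow> ('a \<Rightarrow> 'a \<Rightarrow> ennreal) \<Rightarrow> ennreal" where
  "joint t F = (\<integral>\<^sup>+x. (\<integral>\<^sup>+y. F x y \<partial>K t x) \<partial>m)"

lemma space_m [simp]: "space m = UNIV"
  using sets_eq_imp_space_eq[OF sets_m] by simp

lemma K_meas: "0 \<le> t \<Longrightarrow> K t \<in> borel \<rightarrow>\<^sub>M subprob_algebra borel"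
  using kernels by (simp add: sub_markov_kernels_def)

lemma K_meas': "0 \<le> t \<Longrightarrow> K t \<in> m \<rightarrow>\<^sub>M subprob_algebra borel"
  using K_meas measurable_cong_sets[OF sets_m refl, of "subprob_algebra borel"] by simp

lemma sets_K [measurable_cong]: "0 \<le> t \<Longrightarrow> sets (K t x) = sets borel"
  using measurable_space[OF K_meas, of t x] by (auto simp: space_subprob_algebra)

lemma space_K [simp]: "0 \<le> t \<Longrightarrow> space (K t x) = UNIV"
  using sets_eq_imp_space_eq[OF sets_K] by simp

lemma meas_K_iff: "0 \<le> t \<Longrightarrow> f \<in> borel_measurable (K t x) \<longleftrightarrow> f \<in> borel_measurable borel"
  using measurable_cong_sets[OF sets_K refl] by blast

lemma meas_m_iff: "f \<in> borel_measurable m \<longleftrightarrow> f \<in> borel_measurable borel"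
  using measurable_cong_sets[OF sets_m refl] by blast

lemma subprob_K: "0 \<le> t \<Longrightarrow> subprob_space (K t x)"
  using measurable_space[OF K_meas, of t x] by (auto simp: space_subprob_algebra)

lemma P_meas [measurable]:
  assumes "0 \<le> t" "f \<in> borel_measurable borel"
  shows "P t f \<in> borel_measurable borel"
  unfolding kernel_op_def
  using measurable_compose[OF K_meas[OF assms(1)] integral_measurable_subprob_algebra[OF assms(2)]] .

lemma nn_K_meas [measurable]:
  assumes t: "0 \<le> t" and f: "(\<lambda>(x, y). f x y) \<in> borel_measurable (borel \<Otimes>\<^sub>M borel)"
  shows "(\<lambda>x. \<integral>\<^sup>+y. f x y \<partial>K t x) \<in> borel_measurable borel"
  by (rule nn_integral_measurable_subprob_algebra2[OF f K_meas[OF t]])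

lemma borel_pair: "borel \<Otimes>\<^sub>M borel = (borel :: ('a \<times> 'a) measure)"
  by (rule borel_prod)

lemma
  assumes h: "0 \<le> h" and F: "(\<lambda>(x, y). F x y) \<in> borel_measurable (borel :: ('a \<times> 'a) measure)"
  shows measurable_section_K: "F x \<in> borel_measurable (K h x')"
    and measurable_section_integral: "(\<lambda>x. \<integral>\<^sup>+y. F x y \<partial>K h x) \<in> borel_measurable m"
  using measurable_Pair2[of "\<lambda>(x, y). F x y" borel borel borel x] nn_K_meas[OF h, of F] F
  unfolding meas_K_iff[OF h] meas_m_iff by (simp_all add: borel_pair)

lemma joint_cmult:
  assumes h: "0 \<le> h" and F: "(\<lambda>(x, y). F x y) \<in> borel_measurable (borel :: ('a \<times> 'a) measure)"
  shows "joint h (\<lambda>x y. c * F x y) = c * joint h F"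
  unfolding joint_def using measurable_section_K[OF h F] measurable_section_integral[OF h F]
  by (simp add: nn_integral_cmult)

lemma joint_add:
  assumes h: "0 \<le> h" and F: "(\<lambda>(x, y). F x y) \<in> borel_measurable (borel :: ('a \<times> 'a) measure)"
    and G: "(\<lambda>(x, y). G x y) \<in> borel_measurable (borel :: ('a \<times> 'a) measure)"
  shows "joint h (\<lambda>x y. F x y + G x y) = joint h F + joint h G"
  unfolding joint_def using measurable_section_K[OF h F] measurable_section_integral[OF h F]
    measurable_section_K[OF h G] measurable_section_integral[OF h G]
  by (simp add: nn_integral_add)

lemma joint_suminf:
  assumes h: "0 \<le> h" and F: "\<And>k. (\<lambda>(x, y). F k x y) \<in> borel_measurable (borel :: ('a \<times> 'a) measure)"
  shows "joint h (\<lambda>x y. \<Sum>k. F k x y) = (\<Sum>k. joint h (F k))"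
  unfolding joint_def using measurable_section_K[OF h F] measurable_section_integral[OF h F]
  by (simp add: nn_integral_suminf)

lemma AE_prob:
  assumes "0 \<le> t" shows "AE x in m. prob_space (K t x)"
proof -
  have "AE x in m. P t (\<lambda>y. 1) x = 1" using conserv assms by (simp add: conservative_def)
  then show ?thesis
  proof eventually_elim
    case (elim x)
    interpret subprob_space "K t x" by (rule subprob_K[OF assms])
    have "measure (K t x) UNIV = 1" using elim assms by (simp add: kernel_op_def)
    then show ?case using assms by (intro prob_spaceI) (simp add: emeasure_eq_measure)
  qed
qed

lemma indicator_Lp:
  assumes "A \<in> sets m" "emeasure m A < \<infinity>"
  shows "indicator A \<in> Lp q m"
proof -
  have "(\<lambda>x. \<bar>indicator A x\<bar> powr q) = (indicator A :: 'a \<Rightarrow> real)"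
    by (auto simp: indicator_def fun_eq_iff)
  then show ?thesis using assms by (auto simp: Lp_def)
qed

text \<open>By symmetry, the mass that \<open>P t\<close> moves from \<open>A\<close> into a set
\<open>B\<close> equals the mass moved from \<open>B\<close> into \<open>A\<close>. Letting
\<open>B\<close> exhaust the space, conservativeness turns the first quantity into the measure
of \<open>A\<close>.\<close>

lemma indicator_invariant:
  assumes t: "0 \<le> t" and A: "A \<in> sets m" "emeasure m A < \<infinity>"
  shows "(\<integral>\<^sup>+x. emeasure (K t x) A \<partial>m) = emeasure m A"
proof -
  note [measurable] = K_meas[OF t]
  obtain E where E: "range E \<subseteq> sets m" "(\<Union>i. E i) = space m" "\<And>i. emeasure m (E i) \<noteq> \<infinity>" "incseq E"
    using sigma_finite_measure.sigma_finite_incseq[OF sf] by blast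
  have Es [measurable]: "E i \<in> sets borel" "A \<in> sets borel" for i
    using E A by (auto simp: sets_m)
  have PK: "P t (indicator B) x = measure (K t x) B" if "B \<in> sets borel" for B x
  proof -
    interpret subprob_space "K t x" by (rule subprob_K[OF t])
    show ?thesis using that t by (simp add: kernel_op_def sets_K)
  qed
  have em: "ennreal (measure (K t x) B) = emeasure (K t x) B" for B x
  proof -
    interpret subprob_space "K t x" by (rule subprob_K[OF t])
    show ?thesis by (simp add: emeasure_eq_measure)
  qed
  have key: "(\<integral>\<^sup>+x. emeasure (K t x) A * indicator B x \<partial>m) = (\<integral>\<^sup>+x. indicator A x * emeasure (K t x) B \<partial>m)"
    if B [measurable]: "B \<in> sets borel" and fin: "emeasure m B < \<infinity>" for B
  proof -
    have s: "L2_inner m (P t (indicator A)) (indicator B) = L2_inner m (indicator A) (P t (indicator B))"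
      using semigroup t indicator_Lp A that sets_m by (auto simp: symmetric_markov_semigroup_def)
    have m1: "(\<lambda>x. measure (K t x) C) \<in> borel_measurable m" if "C \<in> sets borel" for C
      using that PK[OF that] P_meas[OF t, of "indicator C"] by (simp add: meas_m_iff)
    have b: "measure (K t x) C \<le> 1" for x C
    proof -
      interpret subprob_space "K t x" by (rule subprob_K[OF t])
      show ?thesis by (rule subprob_measure_le_1)
    qed
    have iB: "integrable m (indicator B :: 'a \<Rightarrow> real)" "integrable m (indicator A :: 'a \<Rightarrow> real)"
      using fin A B sets_m by (auto intro!: integrable_real_indicator)
    have [measurable]: "(\<lambda>x. measure (K t x) A) \<in> borel_measurable m" "(\<lambda>x. measure (K t x) B) \<in> borel_measurable m"
      using m1 by auto
    have i1: "integrable m (\<lambda>x. measure (K t x) A * indicator B x)"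
      using b by (intro Bochner_Integration.integrable_bound[OF iB(1)]) (auto split: split_indicator)
    have i2: "integrable m (\<lambda>x. indicator A x * measure (K t x) B)"
      using b by (intro Bochner_Integration.integrable_bound[OF iB(2)]) (auto split: split_indicator)
    have "(\<integral>\<^sup>+x. emeasure (K t x) A * indicator B x \<partial>m) = (\<integral>\<^sup>+x. ennreal (measure (K t x) A * indicator B x) \<partial>m)"
      by (auto intro!: nn_integral_cong simp: em[symmetric] indicator_def)
    also have "\<dots> = ennreal (L2_inner m (P t (indicator A)) (indicator B))"
      using PK by (subst nn_integral_eq_integral[OF i1]) (auto simp: L2_inner_def)
    also have "\<dots> = ennreal (\<integral>x. indicator A x * measure (K t x) B \<partial>m)"
      using PK unfolding s by (simp add: L2_inner_def)
    also have "\<dots> = (\<integral>\<^sup>+x. ennreal (indicator A x * measure (K t x) B) \<partial>m)"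
      by (subst nn_integral_eq_integral[OF i2]) auto
    also have "\<dots> = (\<integral>\<^sup>+x. indicator A x * emeasure (K t x) B \<partial>m)"
      by (auto intro!: nn_integral_cong simp: em[symmetric] indicator_def)
    finally show ?thesis .
  qed
  have incE: "indicator (E i) x \<le> (indicator (E (Suc i)) x :: ennreal)" for i x
    using incseq_SucD[OF E(4), of i] by (auto simp: indicator_def)
  have supE: "(SUP i. indicator (E i) x) = (1::ennreal)" for x
  proof -
    obtain i where "x \<in> E i" using E(2) by auto
    then have "1 \<le> (SUP i. indicator (E i) x :: ennreal)"
      by (intro SUP_upper2[of i]) (auto simp: indicator_def)
    moreover have "(SUP i. indicator (E i) x :: ennreal) \<le> 1"
      by (intro SUP_least) (auto simp: indicator_def)
    ultimately show ?thesis by (rule antisym[rotated])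
  qed
  have "(\<integral>\<^sup>+x. emeasure (K t x) A \<partial>m) = (\<integral>\<^sup>+x. (SUP i. emeasure (K t x) A * indicator (E i) x) \<partial>m)"
    by (simp add: SUP_mult_left_ennreal[symmetric] supE)
  also have "\<dots> = (SUP i. \<integral>\<^sup>+x. emeasure (K t x) A * indicator (E i) x \<partial>m)"
    using incE by (intro nn_integral_monotone_convergence_SUP)
      (auto simp: incseq_Suc_iff le_fun_def intro!: mult_left_mono)
  also have "\<dots> = (SUP i. \<integral>\<^sup>+x. indicator A x * emeasure (K t x) (E i) \<partial>m)"
    using key E by (simp add: less_top)
  also have "\<dots> = (\<integral>\<^sup>+x. (SUP i. indicator A x * emeasure (K t x) (E i)) \<partial>m)"
    using E(4) by (intro nn_integral_monotone_convergence_SUP[symmetric])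
      (auto simp: incseq_Suc_iff le_fun_def sets_K[OF t] intro!: mult_left_mono emeasure_mono)
  also have "\<dots> = (\<integral>\<^sup>+x. indicator A x * emeasure (K t x) UNIV \<partial>m)"
  proof (intro nn_integral_cong)
    fix x
    have "(SUP i. emeasure (K t x) (E i)) = emeasure (K t x) (\<Union>i. E i)"
      using E by (intro SUP_emeasure_incseq) (auto simp: sets_K[OF t] sets_m)
    then show "(SUP i. indicator A x * emeasure (K t x) (E i)) = indicator A x * emeasure (K t x) UNIV"
      using E(2) by (simp add: SUP_mult_left_ennreal[symmetric])
  qed
  also have "\<dots> = (\<integral>\<^sup>+x. indicator A x \<partial>m)"
    using AE_prob[OF t]
  proof (intro nn_integral_cong_AE, eventually_elim)
    case (elim x)
    interpret prob_space "K t x" by (rule elim)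
    show ?case using emeasure_space_1 t by simp
  qed
  also have "\<dots> = emeasure m A" using A by simp
  finally show ?thesis .
qed

lemma invariant:
  assumes t: "0 \<le> t" shows "m \<bind> K t = m"
proof -
  interpret sigma_finite_measure m by (rule sf)
  obtain E where E: "range E \<subseteq> sets m" "(\<Union>i. E i) = space m" "\<And>i. emeasure m (E i) \<noteq> \<infinity>" "incseq E"
    using sigma_finite_incseq by blast
  have sb: "sets (m \<bind> K t) = sets borel"
    by (rule sets_bind_measurable[OF K_meas'[OF t]]) simp
  have fin: "emeasure (m \<bind> K t) A = emeasure m A" if "A \<in> sets m" "emeasure m A < \<infinity>" for A
    using that indicator_invariant[OF t that] by (subst emeasure_bind[OF _ K_meas'[OF t]]) (auto simp: sets_m)
  have fE: "emeasure m (A \<inter> E i) < \<infinity>" "A \<inter> E i \<in> sets m" if "A \<in> sets m" for A i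
  proof -
    show s: "A \<inter> E i \<in> sets m" using E that by blast
    have "emeasure m (A \<inter> E i) \<le> emeasure m (E i)" using E by (intro emeasure_mono) auto
    then show "emeasure m (A \<inter> E i) < \<infinity>" using E(3)[of i] by (auto simp: less_top intro: order_le_less_trans)
  qed
  show ?thesis
  proof (rule measure_eqI)
    fix A assume "A \<in> sets (m \<bind> K t)"
    then have A: "A \<in> sets m" by (simp add: sb sets_m)
    have UA: "(\<Union>i. A \<inter> E i) = A" using E(2) by auto
    have inc: "incseq (\<lambda>i. A \<inter> E i)" using E(4) by (auto simp: incseq_def)
    have "emeasure (m \<bind> K t) A = (SUP i. emeasure (m \<bind> K t) (A \<inter> E i))"
      using fE[OF A] inc sb sets_m by (subst SUP_emeasure_incseq) (auto simp del: UN_simps simp: UA)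
    also have "\<dots> = (SUP i. emeasure m (A \<inter> E i))" using fin fE[OF A] by simp
    also have "\<dots> = emeasure m A" using fE[OF A] inc by (subst SUP_emeasure_incseq) (auto simp del: UN_simps simp: UA)
    finally show "emeasure (m \<bind> K t) A = emeasure m A" .
  qed (simp add: sb sets_m)
qed

lemma nn_invariant:
  assumes t: "0 \<le> t" and g: "g \<in> borel_measurable borel"
  shows "(\<integral>\<^sup>+x. (\<integral>\<^sup>+y. g y \<partial>K t x) \<partial>m) = (\<integral>\<^sup>+x. g x \<partial>m)"
  using nn_integral_bind[OF g K_meas'[OF t]] invariant[OF t] by simp

lemma AE_K:
  assumes t: "0 \<le> t" and ae: "AE x in m. Q x"
  shows "AE x in m. AE y in K t x. Q y"
proof -
  obtain N where N: "{x \<in> space m. \<not> Q x} \<subseteq> N" "emeasure m N = 0" "N \<in> sets m"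
    using ae by (rule AE_E)
  have [measurable]: "N \<in> sets borel" using N(3) by (simp add: sets_m)
  have "AE x in m \<bind> K t. x \<notin> N" unfolding invariant[OF t] using N by (intro AE_not_in) auto
  then have "AE x in m. AE y in K t x. y \<notin> N"
    by (subst (asm) AE_bind[OF K_meas'[OF t]]) auto
  then show ?thesis
    using N(1) by (auto elim!: eventually_mono)
qed

end

section \<open>The semigroup on functions with integrable p-th power\<close>

lemma filterlim_at_right_0_sequence:
  fixes h :: "nat \<Rightarrow> real"
  assumes "\<And>n. 0 < h n" "h \<longlonglongrightarrow> 0"
  shows "filterlim h (at_right 0) sequentially"
  unfolding filterlim_at using assms by (auto intro!: always_eventually simp: less_le)

text \<open>A form of Pratt's dominated convergence argument: if the sum of two sequences is at most a
sequence with limit \<open>i + y\<close>, a lower bound by \<open>y\<close> for one becomes an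
upper bound by \<open>i\<close> for the other.\<close>

lemma limsup_le_of_complement:
  fixes X T Z :: "nat \<Rightarrow> ennreal"
  assumes sum: "\<And>n. X n + T n \<le> Z n" and Z: "Z \<longlonglongrightarrow> z" and iy: "i + y = z" and fin: "z < \<infinity>"
    and T: "y \<le> liminf T"
  shows "limsup X \<le> i"
proof -
  have yfin: "y < \<infinity>" using iy fin by (auto simp: less_top[symmetric])
  have *: "limsup X \<le> i + ennreal e" if e: "0 < e" for e :: real
  proof (rule Limsup_bounded)
    have z: "z < z + ennreal (e/2)" using fin e by (cases z) (auto simp: ennreal_plus[symmetric] ennreal_less_iff simp del: ennreal_plus)
    have "\<forall>\<^sub>F n in sequentially. y \<le> T n + ennreal (e/2)"
    proof (cases "y = 0")
      case False
      then have "y - ennreal (e/2) < y"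
        using e yfin False by (intro ennreal_between(1)) (auto simp: zero_less_iff_neq_zero)
      then have "y - ennreal (e/2) < liminf T" using T by simp
      then have "\<forall>\<^sub>F n in sequentially. y - ennreal (e/2) < T n" by (rule less_LiminfD)
      then show ?thesis
        by eventually_elim (metis add.commute ennreal_minus_le_iff less_imp_le)
    qed simp
    moreover have "\<forall>\<^sub>F n in sequentially. Z n < z + ennreal (e/2)"
      using order_tendstoD(2)[OF Z z] .
    ultimately show "\<forall>\<^sub>F n in sequentially. X n \<le> i + ennreal e"
    proof eventually_elim
      case (elim n)
      have Tfin: "T n < \<infinity>"
      proof -
        have "T n \<le> Z n" by (rule order_trans[OF _ sum]) simp
        also have "\<dots> < \<infinity>" using elim(2) by (rule less_le_trans) simp
        finally show ?thesis .
      qed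
      have "T n + X n \<le> i + y + ennreal (e/2)" using le_less_trans[OF sum elim(2)] iy by (simp add: add.commute)
      also have "\<dots> \<le> i + (T n + ennreal (e/2)) + ennreal (e/2)" using elim(1) by (intro add_mono) auto
      also have "\<dots> = T n + (i + (ennreal (e/2) + ennreal (e/2)))" by (simp only: ac_simps)
      also have "ennreal (e/2) + ennreal (e/2) = ennreal e" using e by (simp add: ennreal_plus[symmetric] del: ennreal_plus)
      finally show ?case using Tfin by (auto simp: ennreal_add_left_cancel_le)
    qed
  qed
  show ?thesis
  proof (rule ennreal_le_epsilon)
    fix e :: real assume "0 < e" then show "limsup X \<le> i + ennreal e" by (rule *)
  qed
qed

lemma abs_powr_add_le:
  fixes a b :: real assumes "0 < p"
  shows "\<bar>a + b\<bar> powr p \<le> 2 powr p * (\<bar>a\<bar> powr p + \<bar>b\<bar> powr p)"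
proof -
  have "\<bar>a + b\<bar> powr p \<le> (2 * max \<bar>a\<bar> \<bar>b\<bar>) powr p"
    using assms by (intro powr_mono2) auto
  also have "\<dots> = 2 powr p * max \<bar>a\<bar> \<bar>b\<bar> powr p" by (simp add: powr_mult)
  also have "\<dots> \<le> 2 powr p * (\<bar>a\<bar> powr p + \<bar>b\<bar> powr p)"
    by (intro mult_left_mono) (auto simp: max_def)
  finally show ?thesis .
qed

context markov_semigroup_kernels
begin

lemma Lp_iff: "f \<in> Lp p m \<longleftrightarrow> f \<in> borel_measurable borel \<and> energy p f < \<infinity>"
proof -
  have "integrable m (\<lambda>x. \<bar>f x\<bar> powr p) \<longleftrightarrow> energy p f < \<infinity>" if "f \<in> borel_measurable borel"
    unfolding energy_def using that
    by (subst integrable_iff_bounded) (auto simp: meas_m_iff)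
  then show ?thesis by (auto simp: Lp_def meas_m_iff)
qed

lemma Lp_meas [measurable_dest]: "f \<in> Lp p m \<Longrightarrow> f \<in> borel_measurable borel"
  by (simp add: Lp_iff)

lemma energy_mono_AE:
  assumes "0 \<le> p" "AE x in m. \<bar>f x\<bar> \<le> \<bar>g x\<bar>" shows "energy p f \<le> energy p g"
  unfolding energy_def using assms(2)
  by (intro nn_integral_mono_AE) (auto elim!: eventually_mono intro!: ennreal_leI powr_mono2 assms(1))

lemma energy_add_le:
  assumes "0 < p" "f \<in> borel_measurable borel" "g \<in> borel_measurable borel"
  shows "energy p (\<lambda>x. f x + g x) \<le> ennreal (2 powr p) * (energy p f + energy p g)"
proof -
  note [measurable] = assms(2,3)
  have "energy p (\<lambda>x. f x + g x) \<le> (\<integral>\<^sup>+x. ennreal (2 powr p) * (ennreal (\<bar>f x\<bar> powr p) + ennreal (\<bar>g x\<bar> powr p)) \<partial>m)"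
    unfolding energy_def using abs_powr_add_le[OF assms(1)]
    by (intro nn_integral_mono) (simp add: ennreal_mult[symmetric] ennreal_plus[symmetric] del: ennreal_plus)
  also have "\<dots> = ennreal (2 powr p) * (energy p f + energy p g)"
    unfolding energy_def by (simp add: nn_integral_cmult nn_integral_add meas_m_iff)
  finally show ?thesis .
qed

lemma Lp_add:
  assumes "0 < p" "f \<in> Lp p m" "g \<in> Lp p m" shows "(\<lambda>x. f x + g x) \<in> Lp p m"
  unfolding Lp_iff
proof
  have [measurable]: "f \<in> borel_measurable borel" "g \<in> borel_measurable borel" using assms by (auto simp: Lp_iff)
  show "(\<lambda>x. f x + g x) \<in> borel_measurable borel" by measurable
  have "energy p (\<lambda>x. f x + g x) \<le> ennreal (2 powr p) * (energy p f + energy p g)"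
    by (rule energy_add_le) (use assms in auto)
  also have "\<dots> < \<infinity>" using assms by (auto simp: Lp_iff ennreal_mult_less_top)
  finally show "energy p (\<lambda>x. f x + g x) < \<infinity>" .
qed

lemma Lp_le:
  assumes "0 < p" "f \<in> Lp p m" "g \<in> borel_measurable borel" "AE x in m. \<bar>g x\<bar> \<le> \<bar>f x\<bar>" shows "g \<in> Lp p m"
  using assms energy_mono_AE[of p g f] by (auto simp: Lp_iff)

lemma Lp_minus:
  assumes "f \<in> Lp p m" shows "(\<lambda>x. - f x) \<in> Lp p m"
  using assms by (simp add: Lp_iff energy_def)

lemma Lp_diff:
  assumes "0 < p" "f \<in> Lp p m" "g \<in> Lp p m" shows "(\<lambda>x. f x - g x) \<in> Lp p m"
  using Lp_add[OF assms(1,2) Lp_minus[OF assms(3)]] by simp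

lemma AE_integrable_powr:
  assumes t: "0 \<le> t" and f: "f \<in> Lp p m"
  shows "AE x in m. prob_space (K t x) \<and> f \<in> borel_measurable (K t x) \<and> integrable (K t x) (\<lambda>y. \<bar>f y\<bar> powr p)"
proof -
  have fm [measurable]: "f \<in> borel_measurable borel" using f by (simp add: Lp_iff)
  have "(\<integral>\<^sup>+x. (\<integral>\<^sup>+y. ennreal (\<bar>f y\<bar> powr p) \<partial>K t x) \<partial>m) = energy p f"
    unfolding energy_def by (rule nn_invariant[OF t]) measurable
  then have "(\<integral>\<^sup>+x. (\<integral>\<^sup>+y. ennreal (\<bar>f y\<bar> powr p) \<partial>K t x) \<partial>m) \<noteq> \<infinity>"
    using f by (auto simp: Lp_iff)
  then have "AE x in m. (\<integral>\<^sup>+y. ennreal (\<bar>f y\<bar> powr p) \<partial>K t x) \<noteq> \<infinity>"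
    using nn_K_meas[OF t, of "\<lambda>x y. ennreal (\<bar>f y\<bar> powr p)"]
    by (intro nn_integral_PInf_AE) (auto simp: meas_m_iff)
  with AE_prob[OF t] show ?thesis
  proof eventually_elim
    case (elim x)
    then show ?case
      by (auto intro!: integrableI_bounded simp: meas_K_iff[OF t] less_top)
  qed
qed

lemma AE_integrable:
  assumes p: "1 < p" and t: "0 \<le> t" and f: "f \<in> Lp p m"
  shows "AE x in m. integrable (K t x) f"
  using AE_integrable_powr[OF t f]
  by eventually_elim (auto intro: prob_space.integrable_of_powr[OF _ p])

text \<open>The energy balance of one step of the semigroup: the integrated divergence between
\<open>g\<close> and its conditional mean is exactly the \<open>p\<close>-energy that the step
destroys. Conservativeness and invariance enter here.\<close>

lemma joint_bregman_energy:
  assumes p: "1 < p" and t: "0 \<le> t" and g: "g \<in> Lp p m"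
  shows "joint t (\<lambda>x y. ennreal (bregman p (P t g x) (g y))) + energy p (P t g) = energy p g"
proof -
  have gm [measurable]: "g \<in> borel_measurable borel" using g by (simp add: Lp_iff)
  note [measurable] = P_meas[OF t gm]
  have 1: "(\<lambda>x. \<integral>\<^sup>+y. ennreal (bregman p (P t g x) (g y)) \<partial>K t x) \<in> borel_measurable m"
    unfolding meas_m_iff by (rule nn_K_meas[OF t]) measurable
  have 2: "(\<lambda>x. ennreal (\<bar>P t g x\<bar> powr p)) \<in> borel_measurable m"
    unfolding meas_m_iff by measurable
  have "joint t (\<lambda>x y. ennreal (bregman p (P t g x) (g y))) + energy p (P t g)
     = (\<integral>\<^sup>+x. (\<integral>\<^sup>+y. ennreal (bregman p (P t g x) (g y)) \<partial>K t x) + ennreal (\<bar>P t g x\<bar> powr p) \<partial>m)"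
    unfolding joint_def energy_def by (rule nn_integral_add[symmetric, OF 1 2])
  also have "\<dots> = (\<integral>\<^sup>+x. (\<integral>\<^sup>+y. ennreal (\<bar>g y\<bar> powr p) \<partial>K t x) \<partial>m)"
  proof (rule nn_integral_cong_AE)
    show "AE x in m. (\<integral>\<^sup>+y. ennreal (bregman p (P t g x) (g y)) \<partial>K t x) + ennreal (\<bar>P t g x\<bar> powr p)
        = (\<integral>\<^sup>+y. ennreal (\<bar>g y\<bar> powr p) \<partial>K t x)"
      using AE_integrable_powr[OF t g]
      by eventually_elim (auto simp: kernel_op_def prob_space.nn_integral_bregman_mean[OF _ p])
  qed
  also have "\<dots> = energy p g"
    unfolding energy_def by (rule nn_invariant[OF t]) measurable
  finally show ?thesis .
qed

text \<open>The mean is the pointwise minimiser, so any \<open>c\<close> gives an upper bound for the energy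
lost in one step.\<close>

lemma joint_bregman_mean_le:
  assumes p: "1 < p" and t: "0 \<le> t" and g: "g \<in> Lp p m"
  shows "joint t (\<lambda>x y. ennreal (bregman p (P t g x) (g y))) \<le> joint t (\<lambda>x y. ennreal (bregman p (c x) (g y)))"
  unfolding joint_def
proof (rule nn_integral_mono_AE)
  show "AE x in m. (\<integral>\<^sup>+y. ennreal (bregman p (P t g x) (g y)) \<partial>K t x)
      \<le> (\<integral>\<^sup>+y. ennreal (bregman p (c x) (g y)) \<partial>K t x)"
    using AE_integrable_powr[OF t g]
    by eventually_elim (auto simp: kernel_op_def intro!: prob_space.nn_integral_bregman_mean_le[OF _ p])
qed

lemma energy_P_le:
  assumes "1 < p" "0 \<le> t" "g \<in> Lp p m" shows "energy p (P t g) \<le> energy p g"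
  by (rule order_trans[OF _ eq_refl[OF joint_bregman_energy[OF assms]]]) (rule add_increasing, simp_all)

lemma P_Lp:
  assumes "1 < p" "0 \<le> t" "g \<in> Lp p m" shows "P t g \<in> Lp p m"
  using energy_P_le[OF assms] assms P_meas[of t g] by (auto simp: Lp_iff)

lemma P_cong_AE:
  assumes t: "0 \<le> t" and "f \<in> borel_measurable borel" "g \<in> borel_measurable borel" and ae: "AE x in m. f x = g x"
  shows "AE x in m. P t f x = P t g x"
  using AE_K[OF t ae]
  by (auto elim!: eventually_mono simp: kernel_op_def intro!: integral_cong_AE) (simp_all add: meas_K_iff t assms)

lemma P_diff_AE:
  assumes p: "1 < p" and t: "0 \<le> t" and f: "f \<in> Lp p m" and g: "g \<in> Lp p m"
  shows "AE x in m. P t (\<lambda>y. f y - g y) x = P t f x - P t g x"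
  using AE_integrable[OF p t f] AE_integrable[OF p t g]
  by eventually_elim (simp add: kernel_op_def)

lemma P_mono_AE:
  assumes p: "1 < p" and t: "0 \<le> t" and f: "f \<in> Lp p m" and g: "g \<in> Lp p m" and ae: "AE x in m. f x \<le> g x"
  shows "AE x in m. P t f x \<le> P t g x"
  using AE_integrable[OF p t f] AE_integrable[OF p t g] AE_K[OF t ae]
  by eventually_elim (simp add: kernel_op_def integral_mono_AE)

lemma P_nonneg:
  assumes "\<And>y. 0 \<le> f y" shows "0 \<le> P t f x"
  unfolding kernel_op_def by (rule Bochner_Integration.integral_nonneg) (use assms in auto)

lemma exhaustion:
  obtains E :: "nat \<Rightarrow> 'a set" where "\<And>i. E i \<in> sets borel" "(\<Union>i. E i) = UNIV"
    "\<And>i. emeasure m (E i) < \<infinity>" "incseq E"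
proof -
  obtain E where E: "range E \<subseteq> sets m" "(\<Union>i. E i) = space m" "\<And>i. emeasure m (E i) \<noteq> \<infinity>" "incseq E"
    using sigma_finite_measure.sigma_finite_incseq[OF sf] by blast
  then show ?thesis using that[of E] by (auto simp: sets_m less_top)
qed

lemma Lp_of_bounded:
  assumes "0 < q" "f \<in> borel_measurable borel" "A \<in> sets borel" "emeasure m A < \<infinity>"
    and "\<And>x. \<bar>f x\<bar> \<le> c * indicator A x"
  shows "f \<in> Lp q m"
proof -
  have fm: "(\<lambda>x. c * indicator A x :: real) \<in> borel_measurable borel" using assms(3) by measurable
  have "energy q (\<lambda>x. c * indicator A x) = (\<integral>\<^sup>+x. ennreal (\<bar>c\<bar> powr q) * indicator A x \<partial>m)"
    unfolding energy_def by (auto intro!: nn_integral_cong split: split_indicator)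
  also have "\<dots> = ennreal (\<bar>c\<bar> powr q) * emeasure m A"
    using assms(3) sets_m by (simp add: nn_integral_cmult_indicator)
  also have "\<dots> < \<infinity>" using assms(4) by (simp add: ennreal_mult_less_top)
  finally have "(\<lambda>x. c * indicator A x) \<in> Lp q m" using fm by (simp add: Lp_iff)
  then show ?thesis
    using assms by (intro Lp_le[OF assms(1) _ assms(2)]) (auto intro!: AE_I2 order_trans[OF assms(5)])
qed

lemma P_bounded_nn:
  assumes t: "0 \<le> t" and f: "f \<in> borel_measurable borel" "\<And>x. 0 \<le> f x" "\<And>x. f x \<le> c"
  shows "ennreal (P t f x) = (\<integral>\<^sup>+y. ennreal (f y) \<partial>K t x)" "P t f x \<le> c"
proof -
  interpret subprob_space "K t x" by (rule subprob_K[OF t])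
  have "integrable (K t x) f"
    using f by (intro integrable_const_bound[of _ c]) (auto simp: meas_K_iff[OF t])
  then show "ennreal (P t f x) = (\<integral>\<^sup>+y. ennreal (f y) \<partial>K t x)"
    unfolding kernel_op_def using f by (subst nn_integral_eq_integral) auto
  have "0 \<le> c" using f(2)[of x] f(3)[of x] by linarith
  have "P t f x \<le> (\<integral>y. c \<partial>K t x)"
    unfolding kernel_op_def using f \<open>integrable (K t x) f\<close> by (intro integral_mono) auto
  also have "\<dots> \<le> c" using subprob_measure_le_1[of UNIV] t \<open>0 \<le> c\<close> by (simp add: mult_left_le_one_le)
  finally show "P t f x \<le> c" .
qed

text \<open>The semigroup law is given on square integrable functions only. Truncations of \<open>g\<close>
in height and support are such functions and increase to \<open>g\<close>.\<close>

lemma nn_semigroup: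
  assumes s: "0 \<le> s" and t: "0 \<le> t" and g: "g \<in> borel_measurable borel" "\<And>x. 0 \<le> g x"
  shows "AE x in m. (\<integral>\<^sup>+y. ennreal (g y) \<partial>K (s + t) x) = (\<integral>\<^sup>+y. (\<integral>\<^sup>+z. ennreal (g z) \<partial>K t y) \<partial>K s x)"
proof -
  obtain E where E: "\<And>i. E i \<in> sets borel" "(\<Union>i. E i) = UNIV" "\<And>i. emeasure m (E i) < \<infinity>" "incseq E"
    by (rule exhaustion) blast
  define G where "G n x = min (g x) (real n) * indicator (E n) x" for n x
  have Gm [measurable]: "G n \<in> borel_measurable borel" for n
    unfolding G_def using g(1) E(1) by measurable
  have Gb: "0 \<le> G n x" "G n x \<le> real n" for n x
    using g(2)[of x] by (auto simp: G_def split: split_indicator)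
  have GL: "G n \<in> Lp 2 m" for n
    using g(2) by (intro Lp_of_bounded[OF _ Gm E(1)[of n] E(3)[of n], where c = "real n"]) (auto simp: G_def split: split_indicator)
  have Ginc: "G n x \<le> G (Suc n) x" for n x
    using g(2)[of x] incseq_SucD[OF E(4), of n] by (auto simp: G_def split: split_indicator)
  have sup: "(SUP n. ennreal (G n x)) = ennreal (g x)" for x
  proof (rule antisym)
    show "(SUP n. ennreal (G n x)) \<le> ennreal (g x)"
      using g(2) by (intro SUP_least ennreal_leI) (auto simp: G_def split: split_indicator)
    obtain i where i: "x \<in> E i" using E(2) by auto
    obtain j where j: "g x \<le> real j" using real_arch_simple by blast
    have "x \<in> E (max i j)" using i incseqD[OF E(4), of i "max i j"] by auto
    then have "G (max i j) x = g x" using j by (auto simp: G_def)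
    then show "ennreal (g x) \<le> (SUP n. ennreal (G n x))" by (metis SUP_upper UNIV_I)
  qed
  have conv: "(\<integral>\<^sup>+y. ennreal (g y) \<partial>K r x) = (SUP n. \<integral>\<^sup>+y. ennreal (G n y) \<partial>K r x)" if "0 \<le> r" for r x
    unfolding sup[symmetric] using Ginc
    by (intro nn_integral_monotone_convergence_SUP) (auto simp: incseq_Suc_iff le_fun_def meas_K_iff[OF that] ennreal_leI)
  have "AE x in m. P (s + t) (G n) x = P s (P t (G n)) x" for n
    using semigroup s t GL by (auto simp: symmetric_markov_semigroup_def)
  then have "AE x in m. \<forall>n. P (s + t) (G n) x = P s (P t (G n)) x"
    by (simp add: AE_all_countable)
  then show ?thesis
  proof eventually_elim
    case (elim x)
    have m2: "(\<lambda>y. \<integral>\<^sup>+z. ennreal (G n z) \<partial>K t y) \<in> borel_measurable borel" for n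
      by (rule nn_K_meas[OF t]) measurable
    have st: "0 \<le> s + t" using s t by simp
    have eqn: "(\<integral>\<^sup>+y. ennreal (G n y) \<partial>K (s + t) x) = (\<integral>\<^sup>+y. (\<integral>\<^sup>+z. ennreal (G n z) \<partial>K t y) \<partial>K s x)" for n
    proof -
      have "(\<integral>\<^sup>+y. ennreal (G n y) \<partial>K (s + t) x) = ennreal (P s (P t (G n)) x)"
        using P_bounded_nn(1)[OF st, of "G n" "real n" x] Gm Gb elim by simp
      also have "\<dots> = (\<integral>\<^sup>+y. ennreal (P t (G n) y) \<partial>K s x)"
        using P_bounded_nn(2)[OF t, of "G n" "real n"] Gm Gb P_nonneg[of "G n", OF Gb(1)]
        by (intro P_bounded_nn(1)[OF s P_meas[OF t Gm], where c = "real n"]) auto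
      also have "\<dots> = (\<integral>\<^sup>+y. (\<integral>\<^sup>+z. ennreal (G n z) \<partial>K t y) \<partial>K s x)"
        using P_bounded_nn(1)[OF t, of "G n" "real n"] Gm Gb by simp
      finally show ?thesis .
    qed
    have "(\<integral>\<^sup>+y. ennreal (g y) \<partial>K (s + t) x) = (SUP n. (\<integral>\<^sup>+y. (\<integral>\<^sup>+z. ennreal (G n z) \<partial>K t y) \<partial>K s x))"
      unfolding conv[OF st] eqn ..
    also have "\<dots> = (\<integral>\<^sup>+y. (SUP n. \<integral>\<^sup>+z. ennreal (G n z) \<partial>K t y) \<partial>K s x)"
      using Ginc m2 by (intro nn_integral_monotone_convergence_SUP[symmetric])
         (auto simp: incseq_Suc_iff le_fun_def meas_K_iff[OF s] intro!: nn_integral_mono ennreal_leI)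
    finally show ?case unfolding conv[OF t] .
  qed
qed

lemma nn_P_AE:
  assumes p: "1 < p" and t: "0 \<le> t" and f: "f \<in> Lp p m" "\<And>x. 0 \<le> f x"
  shows "AE x in m. ennreal (P t f x) = (\<integral>\<^sup>+y. ennreal (f y) \<partial>K t x)"
  using AE_integrable[OF p t f(1)]
  by eventually_elim (use f(2) in \<open>simp add: kernel_op_def nn_integral_eq_integral\<close>)

lemma semigroup_Lp_nonneg:
  assumes p: "1 < p" and s: "0 \<le> s" and t: "0 \<le> t" and f: "f \<in> Lp p m" "\<And>x. 0 \<le> f x"
  shows "AE x in m. P (s + t) f x = P s (P t f) x"
proof -
  have fm: "f \<in> borel_measurable borel" using f by (simp add: Lp_iff)
  have st: "0 \<le> s + t" using s t by simp
  show ?thesis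
    using nn_semigroup[OF s t fm f(2)] nn_P_AE[OF p st f] AE_K[OF s nn_P_AE[OF p t f]]
      nn_P_AE[OF p s P_Lp[OF p t f(1)] P_nonneg[OF f(2)]]
  proof eventually_elim
    case (elim x)
    have "(\<integral>\<^sup>+y. (\<integral>\<^sup>+z. ennreal (f z) \<partial>K t y) \<partial>K s x) = (\<integral>\<^sup>+y. ennreal (P t f y) \<partial>K s x)"
      using elim(3) by (intro nn_integral_cong_AE) (auto elim!: eventually_mono)
    then have "ennreal (P (s + t) f x) = ennreal (P s (P t f) x)" using elim by simp
    then show ?case using P_nonneg[of f, OF f(2)] P_nonneg[of "P t f", OF P_nonneg[OF f(2)]]
      by simp
  qed
qed

text \<open>Linear extension of the law for nonnegative functions; the exceptional null sets are harmless
because the kernels preserve null sets.\<close>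

lemma semigroup_Lp:
  assumes p: "1 < p" and s: "0 \<le> s" and t: "0 \<le> t" and f: "f \<in> Lp p m"
  shows "AE x in m. P (s + t) f x = P s (P t f) x"
proof -
  have fm [measurable]: "f \<in> borel_measurable borel" using f by (simp add: Lp_iff)
  have p_pos: "0 < p" using p by simp
  define a b where "a x = max (f x) 0" and "b x = max (- f x) 0" for x
  have ab: "a \<in> Lp p m" "b \<in> Lp p m"
    unfolding a_def b_def by (auto intro!: Lp_le[OF p_pos f])
  have nn: "0 \<le> a x" "0 \<le> b x" for x by (auto simp: a_def b_def)
  have f_eq: "f = (\<lambda>x. a x - b x)" by (auto simp: a_def b_def)
  have st: "0 \<le> s + t" using s t by simp
  have Pab: "P t a \<in> Lp p m" "P t b \<in> Lp p m" using P_Lp[OF p t] ab by auto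
  have 1: "AE x in m. P s (P t f) x = P s (\<lambda>y. P t a y - P t b y) x"
    using P_diff_AE[OF p t ab] Pab unfolding f_eq[symmetric]
    by (intro P_cong_AE[OF s]) (auto intro!: P_meas[OF t] borel_measurable_diff dest!: Lp_meas)
  show ?thesis
    using 1 P_diff_AE[OF p s Pab] semigroup_Lp_nonneg[OF p s t ab(1) nn(1)]
      semigroup_Lp_nonneg[OF p s t ab(2) nn(2)] P_diff_AE[OF p st ab]
    unfolding f_eq[symmetric]
    by eventually_elim simp
qed


lemma powr2_eq: "\<bar>u :: real\<bar> powr 2 = u\<^sup>2"
  by (cases "u = 0") (auto simp: powr_numeral)

lemma Lp_approximation_L2:
  assumes p: "1 < p" and f: "f \<in> Lp p m" and e: "0 < \<epsilon>"
  obtains g where "g \<in> Lp p m" "g \<in> Lp 2 m" "energy p (\<lambda>x. f x - g x) < \<epsilon>"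
proof -
  have fm [measurable]: "f \<in> borel_measurable borel" using f by (simp add: Lp_iff)
  obtain E where E: "\<And>i. E i \<in> sets borel" "(\<Union>i. E i) = UNIV" "\<And>i. emeasure m (E i) < \<infinity>" "incseq E"
    by (rule exhaustion) blast
  note [measurable] = E(1)
  define g where "g n x = (if x \<in> E n \<and> \<bar>f x\<bar> \<le> real n then f x else 0)" for n x
  have gm [measurable]: "g n \<in> borel_measurable borel" for n
    unfolding g_def by measurable
  have gb: "\<bar>g n x\<bar> \<le> real n * indicator (E n) x" for n x by (auto simp: g_def)
  have gL: "g n \<in> Lp q m" if "0 < q" for n q
    by (rule Lp_of_bounded[OF that gm E(1)[of n] E(3)[of n] gb])
  have "(\<lambda>n. \<integral>\<^sup>+x. ennreal (\<bar>f x - g n x\<bar> powr p) \<partial>m) \<longlonglongrightarrow> (\<integral>\<^sup>+x. 0 \<partial>m)"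
  proof (rule nn_integral_dominated_convergence[where w = "\<lambda>x. ennreal (\<bar>f x\<bar> powr p)"])
    show "(\<integral>\<^sup>+x. ennreal (\<bar>f x\<bar> powr p) \<partial>m) < \<infinity>" using f by (simp add: Lp_iff energy_def)
    show "AE x in m. ennreal (\<bar>f x - g j x\<bar> powr p) \<le> ennreal (\<bar>f x\<bar> powr p)" for j
      using p by (intro AE_I2 ennreal_leI powr_mono2) (auto simp: g_def)
    show "AE x in m. (\<lambda>i. ennreal (\<bar>f x - g i x\<bar> powr p)) \<longlonglongrightarrow> 0"
    proof (rule AE_I2)
      fix x
      obtain i where i: "x \<in> E i" using E(2) by auto
      obtain j where j: "\<bar>f x\<bar> \<le> real j" using real_arch_simple by blast
      have "eventually (\<lambda>n. ennreal (\<bar>f x - g n x\<bar> powr p) = 0) sequentially"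
        using eventually_ge_at_top[of "max i j"]
      proof eventually_elim
        case (elim n)
        then have "x \<in> E n" using i E(4) by (auto simp: incseq_def)
        then show ?case using j elim by (simp add: g_def)
      qed
      then show "(\<lambda>i. ennreal (\<bar>f x - g i x\<bar> powr p)) \<longlonglongrightarrow> 0" by (rule tendsto_eventually)
    qed
  qed (auto simp: meas_m_iff)
  then have "eventually (\<lambda>n. energy p (\<lambda>x. f x - g n x) < \<epsilon>) sequentially"
    using e by (auto simp: energy_def order_tendsto_iff)
  then obtain n where "energy p (\<lambda>x. f x - g n x) < \<epsilon>" by (auto simp: eventually_sequentially)
  then show ?thesis using that[of "g n"] gL p by auto
qed

text \<open>Strong continuity in mean square yields a sequence of times along which \<open>P s g\<close>
converges almost everywhere. Contractivity supplies the majorant \<open>2 powr p * (\<bar>P s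
g\<bar> powr p + \<bar>g\<bar> powr p)\<close> of \<open>\<bar>P s g - g\<bar> powr p\<close>,
whose integral stays bounded by that of its limit, and Fatou applied to the difference gives
convergence of the \<open>p\<close>-energy, for every exponent \<open>p > 1\<close> at once.\<close>

lemma energy_P_diff_small_L2:
  assumes p: "1 < p" and g: "g \<in> Lp p m" "g \<in> Lp 2 m" and e: "0 < \<epsilon>" and d: "0 < \<delta>"
  obtains h where "0 < h" "h < \<delta>" "energy p (\<lambda>x. P h g x - g x) < \<epsilon>"
proof -
  have gm [measurable]: "g \<in> borel_measurable borel" using g by (simp add: Lp_iff)
  have p_pos: "0 < p" using p by simp
  define s where "s n = \<delta> / real (n + 2)" for n
  have s: "0 < s n" "s n < \<delta>" "0 \<le> s n" for n
    using d mult_strict_left_mono[of 1 "real (n + 2)" \<delta>] by (auto simp: s_def divide_less_eq simp del: of_nat_add)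
  have slim: "s \<longlonglongrightarrow> 0"
    unfolding s_def using LIMSEQ_ignore_initial_segment[OF lim_const_over_n[of \<delta>], of 2] by simp
  note Pm [measurable] = P_meas[OF s(3) gm]
  have sF: "filterlim s (at_right 0) sequentially"
    using s(1) slim by (rule filterlim_at_right_0_sequence)
  have "((\<lambda>t. Lp_norm 2 m (\<lambda>x. P t g x - g x)) \<longlongrightarrow> 0) (at_right 0)"
    using semigroup g by (auto simp: symmetric_markov_semigroup_def)
  then have L: "(\<lambda>n. Lp_norm 2 m (\<lambda>x. P (s n) g x - g x)) \<longlonglongrightarrow> 0"
    by (rule filterlim_compose[OF _ sF])
  have nn: "0 \<le> (\<integral>x. \<bar>P (s n) g x - g x\<bar> powr 2 \<partial>m)" for n by simp
  have "(Lp_norm 2 m (\<lambda>x. P (s n) g x - g x))\<^sup>2 = (\<integral>x. \<bar>P (s n) g x - g x\<bar> powr 2 \<partial>m)" for n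
    unfolding Lp_norm_def using nn[of n] by (simp add: powr_half_sqrt)
  with tendsto_power[OF L, of 2]
  have L2: "(\<lambda>n. \<integral>x. norm (\<bar>P (s n) g x - g x\<bar> powr 2) \<partial>m) \<longlonglongrightarrow> 0" by simp
  have PL: "P (s n) g \<in> Lp p m" "P (s n) g \<in> Lp 2 m" for n
    using P_Lp[OF p s(3) g(1)] P_Lp[OF _ s(3) g(2)] by auto
  have "integrable m (\<lambda>x. \<bar>P (s n) g x - g x\<bar> powr 2)" for n
    using Lp_diff[OF _ PL(2) g(2)] by (simp add: Lp_def)
  from tendsto_L1_AE_subseq[OF this L2] obtain r where r: "strict_mono r"
    "AE x in m. (\<lambda>n. \<bar>P (s (r n)) g x - g x\<bar> powr 2) \<longlonglongrightarrow> 0" by auto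
  define D where "D n x = \<bar>P (s (r n)) g x - g x\<bar> powr p" for n x
  define B where "B n x = 2 powr p * (\<bar>P (s (r n)) g x\<bar> powr p + \<bar>g x\<bar> powr p)" for n x
  have Dm [measurable]: "D n \<in> borel_measurable borel" "B n \<in> borel_measurable borel" for n
    unfolding D_def B_def by measurable
  have DB: "0 \<le> D n x" "D n x \<le> B n x" for n x
    unfolding D_def B_def using abs_powr_add_le[OF p_pos, of "P (s (r n)) g x" "- g x"] by auto
  define c where "c = ennreal (2 powr p) * (energy p g + energy p g)"
  have cfin: "c < \<infinity>" using g unfolding c_def by (auto simp: Lp_iff ennreal_mult_less_top)
  have intB: "(\<integral>\<^sup>+x. ennreal (B n x) \<partial>m) \<le> c" for n
  proof -
    have "(\<integral>\<^sup>+x. ennreal (B n x) \<partial>m) = (\<integral>\<^sup>+x. ennreal (2 powr p) * (ennreal (\<bar>P (s (r n)) g x\<bar> powr p) + ennreal (\<bar>g x\<bar> powr p)) \<partial>m)"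
      by (intro nn_integral_cong) (simp add: B_def ennreal_mult[symmetric] ennreal_plus[symmetric] del: ennreal_plus)
    also have "\<dots> = ennreal (2 powr p) * (energy p (P (s (r n)) g) + energy p g)"
      unfolding energy_def by (simp add: nn_integral_cmult nn_integral_add meas_m_iff)
    also have "\<dots> \<le> c" unfolding c_def
      by (intro mult_left_mono add_right_mono energy_P_le p s g) simp
    finally show ?thesis .
  qed
  have lim: "AE x in m. (\<lambda>n. ennreal (B n x - D n x)) \<longlonglongrightarrow> ennreal (2 powr p * (\<bar>g x\<bar> powr p + \<bar>g x\<bar> powr p))"
    using r(2)
  proof eventually_elim
    case (elim x)
    then have "(\<lambda>n. (P (s (r n)) g x - g x)\<^sup>2) \<longlonglongrightarrow> 0" by (simp add: powr2_eq)
    then have "(\<lambda>n. sqrt ((P (s (r n)) g x - g x)\<^sup>2)) \<longlonglongrightarrow> sqrt 0" by (rule tendsto_real_sqrt)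
    then have "(\<lambda>n. \<bar>P (s (r n)) g x - g x\<bar>) \<longlonglongrightarrow> 0" by simp
    then have z: "(\<lambda>n. P (s (r n)) g x - g x) \<longlonglongrightarrow> 0" by (rule tendsto_rabs_zero_cancel)
    then have w: "(\<lambda>n. P (s (r n)) g x) \<longlonglongrightarrow> g x" by (simp add: LIM_zero_iff)
    have "(\<lambda>n. D n x) \<longlonglongrightarrow> \<bar>0\<bar> powr p" unfolding D_def
      using p_pos by (intro tendsto_powr' tendsto_rabs z tendsto_const) auto
    moreover have "(\<lambda>n. B n x) \<longlonglongrightarrow> 2 powr p * (\<bar>g x\<bar> powr p + \<bar>g x\<bar> powr p)" unfolding B_def
      using p_pos by (intro tendsto_mult tendsto_add tendsto_powr' tendsto_rabs w tendsto_const) auto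
    ultimately have "(\<lambda>n. B n x - D n x) \<longlonglongrightarrow> 2 powr p * (\<bar>g x\<bar> powr p + \<bar>g x\<bar> powr p) - 0"
      by (intro tendsto_diff) auto
    then show ?case by (intro tendsto_ennrealI) simp
  qed
  have c_eq: "c = (\<integral>\<^sup>+x. ennreal (2 powr p * (\<bar>g x\<bar> powr p + \<bar>g x\<bar> powr p)) \<partial>m)"
  proof -
    have "(\<integral>\<^sup>+x. ennreal (2 powr p * (\<bar>g x\<bar> powr p + \<bar>g x\<bar> powr p)) \<partial>m)
      = (\<integral>\<^sup>+x. ennreal (2 powr p) * (ennreal (\<bar>g x\<bar> powr p) + ennreal (\<bar>g x\<bar> powr p)) \<partial>m)"
      by (intro nn_integral_cong) (simp add: ennreal_mult[symmetric] ennreal_plus[symmetric] del: ennreal_plus)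
    also have "\<dots> = c"
      unfolding c_def energy_def by (subst nn_integral_cmult) (auto simp: nn_integral_add meas_m_iff)
    finally show ?thesis ..
  qed
  have "c = (\<integral>\<^sup>+x. liminf (\<lambda>n. ennreal (B n x - D n x)) \<partial>m)"
    unfolding c_eq
  proof (rule nn_integral_cong_AE)
    show "AE x in m. ennreal (2 powr p * (\<bar>g x\<bar> powr p + \<bar>g x\<bar> powr p)) = liminf (\<lambda>n. ennreal (B n x - D n x))"
      using lim by eventually_elim (simp add: lim_imp_Liminf)
  qed
  also have "\<dots> \<le> liminf (\<lambda>n. \<integral>\<^sup>+x. ennreal (B n x - D n x) \<partial>m)"
    by (intro nn_integral_liminf) (simp add: meas_m_iff)
  finally have cl: "c \<le> liminf (\<lambda>n. \<integral>\<^sup>+x. ennreal (B n x - D n x) \<partial>m)" .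
  have split: "(\<integral>\<^sup>+x. ennreal (B n x - D n x) \<partial>m) + (\<integral>\<^sup>+x. ennreal (D n x) \<partial>m) \<le> c" for n
  proof -
    have "(\<integral>\<^sup>+x. ennreal (B n x - D n x) \<partial>m) + (\<integral>\<^sup>+x. ennreal (D n x) \<partial>m) = (\<integral>\<^sup>+x. ennreal (B n x) \<partial>m)"
      using DB by (subst nn_integral_add[symmetric])
        (auto simp: meas_m_iff ennreal_plus[symmetric] simp del: ennreal_plus intro!: nn_integral_cong)
    then show ?thesis using intB by simp
  qed
  have "limsup (\<lambda>n. \<integral>\<^sup>+x. ennreal (D n x) \<partial>m) \<le> 0"
    by (rule limsup_le_of_complement[OF _ tendsto_const add_0 cfin cl]) (subst add.commute, rule split)
  then have "limsup (\<lambda>n. \<integral>\<^sup>+x. ennreal (D n x) \<partial>m) < \<epsilon>" using e by simp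
  then have "\<forall>\<^sub>F n in sequentially. (\<integral>\<^sup>+x. ennreal (D n x) \<partial>m) < \<epsilon>" by (rule Limsup_lessD)
  then have "\<exists>n. (\<integral>\<^sup>+x. ennreal (D n x) \<partial>m) < \<epsilon>" by (auto simp: eventually_sequentially)
  then obtain n where "(\<integral>\<^sup>+x. ennreal (D n x) \<partial>m) < \<epsilon>" ..
  then show ?thesis
    using that[of "s (r n)"] s by (simp add: D_def energy_def)
qed

text \<open>Density of the functions covered by the previous lemma, with contractivity of \<open>P
h\<close>.\<close>

lemma energy_P_diff_small:
  assumes p: "1 < p" and f: "f \<in> Lp p m" and e: "0 < \<epsilon>" and d: "0 < \<delta>"
  obtains h where "0 < h" "h < \<delta>" "energy p (\<lambda>x. P h f x - f x) < ennreal \<epsilon>"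
proof -
  have fm [measurable]: "f \<in> borel_measurable borel" using f by (simp add: Lp_iff)
  have p_pos: "0 < p" using p by simp
  define C :: real where "C = 2 powr p"
  have C: "0 < C" by (simp add: C_def)
  \<comment> \<open>Two applications of \<open>energy_add_le\<close> produce the factor \<open>2 * C * C +
    C\<close>.\<close>
  define \<eta> where "\<eta> = \<epsilon> / (2 * C * C + C + 1)"
  have eta: "0 < \<eta>" "(2 * C * C + C) * \<eta> < \<epsilon>"
  proof -
    have D: "0 < 2 * C * C + C + 1" using C by (intro add_pos_pos mult_pos_pos) auto
    show "0 < \<eta>" using D e by (simp add: \<eta>_def)
    have "(2 * C * C + C + 1) * \<eta> = \<epsilon>" using D by (simp add: \<eta>_def)
    then show "(2 * C * C + C) * \<eta> < \<epsilon>" using \<open>0 < \<eta>\<close> by (simp add: algebra_simps)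
  qed
  obtain g where g: "g \<in> Lp p m" "g \<in> Lp 2 m" "energy p (\<lambda>x. f x - g x) < ennreal \<eta>"
    using Lp_approximation_L2[OF p f, of "ennreal \<eta>"] eta by auto
  have gm [measurable]: "g \<in> borel_measurable borel" using g by (simp add: Lp_iff)
  obtain h where h: "0 < h" "h < \<delta>" "energy p (\<lambda>x. P h g x - g x) < ennreal \<eta>"
    using energy_P_diff_small_L2[OF p g(1,2), of "ennreal \<eta>" \<delta>] eta d by auto
  have h0: "0 \<le> h" using h by simp
  note [measurable] = P_meas[OF h0 fm] P_meas[OF h0 gm]
  have dL: "(\<lambda>x. f x - g x) \<in> Lp p m" by (rule Lp_diff[OF p_pos f g(1)])
  have dm [measurable]: "P h (\<lambda>x. f x - g x) \<in> borel_measurable borel"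
    by (rule P_meas[OF h0]) measurable
  have 1: "energy p (\<lambda>x. P h (\<lambda>y. f y - g y) x + - (f x - g x)) \<le> ennreal C * (ennreal \<eta> + ennreal \<eta>)"
  proof -
    have "energy p (\<lambda>x. P h (\<lambda>y. f y - g y) x + - (f x - g x))
      \<le> ennreal C * (energy p (P h (\<lambda>x. f x - g x)) + energy p (\<lambda>x. - (f x - g x)))"
      unfolding C_def by (rule energy_add_le[OF p_pos]) measurable
    also have "energy p (\<lambda>x. - (f x - g x)) = energy p (\<lambda>x. f x - g x)" by (simp add: energy_def abs_minus_commute)
    also have "ennreal C * (energy p (P h (\<lambda>x. f x - g x)) + energy p (\<lambda>x. f x - g x)) \<le> ennreal C * (ennreal \<eta> + ennreal \<eta>)"
      using energy_P_le[OF p h0 dL] g(3) by (intro mult_left_mono add_mono) auto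
    finally show ?thesis .
  qed
  have "AE x in m. P h f x - f x = (P h (\<lambda>y. f y - g y) x + - (f x - g x)) + (P h g x - g x)"
    using P_diff_AE[OF p h0 f g(1)] by eventually_elim simp
  then have "energy p (\<lambda>x. P h f x - f x) = energy p (\<lambda>x. (P h (\<lambda>y. f y - g y) x + - (f x - g x)) + (P h g x - g x))"
    unfolding energy_def by (intro nn_integral_cong_AE) (elim eventually_mono, simp only:)
  also have "\<dots> \<le> ennreal C * (energy p (\<lambda>x. P h (\<lambda>y. f y - g y) x + - (f x - g x)) + energy p (\<lambda>x. P h g x - g x))"
    unfolding C_def by (rule energy_add_le[OF p_pos]) measurable
  also have "\<dots> \<le> ennreal C * (ennreal C * (ennreal \<eta> + ennreal \<eta>) + ennreal \<eta>)"
    using 1 h(3) by (intro mult_left_mono add_mono) auto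
  also have "\<dots> = ennreal ((2 * C * C + C) * \<eta>)"
    using C eta by (simp add: ennreal_mult[symmetric] ennreal_plus[symmetric] algebra_simps del: ennreal_plus)
  also have "\<dots> < ennreal \<epsilon>" using eta e by (intro ennreal_lessI)
  finally show ?thesis using that h by blast
qed

text \<open>The identity for a fixed \<open>f\<close> only needs one sequence of time steps along which the
semigroup is continuous at \<open>f\<close>.\<close>

lemma strong_continuity_sequence:
  assumes p: "1 < p" and f: "f \<in> Lp p m"
  obtains h :: "nat \<Rightarrow> real" where "\<And>n. 0 < h n" "h \<longlonglongrightarrow> 0" "(\<lambda>n. energy p (\<lambda>x. P (h n) f x - f x)) \<longlonglongrightarrow> 0"
proof -
  have "\<forall>n::nat. \<exists>h. 0 < h \<and> h < 1 / real (Suc n) \<and> energy p (\<lambda>x. P h f x - f x) < ennreal (1 / real (Suc n))"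
    using energy_P_diff_small[OF p f, of "1 / real (Suc n)" "1 / real (Suc n)" for n] by (metis of_nat_0_less_iff zero_less_Suc zero_less_divide_1_iff)
  then obtain h where h: "\<And>n. 0 < h n" "\<And>n. h n < 1 / real (Suc n)"
    "\<And>n. energy p (\<lambda>x. P (h n) f x - f x) < ennreal (1 / real (Suc n))" by metis
  have l: "(\<lambda>n. 1 / real (Suc n)) \<longlonglongrightarrow> 0" using LIMSEQ_Suc[OF lim_1_over_n] by simp
  have "h \<longlonglongrightarrow> 0"
    by (rule tendsto_sandwich[OF _ _ tendsto_const l]) (use h in \<open>auto intro!: always_eventually less_imp_le\<close>)
  moreover have "(\<lambda>n. energy p (\<lambda>x. P (h n) f x - f x)) \<longlonglongrightarrow> 0"
    by (rule tendsto_sandwich[OF _ _ tendsto_const tendsto_ennrealI[OF l, unfolded ennreal_0]])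
       (use h in \<open>auto intro!: always_eventually less_imp_le\<close>)
  ultimately show ?thesis using that h by blast
qed

end

section \<open>Approximating forms and the domain of the form\<close>

lemma bregman_2: "bregman 2 a b = (b - a)\<^sup>2"
proof -
  have "\<bar>a\<bar> * sgn a = a" by (simp add: abs_mult_sgn)
  then have "signed_powr a 1 = a"
    by (cases "a = 0") (auto simp: signed_powr_def)
  moreover have "\<bar>u\<bar> powr 2 = u\<^sup>2" for u :: real
    by (cases "u = 0") (auto simp: powr_numeral)
  ultimately show ?thesis by (simp add: bregman_def power2_eq_square algebra_simps)
qed

context markov_semigroup_kernels
begin

lemma L2_integrable_mult:
  assumes "u \<in> Lp 2 m" "v \<in> Lp 2 m" shows "integrable m (\<lambda>x. u x * v x)"
proof (rule Bochner_Integration.integrable_bound)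
  show "integrable m (\<lambda>x. (u x)\<^sup>2 + (v x)\<^sup>2)"
    using assms by (auto simp: Lp_def powr2_eq)
  show "AE x in m. norm (u x * v x) \<le> norm ((u x)\<^sup>2 + (v x)\<^sup>2)"
  proof (rule AE_I2)
    fix x
    have "\<bar>u x\<bar> * \<bar>v x\<bar> \<le> \<bar>u x\<bar>\<^sup>2 + \<bar>v x\<bar>\<^sup>2"
      by (rule order_trans[OF _ sum_squares_bound[of "\<bar>u x\<bar>" "\<bar>v x\<bar>", THEN order_trans[rotated]]])
         (auto simp: algebra_simps)
    then show "norm (u x * v x) \<le> norm ((u x)\<^sup>2 + (v x)\<^sup>2)"
      by (simp add: abs_mult)
  qed
qed (use assms in \<open>auto simp: Lp_def\<close>)

lemma L2_inner_cong_AE: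
  assumes "u \<in> borel_measurable borel" "u' \<in> borel_measurable borel" "v \<in> borel_measurable borel" "AE x in m. u x = u' x"
  shows "L2_inner m u v = L2_inner m u' v"
  unfolding L2_inner_def using assms
  by (intro integral_cong_AE) (auto simp: meas_m_iff elim!: eventually_mono)

lemma L2_inner_commute: "L2_inner m u v = L2_inner m v u"
  by (simp add: L2_inner_def mult.commute)

lemma L2_symmetric:
  assumes "0 \<le> t" "u \<in> Lp 2 m" "v \<in> Lp 2 m"
  shows "L2_inner m (P t u) v = L2_inner m u (P t v)"
  using semigroup assms by (auto simp: symmetric_markov_semigroup_def)

lemma P_L2: "0 \<le> t \<Longrightarrow> v \<in> Lp 2 m \<Longrightarrow> P t v \<in> Lp 2 m"
  by (rule P_Lp) auto

lemma L2_inner_P_add: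
  assumes s: "0 \<le> s" and t: "0 \<le> t" and v: "v \<in> Lp 2 m"
  shows "L2_inner m (P (s + t) v) v = L2_inner m (P s v) (P t v)"
proof -
  have "L2_inner m (P (s + t) v) v = L2_inner m (P s (P t v)) v"
    using semigroup_Lp[OF _ s t v] s t v P_L2[OF t v]
    by (intro L2_inner_cong_AE P_meas) (auto dest: Lp_meas intro: P_meas)
  also have "\<dots> = L2_inner m (P t v) (P s v)" by (rule L2_symmetric[OF s P_L2[OF t v] v])
  finally show ?thesis by (simp add: L2_inner_commute)
qed

lemma energy_2_eq:
  assumes "v \<in> Lp 2 m" shows "energy 2 v = ennreal (L2_inner m v v)"
  unfolding energy_def L2_inner_def using L2_integrable_mult[OF assms assms]
  by (subst nn_integral_eq_integral[symmetric]) (auto simp: powr2_eq power2_eq_square)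

text \<open>By symmetry and the semigroup law, \<open>corr v t\<close> is the squared norm of \<open>P (t /
2) v\<close>; hence it is decreasing and convex in \<open>t\<close>.\<close>

definition corr :: "('a \<Rightarrow> real) \<Rightarrow> real \<Rightarrow> real" where
  "corr v t = L2_inner m (P t v) v"

lemma corr_0: "v \<in> Lp 2 m \<Longrightarrow> corr v 0 = L2_inner m v v"
  unfolding corr_def using semigroup P_meas[of 0 v]
  by (intro L2_inner_cong_AE) (auto simp: symmetric_markov_semigroup_def Lp_iff)

lemma corr_double: "0 \<le> t \<Longrightarrow> v \<in> Lp 2 m \<Longrightarrow> corr v (2 * t) = L2_inner m (P t v) (P t v)"
  unfolding corr_def using L2_inner_P_add[of t t v] by simp

lemma L2_norm_P_le:
  assumes "0 \<le> t" "v \<in> Lp 2 m" shows "L2_inner m (P t v) (P t v) \<le> L2_inner m v v"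
proof -
  have "0 \<le> L2_inner m v v" by (simp add: L2_inner_def)
  then show ?thesis
    using energy_P_le[of 2 t v] assms by (simp add: energy_2_eq P_L2)
qed

lemma corr_antimono:
  assumes s: "0 \<le> s" and st: "s \<le> t" and v: "v \<in> Lp 2 m"
  shows "corr v t \<le> corr v s"
proof -
  have "corr v t = L2_inner m (P (t / 2) v) (P (t / 2) v)"
    using corr_double[of "t/2" v] s st v by simp
  also have "\<dots> = L2_inner m (P ((t - s) / 2) (P (s / 2) v)) (P ((t - s) / 2) (P (s / 2) v))"
  proof -
    have ae: "AE x in m. P (t / 2) v x = P ((t - s) / 2) (P (s / 2) v) x"
      using semigroup_Lp[of 2 "(t - s)/2" "s/2" v] s st v by (simp add: add_divide_distrib[symmetric])
    have vm: "v \<in> borel_measurable borel" using v by (rule Lp_meas)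
    have m: "P (t / 2) v \<in> borel_measurable borel" "P ((t - s) / 2) (P (s / 2) v) \<in> borel_measurable borel"
      using s st by (auto intro!: P_meas vm)
    show ?thesis
      using L2_inner_cong_AE[OF m m(1) ae] L2_inner_cong_AE[OF m m(2) ae] by (simp add: L2_inner_commute)
  qed
  also have "\<dots> \<le> L2_inner m (P (s / 2) v) (P (s / 2) v)"
    using s st v by (intro L2_norm_P_le P_L2) auto
  also have "\<dots> = corr v s" using corr_double[of "s/2" v] s v by simp
  finally show ?thesis .
qed

text \<open>\<open>P (s + t)\<close> splits into \<open>P s\<close> and \<open>P t\<close> acting on the two
arguments of the inner product, so midpoint convexity of \<open>corr v\<close> is the inequality
between geometric and arithmetic mean.\<close>

lemma corr_midpoint:
  assumes s: "0 \<le> s" and t: "0 \<le> t" and v: "v \<in> Lp 2 m"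
  shows "2 * corr v (s + t) \<le> corr v (2 * s) + corr v (2 * t)"
proof -
  note L = P_L2[OF s v] P_L2[OF t v]
  note I = L2_integrable_mult[OF L(1) L(1)] L2_integrable_mult[OF L(2) L(2)] L2_integrable_mult[OF L(1) L(2)]
  have "2 * corr v (s + t) = (\<integral>x. 2 * (P s v x * P t v x) \<partial>m)"
    unfolding corr_def L2_inner_P_add[OF s t v] by (simp add: L2_inner_def)
  also have "\<dots> \<le> (\<integral>x. P s v x * P s v x + P t v x * P t v x \<partial>m)"
  proof (rule integral_mono)
    show "2 * (P s v x * P t v x) \<le> P s v x * P s v x + P t v x * P t v x" for x
      using sum_squares_bound[of "P s v x" "P t v x"] by (simp add: power2_eq_square)
  qed (use I in auto)
  also have "\<dots> = corr v (2 * s) + corr v (2 * t)"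
    unfolding corr_double[OF s v] corr_double[OF t v] L2_inner_def using I by simp
  finally show ?thesis .
qed

text \<open>The numerator of the approximating form.\<close>

definition defect :: "('a \<Rightarrow> real) \<Rightarrow> real \<Rightarrow> real" where
  "defect v t = L2_inner m v v - corr v t"

lemma defect_eq: "v \<in> Lp 2 m \<Longrightarrow> defect v t = corr v 0 - corr v t"
  by (simp add: defect_def corr_0)

lemma approx_form_eq:
  assumes t: "0 \<le> t" and u: "u \<in> Lp 2 m" and v: "v \<in> Lp 2 m"
  shows "approx_form m P t u v = (L2_inner m u v - L2_inner m (P t u) v) / t"
  using L2_integrable_mult[OF u v] L2_integrable_mult[OF P_L2[OF t u] v]
  by (simp add: approx_form_def L2_inner_def left_diff_distrib)

lemma approx_form_defect:
  assumes "0 \<le> t" "v \<in> Lp 2 m" shows "approx_form m P t v v = defect v t / t"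
  using approx_form_eq[OF assms(1) assms(2) assms(2)] by (simp add: defect_def corr_def)

lemma defect_nonneg: "0 \<le> t \<Longrightarrow> v \<in> Lp 2 m \<Longrightarrow> 0 \<le> defect v t"
  using corr_antimono[of 0 t v] by (simp add: defect_eq)

lemma defect_mono: "0 \<le> s \<Longrightarrow> s \<le> t \<Longrightarrow> v \<in> Lp 2 m \<Longrightarrow> defect v s \<le> defect v t"
  using corr_antimono[of s t v] by (simp add: defect_eq)

text \<open>On the grid of multiples of \<open>h\<close> the increments of \<open>corr v\<close> are
monotone by midpoint convexity; the first one is the largest decrease.\<close>

lemma defect_multiple:
  assumes h: "0 \<le> h" and v: "v \<in> Lp 2 m" shows "defect v (real n * h) \<le> real n * defect v h"
proof -
  define d where "d k = corr v (real k * h) - corr v (real (Suc k) * h)" for k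
  have "d (Suc k) \<le> d k" for k
  proof -
    have "real k * h / 2 + real (Suc (Suc k)) * h / 2 = real (Suc k) * h" by (simp add: field_simps)
    then show ?thesis
      using corr_midpoint[of "real k * h / 2" "real (Suc (Suc k)) * h / 2" v] h v
      by (simp only: d_def) simp
  qed
  then have dec: "d k \<le> d 0" for k by (rule lift_Suc_antimono_le) simp
  have "defect v (real n * h) = (\<Sum>k<n. d k)"
  proof (induction n)
    case 0 then show ?case using v by (simp add: defect_eq)
  next
    case (Suc n) then show ?case using v by (simp add: defect_eq d_def)
  qed
  also have "\<dots> \<le> (\<Sum>k<n. d 0)" by (intro sum_mono dec)
  also have "\<dots> = real n * defect v h" using v by (simp add: d_def defect_eq)
  finally show ?thesis .
qed

text \<open>Subadditivity on grids and monotonicity of the defect give the monotonicity of \<open>defect v h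
/ h\<close> in \<open>h\<close> up to the factor \<open>1 + s / h\<close>, the cost of rounding
\<open>h / s\<close> up. The factor disappears as \<open>s\<close> tends to 0, which is all that
the limits below require.\<close>

lemma defect_rate_le:
  assumes s: "0 < s" and h: "0 < h" and v: "v \<in> Lp 2 m"
  shows "defect v h / h \<le> (1 + s / h) * (defect v s / s)"
proof -
  \<comment> \<open>\<open>n\<close> is the least number of steps of length \<open>s\<close> that cover
    \<open>h\<close>.\<close>
  define n where "n = nat \<lceil>h / s\<rceil>"
  have n: "h / s \<le> real n" "real n \<le> h / s + 1"
    using s h unfolding n_def by (auto simp: real_nat_ceiling_ge of_nat_ceiling)
  have "defect v h \<le> defect v (real n * s)"
    using n s h v by (intro defect_mono) (auto simp: field_simps)
  also have "\<dots> \<le> real n * defect v s" using s v by (intro defect_multiple) auto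
  also have "\<dots> \<le> (h / s + 1) * defect v s" using n defect_nonneg[of s v] s v by (intro mult_right_mono) auto
  finally show ?thesis using s h by (simp add: field_simps)
qed

lemma approx_form_rate_le:
  assumes s: "0 < s" and h: "0 < h" and v: "v \<in> Lp 2 m"
  shows "approx_form m P h v v / (1 + s / h) \<le> approx_form m P s v v"
proof -
  have "0 < 1 + s / h" using s h by (simp add: add_pos_pos)
  then show ?thesis
    using defect_rate_le[OF s h v] s h v by (subst pos_divide_le_eq) (auto simp: approx_form_defect mult.commute)
qed

definition form_domain :: "('a \<Rightarrow> real) set" where
  "form_domain = {u \<in> Lp 2 m. \<exists>c. ((\<lambda>t. approx_form m P t u u) \<longlongrightarrow> c) (at_right 0)}"

lemma approx_form_le_limit:
  assumes v: "v \<in> Lp 2 m" and h: "0 < h" and s: "filterlim s (at_right 0) F" and F: "F \<noteq> bot"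
    and lim: "((\<lambda>n. approx_form m P (s n) v v) \<longlongrightarrow> c) F"
  shows "approx_form m P h v v \<le> c"
proof (rule tendsto_le[OF F lim])
  have "(s \<longlongrightarrow> 0) F" "eventually (\<lambda>n. 0 < s n) F" using s
    by (auto simp: filterlim_at elim: eventually_mono)
  then show "((\<lambda>n. approx_form m P h v v / (1 + s n / h)) \<longlongrightarrow> approx_form m P h v v) F"
    using h by (auto intro!: tendsto_eq_intros)
  show "\<forall>\<^sub>F n in F. approx_form m P h v v / (1 + s n / h) \<le> approx_form m P (s n) v v"
    using \<open>eventually (\<lambda>n. 0 < s n) F\<close> by eventually_elim (rule approx_form_rate_le[OF _ h v])
qed

text \<open>By the almost-monotonicity of \<open>approx_form_rate_le\<close> a bounded family of
approximating forms converges to its supremum.\<close>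

lemma form_domainI:
  assumes v: "v \<in> Lp 2 m" and b: "\<And>h. 0 < h \<Longrightarrow> approx_form m P h v v \<le> B"
  shows "v \<in> form_domain"
proof -
  define S where "S = (SUP h\<in>{0<..}. approx_form m P h v v)"
  have bdd: "bdd_above ((\<lambda>h. approx_form m P h v v) ` {0<..})" using b by (auto intro!: bdd_aboveI2)
  have ub: "approx_form m P h v v \<le> S" if "0 < h" for h
    unfolding S_def using that bdd by (intro cSUP_upper) auto
  have "((\<lambda>t. approx_form m P t v v) \<longlongrightarrow> S) (at_right 0)"
  proof (rule order_tendstoI)
    fix a assume "a < S"
    then obtain h where h: "0 < h" "a < approx_form m P h v v"
      unfolding S_def using less_cSUP_iff[OF _ bdd] by auto
    have "((\<lambda>s. approx_form m P h v v / (1 + s / h)) \<longlongrightarrow> approx_form m P h v v / (1 + 0 / h)) (at_right 0)"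
      using h by (intro tendsto_intros) auto
    then have "eventually (\<lambda>s. a < approx_form m P h v v / (1 + s / h)) (at_right 0)"
      using h by (intro order_tendstoD(1)) auto
    moreover have "eventually (\<lambda>s. 0 < s) (at_right (0::real))" by (simp add: eventually_at_right_less)
    ultimately show "eventually (\<lambda>s. a < approx_form m P s v v) (at_right 0)"
    proof eventually_elim
      case (elim s) then show ?case using approx_form_rate_le[OF elim(2) h(1) v] by linarith
    qed
  next
    fix a assume a: "S < a"
    show "eventually (\<lambda>s. approx_form m P s v v < a) (at_right 0)"
      using eventually_at_right_less[of 0] by eventually_elim (use ub a in force)
  qed
  then show ?thesis using v by (auto simp: form_domain_def)
qed

lemma form_domainD:
  assumes "v \<in> form_domain"
  obtains B where "v \<in> Lp 2 m" "\<And>h. 0 < h \<Longrightarrow> approx_form m P h v v \<le> B"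
proof -
  obtain c where v: "v \<in> Lp 2 m" and c: "((\<lambda>t. approx_form m P t v v) \<longlongrightarrow> c) (at_right 0)"
    using assms by (auto simp: form_domain_def)
  show ?thesis
    using that[of c] v approx_form_le_limit[OF v _ filterlim_ident _ c] by (auto simp: trivial_limit_at_right_real)
qed

text \<open>For exponent 2 the energy balance says that \<open>defect v (2 * s)\<close> is the integrated
variance of \<open>v\<close> under \<open>K s x\<close>, and the variance is the minimum over
all constants \<open>c x\<close>. The time doubles because the squared norm of \<open>P s
v\<close> is \<open>corr v (2 * s)\<close>.\<close>

lemma joint_square_ge_defect:
  assumes s: "0 \<le> s" and v: "v \<in> Lp 2 m"
  shows "ennreal (defect v (2 * s)) \<le> joint s (\<lambda>x y. ennreal ((v y - c x)\<^sup>2))"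
proof -
  have "joint s (\<lambda>x y. ennreal (bregman 2 (P s v x) (v y))) + ennreal (corr v (2 * s)) = ennreal (L2_inner m v v)"
    using joint_bregman_energy[of 2 s v] s v by (simp add: energy_2_eq P_L2 corr_double)
  moreover have "0 \<le> corr v (2 * s)"
    using s v by (simp add: corr_double L2_inner_def)
  ultimately have "ennreal (defect v (2 * s)) = joint s (\<lambda>x y. ennreal (bregman 2 (P s v x) (v y)))"
    unfolding defect_def by (metis ennreal_minus ennreal_add_diff_cancel_right ennreal_neq_top)
  also have "\<dots> \<le> joint s (\<lambda>x y. ennreal (bregman 2 (c x) (v y)))"
    using s v by (intro joint_bregman_mean_le) auto
  finally show ?thesis by (simp add: bregman_2)
qed

text \<open>The usual symmetric expression of the approximating form by increments; it uses invariance of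
\<open>m\<close> for both diagonal terms.\<close>

lemma joint_square_eq_defect:
  assumes h: "0 \<le> h" and v: "v \<in> Lp 2 m"
  shows "joint h (\<lambda>x y. ennreal ((v y - v x)\<^sup>2)) = ennreal (2 * defect v h)"
proof -
  have vm [measurable]: "v \<in> borel_measurable borel" using v by (rule Lp_meas)
  define S where "S x = (\<integral>y. (v y)\<^sup>2 \<partial>K h x)" for x
  have S: "S = P h (\<lambda>y. (v y)\<^sup>2)" by (auto simp: S_def kernel_op_def)
  have Sm: "S \<in> borel_measurable m" unfolding S meas_m_iff by (rule P_meas[OF h]) measurable
  have S0: "0 \<le> S x" for x by (simp add: S_def)
  have "(\<integral>\<^sup>+x. ennreal (S x) \<partial>m) = (\<integral>\<^sup>+x. (\<integral>\<^sup>+y. ennreal ((v y)\<^sup>2) \<partial>K h x) \<partial>m)"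
  proof (rule nn_integral_cong_AE)
    show "AE x in m. ennreal (S x) = (\<integral>\<^sup>+y. ennreal ((v y)\<^sup>2) \<partial>K h x)"
      using AE_integrable_powr[OF h v] by eventually_elim (auto simp: S_def powr2_eq nn_integral_eq_integral)
  qed
  also have "\<dots> = (\<integral>\<^sup>+x. ennreal ((v x)\<^sup>2) \<partial>m)" by (rule nn_invariant[OF h]) measurable
  also have "\<dots> = ennreal (L2_inner m v v)"
    using energy_2_eq[OF v] by (simp add: energy_def powr2_eq)
  finally have nS: "(\<integral>\<^sup>+x. ennreal (S x) \<partial>m) = ennreal (L2_inner m v v)" .
  have iS: "integrable m S" using nS Sm S0 by (intro integrableI_nonneg) auto
  have eS: "(\<integral>x. S x \<partial>m) = L2_inner m v v"
    using nS S0 by (intro integral_eq_nn_integral[THEN trans] ) (auto simp: Sm L2_inner_def)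
  note I = L2_integrable_mult[OF v v] L2_integrable_mult[OF P_L2[OF h v] v]
  define A where "A x = S x - v x * v x - 2 * (P h v x * v x - v x * v x)" for x
  have iA: "integrable m A" unfolding A_def using iS I by simp
  have "joint h (\<lambda>x y. ennreal ((v y - v x)\<^sup>2)) = (\<integral>\<^sup>+x. ennreal (A x) \<partial>m)"
    unfolding joint_def
  proof (rule nn_integral_cong_AE)
    have s1: "signed_powr a 1 = a" for a by (cases "a = 0") (auto simp: signed_powr_def abs_mult_sgn)
    show "AE x in m. (\<integral>\<^sup>+y. ennreal ((v y - v x)\<^sup>2) \<partial>K h x) = ennreal (A x)"
      using AE_integrable_powr[OF h v]
    proof eventually_elim
      case (elim x)
      then interpret prob_space "K h x" by simp
      show ?case using nn_integral_bregman[of 2 v "v x"] elim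
        by (simp add: s1 bregman_2 powr2_eq A_def S_def kernel_op_def power2_eq_square algebra_simps)
    qed
  qed
  also have "\<dots> = ennreal (\<integral>x. A x \<partial>m)"
  proof (rule nn_integral_eq_integral[OF iA])
    show "AE x in m. 0 \<le> A x"
      using AE_integrable_powr[OF h v]
    proof eventually_elim
      case (elim x)
      then interpret prob_space "K h x" by simp
      have "\<bar>P h v x\<bar> powr 2 \<le> (\<integral>y. \<bar>v y\<bar> powr 2 \<partial>K h x)"
        unfolding kernel_op_def using elim by (intro abs_mean_powr_le) auto
      then have "(P h v x)\<^sup>2 \<le> S x" by (simp add: S_def powr2_eq)
      moreover have "A x = (S x - (P h v x)\<^sup>2) + (P h v x - v x)\<^sup>2"
        by (simp add: A_def power2_eq_square algebra_simps)
      ultimately show ?case by simp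
    qed
  qed
  also have "(\<integral>x. A x \<partial>m) = 2 * defect v h"
    unfolding A_def using iS I eS by (simp add: defect_def corr_def L2_inner_def)
  finally show ?thesis .
qed

text \<open>Approximating forms are integrals of squared increments, so pointwise control of increments
passes to them and membership in the domain follows from boundedness.\<close>

lemma form_domain_contraction:
  assumes u: "u \<in> form_domain" and v: "v \<in> form_domain" and w: "w \<in> Lp 2 m"
    and L: "0 \<le> L" "\<And>x y. \<bar>w y - w x\<bar> \<le> L * (\<bar>u y - u x\<bar> + \<bar>v y - v x\<bar>)"
  shows "w \<in> form_domain"
proof -
  obtain B where uL: "u \<in> Lp 2 m" and B: "\<And>h. 0 < h \<Longrightarrow> approx_form m P h u u \<le> B"
    using form_domainD[OF u] by blast
  obtain C where vL: "v \<in> Lp 2 m" and C: "\<And>h. 0 < h \<Longrightarrow> approx_form m P h v v \<le> C"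
    using form_domainD[OF v] by blast
  note [measurable] = uL[THEN Lp_meas] vL[THEN Lp_meas]
  have sq: "(w y - w x)\<^sup>2 \<le> (2 * L\<^sup>2) * ((u y - u x)\<^sup>2 + (v y - v x)\<^sup>2)" for x y
  proof -
    have "(w y - w x)\<^sup>2 = \<bar>w y - w x\<bar>\<^sup>2" by simp
    also have "\<dots> \<le> (L * (\<bar>u y - u x\<bar> + \<bar>v y - v x\<bar>))\<^sup>2" using L by (intro power_mono) auto
    also have "\<dots> = L\<^sup>2 * (\<bar>u y - u x\<bar> + \<bar>v y - v x\<bar>)\<^sup>2" by (simp add: power_mult_distrib)
    also have "\<dots> \<le> L\<^sup>2 * (2 * (\<bar>u y - u x\<bar>\<^sup>2 + \<bar>v y - v x\<bar>\<^sup>2))"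
      using sum_squares_bound[of "\<bar>u y - u x\<bar>" "\<bar>v y - v x\<bar>"]
      by (intro mult_left_mono) (auto simp: power2_sum)
    finally show ?thesis by (simp add: algebra_simps)
  qed
  have D: "defect w h \<le> (2 * L\<^sup>2) * (defect u h + defect v h)" if h: "0 < h" for h
  proof -
    have h0: "0 \<le> h" using h by simp
    have um: "(\<lambda>(x, y). ennreal ((u y - u x)\<^sup>2)) \<in> borel_measurable borel"
      and vm: "(\<lambda>(x, y). ennreal ((v y - v x)\<^sup>2)) \<in> borel_measurable borel"
      and uvm: "(\<lambda>(x, y). ennreal ((u y - u x)\<^sup>2) + ennreal ((v y - v x)\<^sup>2)) \<in> borel_measurable borel"
      unfolding borel_pair[symmetric] by measurable
    have "joint h (\<lambda>x y. ennreal ((w y - w x)\<^sup>2))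
      \<le> joint h (\<lambda>x y. ennreal (2 * L\<^sup>2) * (ennreal ((u y - u x)\<^sup>2) + ennreal ((v y - v x)\<^sup>2)))"
      unfolding joint_def using sq
      by (intro nn_integral_mono) (simp add: ennreal_mult[symmetric] ennreal_plus[symmetric] ennreal_leI del: ennreal_plus)
    also have "\<dots> = ennreal (2 * L\<^sup>2) * (joint h (\<lambda>x y. ennreal ((u y - u x)\<^sup>2)) + joint h (\<lambda>x y. ennreal ((v y - v x)\<^sup>2)))"
      unfolding joint_cmult[OF h0 uvm] joint_add[OF h0 um vm] ..
    also have "\<dots> = ennreal (2 * L\<^sup>2 * (2 * defect u h + 2 * defect v h))"
      using defect_nonneg[OF h0 uL] defect_nonneg[OF h0 vL]
      by (simp add: joint_square_eq_defect[OF h0] uL vL ennreal_mult[symmetric] ennreal_plus[symmetric] del: ennreal_plus)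
    finally have "2 * defect w h \<le> 2 * L\<^sup>2 * (2 * defect u h + 2 * defect v h)"
      using defect_nonneg[OF h0 uL] defect_nonneg[OF h0 vL]
      by (simp add: joint_square_eq_defect[OF h0 w] ennreal_le_iff)
    then show ?thesis by (simp add: algebra_simps)
  qed
  show ?thesis
  proof (rule form_domainI[OF w])
    fix h :: real assume h: "0 < h"
    have "defect w h / h \<le> (2 * L\<^sup>2) * (defect u h / h + defect v h / h)"
      using D[OF h] h by (simp add: field_simps)
    also have "\<dots> \<le> (2 * L\<^sup>2) * (B + C)"
      using B[OF h] C[OF h] h uL vL by (intro mult_left_mono) (auto simp: approx_form_defect)
    finally show "approx_form m P h w w \<le> (2 * L\<^sup>2) * (B + C)"
      using h w by (simp add: approx_form_defect)
  qed
qed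

end

section \<open>The jumping measure as an off-diagonal limit\<close>

locale jump_dirichlet_form = markov_semigroup_kernels m K
  for m :: "'a::{metric_space, second_countable_topology} measure" and K +
  fixes D :: "('a \<Rightarrow> real) set" and Q :: "('a \<Rightarrow> real) \<Rightarrow> ('a \<Rightarrow> real) \<Rightarrow> real"
    and J :: "('a \<times> 'a) measure"
  assumes lc: "locally compact (UNIV :: 'a set)"
    and assoc: "associated_semigroup m D Q (kernel_op K)"
    and regular: "regular_form m D Q"
    and jumping: "jumping_measure J"
    and pure_jump: "pure_jump_form m D Q J"
begin

lemma D_eq: "D = form_domain"
  using assoc by (auto simp: associated_semigroup_def form_domain_def)

lemma Q_lim: "u \<in> D \<Longrightarrow> v \<in> D \<Longrightarrow> ((\<lambda>t. approx_form m P t u v) \<longlongrightarrow> Q u v) (at_right 0)"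
  using assoc by (auto simp: associated_semigroup_def)

lemma D_L2: "u \<in> D \<Longrightarrow> u \<in> Lp 2 m"
  by (simp add: D_eq form_domain_def)

lemma zero_D: "(\<lambda>x. 0) \<in> D" and Q_zero: "Q (\<lambda>x. 0) (\<lambda>x. 0) = 0"
proof -
  have z: "approx_form m P t (\<lambda>x. 0) (\<lambda>x. 0) = 0" for t by (simp add: approx_form_def L2_inner_def)
  have "(\<lambda>x. 0) \<in> Lp 2 m" by (simp add: Lp_def)
  then show "(\<lambda>x. 0) \<in> D" unfolding D_eq by (rule form_domainI[where B = 0]) (simp add: z)
  from Q_lim[OF this this] show "Q (\<lambda>x. 0) (\<lambda>x. 0) = 0"
    unfolding z using tendsto_unique[OF _ _ tendsto_const] by (metis trivial_limit_at_right_real)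
qed

text \<open>The empty exceptional set has capacity 0, tested by the zero function.\<close>

lemma continuous_quasi_continuous_version:
  assumes "u \<in> D" "continuous_on UNIV u" shows "quasi_continuous_version m D Q u u"
proof -
  have "open_capacity m D Q {} \<le> ennreal (form1 m Q (\<lambda>x. 0) (\<lambda>x. 0))"
    unfolding open_capacity_def using zero_D by (intro INF_lower) auto
  also have "\<dots> = 0" by (simp add: form1_def Q_zero L2_inner_def)
  finally have "open_capacity m D Q {} = 0" by simp
  then have "quasi_continuous m D Q u"
    unfolding quasi_continuous_def using assms by (auto intro!: exI[of _ "{}"])
  then show ?thesis
    using D_L2[OF assms(1)] by (simp add: quasi_continuous_version_def Lp_def)
qed

lemma form_jump:
  assumes "u \<in> D" "v \<in> D" "continuous_on UNIV u" "continuous_on UNIV v"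
  shows "integrable J (\<lambda>(x, y). (u y - u x) * (v y - v x))"
    and "Q u v = 1/2 * (\<integral>(x, y). (u y - u x) * (v y - v x) \<partial>J)"
  using pure_jump continuous_quasi_continuous_version assms unfolding pure_jump_form_def by blast+

lemma sets_J: "sets J = sets (restrict_space borel (- diag))"
  using jumping by (simp add: jumping_measure_def radon_measure_on_def)

lemma space_J: "space J = - diag"
  using sets_eq_imp_space_eq[OF sets_J] by (simp add: space_restrict_space)

lemma meas_J: "f \<in> borel_measurable borel \<Longrightarrow> f \<in> borel_measurable J"
  using measurable_restrict_space1[of f borel _ "- diag"] measurable_cong_sets[OF sets_J refl] by blast

lemma measurable_swap_J: "prod.swap \<in> measurable J J"
proof -
  have c: "continuous_on UNIV (prod.swap :: 'a \<times> 'a \<Rightarrow> 'a \<times> 'a)"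
    by (auto simp: prod.swap_def intro!: continuous_intros)
  have m: "prod.swap \<in> measurable (restrict_space borel (- diag)) (restrict_space borel (- diag :: ('a \<times> 'a) set))"
    by (rule measurable_restrict_space3[OF borel_measurable_continuous_onI[OF c]]) (auto simp: diag_def)
  show ?thesis using m measurable_cong_sets[OF sets_J sets_J] by blast
qed

lemma distr_swap_J: "distr J J prod.swap = J"
proof (rule measure_eqI)
  fix A assume A: "A \<in> sets (distr J J prod.swap)"
  then have AJ: "A \<in> sets J" by simp
  then have "A \<subseteq> - diag" using sets.sets_into_space space_J by blast
  then have "prod.swap -` A \<inter> space J = prod.swap -` A" by (auto simp: space_J diag_def)
  then have "emeasure (distr J J prod.swap) A = emeasure J (prod.swap -` A)"
    using AJ measurable_swap_J by (simp add: emeasure_distr)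
  also have "\<dots> = emeasure J A" using jumping AJ by (simp add: jumping_measure_def)
  finally show "emeasure (distr J J prod.swap) A = emeasure J A" .
qed simp

lemma nn_integral_J_swap:
  assumes F: "(\<lambda>(x, y). F x y) \<in> borel_measurable borel"
  shows "(\<integral>\<^sup>+(x, y). F y x \<partial>J) = (\<integral>\<^sup>+(x, y). F x y \<partial>J)"
proof -
  have "(\<integral>\<^sup>+(x, y). F x y \<partial>J) = (\<integral>\<^sup>+z. (\<lambda>(x, y). F x y) z \<partial>distr J J prod.swap)"
    by (simp add: distr_swap_J)
  also have "\<dots> = (\<integral>\<^sup>+z. (\<lambda>(x, y). F x y) (prod.swap z) \<partial>J)"
    by (rule nn_integral_distr[OF measurable_swap_J]) (use meas_J[OF F] in simp)
  finally show ?thesis unfolding case_prod_beta' by simp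
qed

text \<open>Integration with respect to \<open>K h x (dy) m(dx) / h\<close>, which approximates
\<open>J\<close> off the diagonal.\<close>

definition rate :: "real \<Rightarrow> ('a \<Rightarrow> 'a \<Rightarrow> ennreal) \<Rightarrow> ennreal" where
  "rate h F = ennreal (1 / h) * joint h F"

text \<open>Since the product \<open>g x * k x\<close> vanishes, the diagonal term of the approximating form
drops out and only the transition from \<open>g\<close> to \<open>k\<close> remains.\<close>

lemma rate_product:
  assumes h: "0 < h" and g: "g \<in> Lp 2 m" "\<And>x. 0 \<le> g x" and k: "k \<in> Lp 2 m" "\<And>x. 0 \<le> k x"
    and gk: "\<And>x. g x * k x = 0"
  shows "rate h (\<lambda>x y. ennreal (g x * k y)) = ennreal (- approx_form m P h k g)"
proof -
  have h0: "0 \<le> h" using h by simp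
  note I = L2_integrable_mult[OF P_L2[OF h0 k(1)] g(1)]
  have "joint h (\<lambda>x y. ennreal (g x * k y)) = (\<integral>\<^sup>+x. ennreal (P h k x * g x) \<partial>m)"
    unfolding joint_def
  proof (rule nn_integral_cong_AE)
    show "AE x in m. (\<integral>\<^sup>+y. ennreal (g x * k y) \<partial>K h x) = ennreal (P h k x * g x)"
      using nn_P_AE[of 2, simplified, OF h0 k(1) k(2)]
    proof eventually_elim
      case (elim x)
      have "(\<integral>\<^sup>+y. ennreal (g x * k y) \<partial>K h x) = ennreal (g x) * (\<integral>\<^sup>+y. ennreal (k y) \<partial>K h x)"
        using g(2) k Lp_meas[OF k(1)] by (simp add: ennreal_mult' nn_integral_cmult meas_K_iff[OF h0])
      then show ?case using elim g(2) P_nonneg[of k, OF k(2)] by (simp add: ennreal_mult mult.commute)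
    qed
  qed
  also have "\<dots> = ennreal (L2_inner m (P h k) g)"
    unfolding L2_inner_def using g(2) P_nonneg[of k, OF k(2)] by (intro nn_integral_eq_integral[OF I]) auto
  finally have j: "joint h (\<lambda>x y. ennreal (g x * k y)) = ennreal (L2_inner m (P h k) g)" .
  have "k x * g x = 0" for x using gk[of x] by (simp add: mult.commute)
  then have "L2_inner m k g = 0" by (simp only: L2_inner_def) simp
  then have "- approx_form m P h k g = 1 / h * L2_inner m (P h k) g"
    by (simp add: approx_form_eq[OF h0 k(1) g(1)])
  then show ?thesis unfolding rate_def j using h by (simp add: ennreal_mult'[symmetric])
qed

text \<open>The same cancellation in the limit form: the product of the increments of \<open>k\<close> and
\<open>g\<close> reduces to the two cross terms, which are equal in integral by symmetry of
\<open>J\<close>.\<close>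

lemma jump_product:
  assumes g: "g \<in> D" "continuous_on UNIV g" "\<And>x. 0 \<le> g x" and k: "k \<in> D" "continuous_on UNIV k" "\<And>x. 0 \<le> k x"
    and gk: "\<And>x. g x * k x = 0"
  shows "(\<integral>\<^sup>+(x, y). ennreal (g x * k y) \<partial>J) = ennreal (- Q k g)"
proof -
  have e: "(k y - k x) * (g y - g x) = - (g x * k y + g y * k x)" for x y
  proof -
    have "(k y - k x) * (g y - g x) = g y * k y + g x * k x - (g x * k y + g y * k x)"
      by (simp add: algebra_simps)
    then show ?thesis unfolding gk by simp
  qed
  have m: "(\<lambda>(x, y). g x * k y) \<in> borel_measurable borel" "(\<lambda>(x, y). g y * k x) \<in> borel_measurable borel"
    unfolding case_prod_beta by (intro borel_measurable_continuous_onI continuous_intros continuous_on_compose2[OF g(2)] continuous_on_compose2[OF k(2)]; simp)+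
  note mJ = m[THEN meas_J]
  have mE: "(\<lambda>z. ennreal (case z of (x, y) \<Rightarrow> g x * k y)) \<in> borel_measurable borel"
    using m(1) by measurable
  have 1: "(\<integral>\<^sup>+(x, y). ennreal (g y * k x) \<partial>J) = (\<integral>\<^sup>+(x, y). ennreal (g x * k y) \<partial>J)"
    using mE by (intro nn_integral_J_swap) (simp add: case_prod_beta)
  have 2: "(\<integral>\<^sup>+(x, y). ennreal (g x * k y + g y * k x) \<partial>J)
    = (\<integral>\<^sup>+(x, y). ennreal (g x * k y) \<partial>J) + (\<integral>\<^sup>+(x, y). ennreal (g y * k x) \<partial>J)"
    using mJ g k unfolding case_prod_beta by (subst nn_integral_add[symmetric]) (auto simp: case_prod_beta)
  have 3: "(\<integral>\<^sup>+(x, y). ennreal (g x * k y + g y * k x) \<partial>J) = ennreal (2 * (- Q k g))"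
  proof -
    define G where "G = (\<lambda>(x, y). g x * k y + g y * k x)"
    have eG: "(\<lambda>(x, y). (k y - k x) * (g y - g x)) = (\<lambda>z. - G z)"
      unfolding e by (auto simp: G_def fun_eq_iff)
    have iG: "integrable J G"
      using form_jump(1)[OF k(1) g(1) k(2) g(2)] unfolding eG by simp
    have "Q k g = 1 / 2 * (\<integral>z. - G z \<partial>J)"
      using form_jump(2)[OF k(1) g(1) k(2) g(2)] unfolding eG .
    then have "2 * (- Q k g) = (\<integral>z. G z \<partial>J)" by simp
    moreover have "(\<integral>\<^sup>+(x, y). ennreal (g x * k y + g y * k x) \<partial>J) = (\<integral>\<^sup>+z. ennreal (G z) \<partial>J)"
      by (simp add: G_def case_prod_beta')
    moreover have "\<dots> = ennreal (\<integral>z. G z \<partial>J)"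
      using g k by (intro nn_integral_eq_integral[OF iG]) (auto simp: G_def)
    ultimately show ?thesis by simp
  qed
  have "2 * (\<integral>\<^sup>+(x, y). ennreal (g x * k y) \<partial>J) = ennreal (2 * (- Q k g))"
    unfolding 3[symmetric] 2 1 by (rule mult_2)
  also have "\<dots> = 2 * ennreal (- Q k g)" by (subst ennreal_mult') auto
  finally show ?thesis by (subst (asm) ennreal_mult_cancel_left) auto
qed

lemma rate_product_tendsto:
  assumes g: "g \<in> D" "continuous_on UNIV g" "\<And>x. 0 \<le> g x" and k: "k \<in> D" "continuous_on UNIV k" "\<And>x. 0 \<le> k x"
    and gk: "\<And>x. g x * k x = 0"
    and h: "\<And>n. 0 < h n" "h \<longlonglongrightarrow> 0"
  shows "(\<lambda>n. rate (h n) (\<lambda>x y. ennreal (g x * k y))) \<longlonglongrightarrow> (\<integral>\<^sup>+(x, y). ennreal (g x * k y) \<partial>J)"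
    and "(\<integral>\<^sup>+(x, y). ennreal (g x * k y) \<partial>J) < \<infinity>"
proof -
  have hF: "filterlim h (at_right 0) sequentially"
    using h by (rule filterlim_at_right_0_sequence)
  show "(\<lambda>n. rate (h n) (\<lambda>x y. ennreal (g x * k y))) \<longlonglongrightarrow> (\<integral>\<^sup>+(x, y). ennreal (g x * k y) \<partial>J)"
    unfolding jump_product[OF g k gk] rate_product[OF h(1) D_L2[OF g(1)] g(3) D_L2[OF k(1)] k(3) gk]
    by (intro tendsto_ennrealI tendsto_minus filterlim_compose[OF Q_lim[OF k(1) g(1)] hF])
  show "(\<integral>\<^sup>+(x, y). ennreal (g x * k y) \<partial>J) < \<infinity>"
    unfolding jump_product[OF g k gk] by simp
qed

end

section \<open>Partitions of unity in the domain and a Fatou lemma for the jumping measure\<close>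

context jump_dirichlet_form
begin

lemma D_contraction:
  assumes "u \<in> D" "v \<in> D" "w \<in> Lp 2 m" "0 \<le> L" "\<And>x y. \<bar>w y - w x\<bar> \<le> L * (\<bar>u y - u x\<bar> + \<bar>v y - v x\<bar>)"
  shows "w \<in> D"
  using form_domain_contraction[of u v w L] assms by (simp add: D_eq)

definition cutoff :: "('a \<Rightarrow> real) set" where
  "cutoff = {b \<in> D \<inter> Cc. \<forall>x. 0 \<le> b x \<and> b x \<le> 1}"

text \<open>Closes the cutoffs under the step \<open>f \<mapsto> f * (1 - b)\<close>, from which the
partition of unity is built.\<close>

lemma cutoff_mult_compl:
  assumes f: "f \<in> cutoff" and b: "b \<in> cutoff" shows "(\<lambda>x. f x * (1 - b x)) \<in> cutoff"
proof -
  have r: "0 \<le> f x" "f x \<le> 1" "0 \<le> b x" "b x \<le> 1" for x using f b by (auto simp: cutoff_def)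
  have fm: "f \<in> D" "b \<in> D" using f b by (auto simp: cutoff_def)
  have cf: "continuous_on UNIV f" "continuous_on UNIV b" using f b by (auto simp: cutoff_def Cc_def)
  have c: "continuous_on UNIV (\<lambda>x. f x * (1 - b x))" by (intro continuous_intros cf)
  have le: "\<bar>f x * (1 - b x)\<bar> \<le> \<bar>f x\<bar>" for x
    using r[of x] by (simp add: abs_mult mult_left_le)
  have L: "(\<lambda>x. f x * (1 - b x)) \<in> Lp 2 m"
    using le by (intro Lp_le[OF _ D_L2[OF fm(1)]] borel_measurable_continuous_onI[OF c]) auto
  have lip: "\<bar>f y * (1 - b y) - f x * (1 - b x)\<bar> \<le> 1 * (\<bar>f y - f x\<bar> + \<bar>b y - b x\<bar>)" for x y
  proof -
    have "f y * (1 - b y) - f x * (1 - b x) = (f y - f x) * (1 - b y) + f x * (b x - b y)"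
      by (simp add: algebra_simps)
    also have "\<bar>\<dots>\<bar> \<le> \<bar>f y - f x\<bar> * \<bar>1 - b y\<bar> + \<bar>f x\<bar> * \<bar>b x - b y\<bar>"
      by (rule order_trans[OF abs_triangle_ineq]) (simp add: abs_mult)
    also have "\<dots> \<le> \<bar>f y - f x\<bar> * 1 + 1 * \<bar>b x - b y\<bar>"
      using r by (intro add_mono mult_left_mono mult_right_mono) auto
    finally show ?thesis by (simp add: abs_minus_commute)
  qed
  have D: "(\<lambda>x. f x * (1 - b x)) \<in> D"
    by (rule D_contraction[OF fm L _ lip]) simp
  have cs: "closure {x. f x * (1 - b x) \<noteq> 0} \<subseteq> closure {x. f x \<noteq> 0}"
    by (intro closure_mono) auto
  have "compact (closure {x. f x \<noteq> 0})" using f by (auto simp: cutoff_def Cc_def)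
  from compact_Int_closed[OF this closed_closure, of "{x. f x * (1 - b x) \<noteq> 0}"]
  have "compact (closure {x. f x * (1 - b x) \<noteq> 0})" using cs by (simp add: Int_absorb1)
  then show ?thesis using D c r by (auto simp: cutoff_def Cc_def mult_le_one)
qed

lemma cutoff_prod:
  assumes "f \<in> cutoff" "\<And>j. j < n \<Longrightarrow> b j \<in> cutoff"
  shows "(\<lambda>x. f x * (\<Prod>j<(n::nat). 1 - b j x)) \<in> cutoff"
  using assms(2)
proof (induction n)
  case 0 then show ?case using assms(1) by simp
next
  case (Suc n)
  then have "(\<lambda>x. (f x * (\<Prod>j<n. 1 - b j x)) * (1 - b n x)) \<in> cutoff"
    by (intro cutoff_mult_compl) auto
  then show ?case by (simp add: mult.assoc)
qed

text \<open>Regularity provides an element of the domain that is uniformly within 1/4 of a tent function at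
\<open>x\<close>. The piecewise linear map that sends values up to 1/2 to 0 and values from 3/4
on to 1 makes it a cutoff that equals 1 near \<open>x\<close> and vanishes wherever the tent
does.\<close>

lemma local_cutoff:
  assumes r: "0 < r"
  obtains b U where "b \<in> cutoff" "open U" "x \<in> U" "\<And>y. y \<in> U \<Longrightarrow> b y = 1" "\<And>y. b y \<noteq> 0 \<Longrightarrow> dist x y < r"
proof -
  obtain s0 where s0: "0 < s0" "compact (cball x s0)" using locally_compact_cball[OF lc] .
  define s where "s = min s0 (r / 2)"
  have s: "0 < s" "s \<le> s0" "s < r" using s0 r by (auto simp: s_def)
  have "cball x s0 \<inter> cball x s = cball x s" using s by auto
  then have cs: "compact (cball x s)" using compact_Int_closed[OF s0(2) closed_cball, of x s] by simp
  define h where "h y = max 0 (1 - dist x y / s)" for y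
  have hc: "continuous_on UNIV h" unfolding h_def using s by (intro continuous_intros) auto
  have hz: "h y \<noteq> 0 \<Longrightarrow> y \<in> cball x s" for y
    using s by (auto simp: h_def max_def field_simps split: if_splits)
  have sub: "closure S \<subseteq> cball x s" if "S \<subseteq> cball x s" for S
    using that closure_minimal by blast
  have comp: "compact (closure S)" if "S \<subseteq> cball x s" for S
    using compact_Int_closed[OF cs closed_closure, of S] sub[OF that] by (metis inf.absorb_iff2)
  have "h \<in> Cc" unfolding Cc_def using hc hz by (auto intro!: comp)
  then obtain g where g: "g \<in> D" "g \<in> Cc" "\<And>y. \<bar>h y - g y\<bar> < 1/4"
    using regular unfolding regular_form_def by (metis IntD1 IntD2 zero_less_divide_1_iff zero_less_numeral)
  define T :: "real \<Rightarrow> real" where "T a = min (max (4 * (a - 1/2)) 0) 1" for a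
  define b where "b y = T (g y)" for y
  have gc: "continuous_on UNIV g" using g by (simp add: Cc_def)
  have bc: "continuous_on UNIV b" unfolding b_def T_def by (intro continuous_intros gc)
  have T_lip: "\<bar>T a - T c\<bar> \<le> 4 * \<bar>a - c\<bar>" for a c by (auto simp: T_def min_def max_def abs_if)
  have bz: "y \<in> cball x s" if "b y \<noteq> 0" for y
  proof (rule hz)
    show "h y \<noteq> 0" using that g(3)[of y] by (auto simp: b_def T_def)
  qed
  have b_le: "\<bar>b y\<bar> \<le> \<bar>4 * g y\<bar>" for y by (auto simp: b_def T_def)
  have g4: "(\<lambda>y. 4 * g y) \<in> Lp 2 m"
    using D_L2[OF g(1)] by (auto simp: Lp_def abs_mult powr_mult intro!: borel_measurable_times)
  have bL: "b \<in> Lp 2 m"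
    by (rule Lp_le[OF _ g4 borel_measurable_continuous_onI[OF bc] AE_I2[OF b_le]]) simp
  have bD: "b \<in> D"
    by (rule D_contraction[OF g(1) g(1) bL, of 2]) (use T_lip in \<open>auto simp: b_def\<close>)
  have "compact (closure {y. b y \<noteq> 0})" using bz by (intro comp) auto
  then have bcut: "b \<in> cutoff" using bD bc by (auto simp: cutoff_def Cc_def b_def T_def)
  let ?U = "{y. 3/4 < g y}"
  have "open ?U" by (intro open_Collect_less continuous_on_const gc)
  moreover have "x \<in> ?U"
  proof -
    have "h x = 1" by (simp add: h_def)
    then have "\<bar>1 - g x\<bar> < 1/4" using g(3)[of x] by metis
    then have "3/4 < g x" by linarith
    then show ?thesis by simp
  qed
  moreover have "b y = 1" if "y \<in> ?U" for y using that by (auto simp: b_def T_def)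
  moreover have "dist x y < r" if "b y \<noteq> 0" for y using bz[OF that] s by auto
  ultimately show ?thesis using that bcut by blast
qed

text \<open>Telescoping: with countably many cutoffs \<open>b i\<close> whose level sets at height 1 cover
the space, the functions \<open>b i * (\<Prod>j<i. 1 - b j)\<close> sum to one and have supports
of small diameter.\<close>

lemma cutoff_partition:
  assumes r: "0 < r"
  obtains w :: "nat \<Rightarrow> 'a \<Rightarrow> real" where "\<And>i. w i \<in> cutoff" "\<And>x. (\<Sum>i. ennreal (w i x)) = 1"
    "\<And>i x y. w i x \<noteq> 0 \<Longrightarrow> w i y \<noteq> 0 \<Longrightarrow> dist x y < r"
proof -
  let ?F = "{U. open U \<and> (\<exists>b c. b \<in> cutoff \<and> (\<forall>y\<in>U. b y = 1) \<and> (\<forall>y. b y \<noteq> 0 \<longrightarrow> dist c y < r / 2))}"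
  obtain F where F: "F \<subseteq> ?F" "countable F" "\<Union>F = \<Union>?F"
    using Lindelof[of ?F] by blast
  have "x \<in> \<Union>?F" for x
  proof -
    obtain b U where "b \<in> cutoff" "open U" "x \<in> U" "\<And>y. y \<in> U \<Longrightarrow> b y = 1" "\<And>y. b y \<noteq> 0 \<Longrightarrow> dist x y < r/2"
      using local_cutoff[of "r/2" x] r by (metis half_gt_zero)
    then show ?thesis by blast
  qed
  then have cover: "\<Union>F = UNIV" using F by blast
  then have "F \<noteq> {}" by auto
  define V where "V = from_nat_into F"
  have V: "V i \<in> F" for i unfolding V_def by (rule from_nat_into[OF \<open>F \<noteq> {}\<close>])
  have "\<forall>i. \<exists>b c. b \<in> cutoff \<and> (\<forall>y\<in>V i. b y = 1) \<and> (\<forall>y. b y \<noteq> 0 \<longrightarrow> dist c y < r / 2)"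
    using V F(1) by blast
  then obtain b c where b: "\<And>i. b i \<in> cutoff" "\<And>i y. y \<in> V i \<Longrightarrow> b i y = 1" "\<And>i y. b i y \<noteq> 0 \<Longrightarrow> dist (c i) y < r / 2"
    by metis
  have b01: "0 \<le> b i x" "b i x \<le> 1" for i x using b(1)[of i] by (auto simp: cutoff_def)
  define w where "w i x = b i x * (\<Prod>j<i. 1 - b j x)" for i x
  have 1: "w i \<in> cutoff" for i
    unfolding w_def using b by (intro cutoff_prod) auto
  have 3: "dist x y < r" if "w i x \<noteq> 0" "w i y \<noteq> 0" for i x y
  proof -
    have "dist (c i) x < r/2" "dist (c i) y < r/2" using that b(3) by (auto simp: w_def)
    then show ?thesis by (smt (verit) dist_commute dist_triangle field_sum_of_halves)
  qed
  have part: "(\<Sum>i<n. w i x) = 1 - (\<Prod>j<n. 1 - b j x)" for n x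
    by (induction n) (auto simp: w_def algebra_simps)
  have 2: "(\<Sum>i. ennreal (w i x)) = 1" for x
  proof -
    obtain U where "U \<in> F" "x \<in> U" using cover by blast
    then obtain j where j: "x \<in> V j" unfolding V_def using from_nat_into_surj[OF F(2)] by metis
    have one: "(\<Sum>i<n. w i x) = 1" if "j < n" for n
    proof -
      have "(\<Prod>j<n. 1 - b j x) = 0" using that b(2)[OF j] by (intro prod_zero) (auto intro!: bexI[of _ j])
      then show ?thesis by (simp add: part)
    qed
    have "w i x = 0" if "i \<notin> {..<Suc j}" for i
    proof -
      have "(\<Sum>i<Suc i. w i x) = 1" "(\<Sum>i<i. w i x) = 1" using that by (intro one; simp)+
      then show ?thesis by simp
    qed
    then have "(\<lambda>i. w i x) sums (\<Sum>i<Suc j. w i x)" by (intro sums_finite) auto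
    then have s1: "(\<lambda>i. w i x) sums 1" using one[OF lessI] by (simp only:)
    have nn: "0 \<le> w i x" for i using b01 by (auto simp: w_def intro!: mult_nonneg_nonneg prod_nonneg)
    show ?thesis by (subst suminf_ennreal_eq[OF nn s1]) simp
  qed
  show ?thesis using that 1 2 3 by blast
qed


lemma rate_mono: 
  assumes "\<And>x y. F x y \<le> G x y" shows "rate h F \<le> rate h G"
  unfolding rate_def joint_def using assms by (intro mult_left_mono nn_integral_mono) auto

lemma suminf_liminf_le:
  fixes a :: "nat \<Rightarrow> nat \<Rightarrow> ennreal"
  shows "(\<Sum>k. liminf (\<lambda>n. a k n)) \<le> liminf (\<lambda>n. \<Sum>k. a k n)"
  using nn_integral_liminf[of "\<lambda>n k. a k n" "count_space UNIV"] by (simp add: nn_integral_count_space_nat)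

text \<open>On the compact supports of \<open>g\<close> and \<open>k\<close> the integrands are eventually
at least \<open>c - \<epsilon>\<close>, and the remaining product integrals converge.\<close>

lemma rate_liminf_product:
  assumes g: "g \<in> cutoff" and k: "k \<in> cutoff" and gk: "\<And>x. g x * k x = 0"
    and h: "\<And>n. 0 < h n" "h \<longlonglongrightarrow> 0"
    and c: "\<And>x y. g x \<noteq> 0 \<Longrightarrow> k y \<noteq> 0 \<Longrightarrow> c \<le> F x y"
    and F: "\<And>C \<epsilon>. compact C \<Longrightarrow> 0 < \<epsilon> \<Longrightarrow> \<forall>\<^sub>F n in sequentially. \<forall>x\<in>C. \<forall>y\<in>C. F x y - \<epsilon> \<le> G n x y"
  shows "ennreal c * (\<integral>\<^sup>+(x, y). ennreal (g x * k y) \<partial>J)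
    \<le> liminf (\<lambda>n. rate (h n) (\<lambda>x y. ennreal (G n x y) * ennreal (g x * k y)))"
proof -
  have gp: "g \<in> D" "continuous_on UNIV g" "\<And>x. 0 \<le> g x" and kp: "k \<in> D" "continuous_on UNIV k" "\<And>x. 0 \<le> k x"
    using g k by (auto simp: cutoff_def Cc_def)
  define L where "L = (\<integral>\<^sup>+(x, y). ennreal (g x * k y) \<partial>J)"
  note lim = rate_product_tendsto[OF gp kp gk h, folded L_def]
  have m: "(\<lambda>(x, y). ennreal (g x * k y)) \<in> borel_measurable borel"
    unfolding case_prod_beta'
    by (intro measurable_compose[OF _ measurable_ennreal] borel_measurable_continuous_onI continuous_intros
        continuous_on_compose2[OF gp(2)] continuous_on_compose2[OF kp(2)]; simp)
  define C where "C = closure {x. g x \<noteq> 0} \<union> closure {x. k x \<noteq> 0}"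
  have C: "compact C" using g k by (auto simp: C_def cutoff_def Cc_def)
  have inC: "g x \<noteq> 0 \<Longrightarrow> x \<in> C" "k x \<noteq> 0 \<Longrightarrow> x \<in> C" for x
    using closure_subset[of "{x. g x \<noteq> 0}"] closure_subset[of "{x. k x \<noteq> 0}"] by (auto simp: C_def)
  have *: "ennreal (c - \<epsilon>) * L \<le> liminf (\<lambda>n. rate (h n) (\<lambda>x y. ennreal (G n x y) * ennreal (g x * k y)))"
    if e: "0 < \<epsilon>" for \<epsilon>
  proof -
    have "(\<lambda>n. ennreal (c - \<epsilon>) * rate (h n) (\<lambda>x y. ennreal (g x * k y))) \<longlonglongrightarrow> ennreal (c - \<epsilon>) * L"
      by (rule ennreal_tendsto_cmult[OF _ lim(1)]) simp
    then have "ennreal (c - \<epsilon>) * L = liminf (\<lambda>n. ennreal (c - \<epsilon>) * rate (h n) (\<lambda>x y. ennreal (g x * k y)))"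
      by (simp add: lim_imp_Liminf)
    also have "\<dots> \<le> liminf (\<lambda>n. rate (h n) (\<lambda>x y. ennreal (G n x y) * ennreal (g x * k y)))"
    proof (rule Liminf_mono)
      show "\<forall>\<^sub>F n in sequentially. ennreal (c - \<epsilon>) * rate (h n) (\<lambda>x y. ennreal (g x * k y))
          \<le> rate (h n) (\<lambda>x y. ennreal (G n x y) * ennreal (g x * k y))"
        using F[OF C e]
      proof eventually_elim
        case (elim n)
        have "ennreal (c - \<epsilon>) * rate (h n) (\<lambda>x y. ennreal (g x * k y)) = rate (h n) (\<lambda>x y. ennreal (c - \<epsilon>) * ennreal (g x * k y))"
          unfolding rate_def using h(1)[of n] by (subst joint_cmult[OF _ m]) (auto simp: mult.left_commute)
        also have "\<dots> \<le> rate (h n) (\<lambda>x y. ennreal (G n x y) * ennreal (g x * k y))"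
        proof (rule rate_mono)
          fix x y
          show "ennreal (c - \<epsilon>) * ennreal (g x * k y) \<le> ennreal (G n x y) * ennreal (g x * k y)"
          proof (cases "g x \<noteq> 0 \<and> k y \<noteq> 0")
            case True
            then have "c - \<epsilon> \<le> G n x y" using elim inC c[of x y] by force
            then show ?thesis by (intro mult_right_mono ennreal_leI) auto
          qed auto
        qed
        finally show ?case .
      qed
    qed
    finally show ?thesis .
  qed
  obtain l where l: "L = ennreal l" "0 \<le> l" using lim(2) by (cases L) auto
  have "(\<lambda>n. ennreal ((c - 1 / real (Suc n)) * l)) \<longlonglongrightarrow> ennreal ((c - 0) * l)"
    by (intro tendsto_ennrealI tendsto_intros LIMSEQ_Suc[OF lim_1_over_n])
  then have "(\<lambda>n. ennreal (c - 1 / real (Suc n)) * L) \<longlonglongrightarrow> ennreal c * L"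
    using l by (simp add: ennreal_mult'')
  then show ?thesis
    unfolding L_def[symmetric] by (rule LIMSEQ_le_const2) (auto intro!: *)
qed

text \<open>The diagonal carries no \<open>J\<close>-mass, so at \<open>x \<noteq> y\<close> a sufficiently
fine partition of unity resolves the two points by members with disjoint supports. The products
of such members, weighted by the infimum of \<open>F\<close> over their supports, add up to
minorants of \<open>F\<close> whose lower limit off the diagonal is \<open>F\<close>; for each
of them the estimate of the previous lemma is summed by Fatou's lemma for series.\<close>

lemma rate_liminf:
  fixes F :: "'a \<Rightarrow> 'a \<Rightarrow> real" and G :: "nat \<Rightarrow> 'a \<Rightarrow> 'a \<Rightarrow> real"
  assumes F_cont: "continuous_on UNIV (\<lambda>(x, y). F x y)" and F_nonneg: "\<And>x y. 0 \<le> F x y"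
    and G_meas: "\<And>n. (\<lambda>(x, y). G n x y) \<in> borel_measurable borel"
    and h: "\<And>n. 0 < h n" "h \<longlonglongrightarrow> 0"
    and FG: "\<And>C \<epsilon>. compact C \<Longrightarrow> 0 < \<epsilon> \<Longrightarrow> \<forall>\<^sub>F n in sequentially. \<forall>x\<in>C. \<forall>y\<in>C. F x y - \<epsilon> \<le> G n x y"
  shows "(\<integral>\<^sup>+(x, y). ennreal (F x y) \<partial>J) \<le> liminf (\<lambda>n. rate (h n) (\<lambda>x y. ennreal (G n x y)))"
    (is "_ \<le> ?R")
proof -
  have "\<exists>w. (\<forall>i. w i \<in> cutoff) \<and> (\<forall>x. (\<Sum>i. ennreal (w i x)) = 1) \<and>
     (\<forall>i x y. w i x \<noteq> 0 \<longrightarrow> w i y \<noteq> 0 \<longrightarrow> dist x y < r)" if "0 < r" for r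
    using cutoff_partition[OF that] by metis
  then have "\<forall>N. \<exists>w. (\<forall>i. w i \<in> cutoff) \<and> (\<forall>x. (\<Sum>i. ennreal (w i x)) = 1) \<and>
     (\<forall>i x y. w i x \<noteq> 0 \<longrightarrow> w i y \<noteq> 0 \<longrightarrow> dist x y < 1 / real (Suc N))" by simp
  then obtain w where w: "\<And>N i. w N i \<in> cutoff" "\<And>N x. (\<Sum>i. ennreal (w N i x)) = 1"
    "\<And>N i x y. w N i x \<noteq> 0 \<Longrightarrow> w N i y \<noteq> 0 \<Longrightarrow> dist x y < 1 / real (Suc N)" by metis
  have w0: "0 \<le> w N i x" for N i x using w(1)[of N i] by (auto simp: cutoff_def)
  have wc: "continuous_on UNIV (w N i)" for N i using w(1)[of N i] by (auto simp: cutoff_def Cc_def)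
  define a where "a N k x y = ennreal (w N (fst (prod_decode k)) x * w N (snd (prod_decode k)) y)" for N k x y
  have am: "(\<lambda>(x, y). a N k x y) \<in> borel_measurable borel" for N k
    unfolding a_def case_prod_beta'
    by (intro measurable_compose[OF _ measurable_ennreal] borel_measurable_continuous_onI continuous_intros
        continuous_on_compose2[OF wc]; simp)
  have a1: "(\<Sum>k. a N k x y) = 1" for N x y
  proof -
    have "(\<Sum>k. (\<lambda>(i, j). ennreal (w N i x) * ennreal (w N j y)) (prod_decode k)) = (\<Sum>i. ennreal (w N i x))"
      by (rule suminf_ennreal_2dimen) (simp add: w(2))
    then show ?thesis using w0 by (simp add: a_def w(2) case_prod_beta ennreal_mult)
  qed
  \<comment> \<open>Pairs of members whose supports meet get weight 0; near the diagonal nothing is claimed.\<close>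
  define disj where "disj N k \<longleftrightarrow> (\<forall>x. w N (fst (prod_decode k)) x * w N (snd (prod_decode k)) x = 0)" for N k
  define S where "S N k = {F x y | x y. w N (fst (prod_decode k)) x \<noteq> 0 \<and> w N (snd (prod_decode k)) y \<noteq> 0}" for N k
  define c where "c N k = (if disj N k then Inf (S N k) else 0)" for N k
  have Sbdd: "bdd_below (S N k)" for N k
    using F_nonneg by (auto simp: S_def intro!: bdd_belowI[of _ 0])
  have est: "(\<integral>\<^sup>+(x, y). (\<Sum>k. ennreal (c N k) * a N k x y) \<partial>J) \<le> ?R" for N
  proof -
    have "(\<integral>\<^sup>+(x, y). (\<Sum>k. ennreal (c N k) * a N k x y) \<partial>J) = (\<Sum>k. ennreal (c N k) * (\<integral>\<^sup>+(x, y). a N k x y \<partial>J))"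
      using am[THEN meas_J] unfolding case_prod_beta'
      by (subst nn_integral_suminf) (auto simp: nn_integral_cmult)
    also have "\<dots> \<le> (\<Sum>k. liminf (\<lambda>n. rate (h n) (\<lambda>x y. ennreal (G n x y) * a N k x y)))"
    proof (intro suminf_le summableI)
      fix k
      show "ennreal (c N k) * (\<integral>\<^sup>+(x, y). a N k x y \<partial>J) \<le> liminf (\<lambda>n. rate (h n) (\<lambda>x y. ennreal (G n x y) * a N k x y))"
      proof (cases "disj N k")
        case True
        then show ?thesis unfolding a_def
          using Sbdd[of N k]
          by (intro rate_liminf_product[OF w(1) w(1) _ h, where F = F])
             (auto simp: c_def disj_def S_def intro!: cInf_lower FG)
      qed (simp add: c_def)
    qed
    also have "\<dots> \<le> liminf (\<lambda>n. \<Sum>k. rate (h n) (\<lambda>x y. ennreal (G n x y) * a N k x y))"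
      by (rule suminf_liminf_le)
    also have "\<dots> = ?R"
    proof -
      have "(\<Sum>k. rate (h n) (\<lambda>x y. ennreal (G n x y) * a N k x y)) = rate (h n) (\<lambda>x y. ennreal (G n x y))" for n
      proof -
        have m: "(\<lambda>(x, y). ennreal (G n x y) * a N k x y) \<in> borel_measurable borel" for k
          using measurable_compose[OF G_meas[of n] measurable_ennreal] am[of N k] unfolding case_prod_beta' by measurable
        have "(\<Sum>k. rate (h n) (\<lambda>x y. ennreal (G n x y) * a N k x y)) = rate (h n) (\<lambda>x y. \<Sum>k. ennreal (G n x y) * a N k x y)"
          unfolding rate_def using h(1)[of n] m by (subst joint_suminf) auto
        then show ?thesis by (simp add: a1)
      qed
      then show ?thesis by simp
    qed
    finally show ?thesis .
  qed
  have low: "ennreal (F x y) \<le> liminf (\<lambda>N. \<Sum>k. ennreal (c N k) * a N k x y)" if xy: "x \<noteq> y" for x y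
  proof -
    have low': "ennreal (F x y - \<epsilon>) \<le> liminf (\<lambda>N. \<Sum>k. ennreal (c N k) * a N k x y)" if e: "0 < \<epsilon>" for \<epsilon>
    proof -
      obtain d where d: "0 < d" "\<And>z. dist z (x, y) < d \<Longrightarrow> dist ((\<lambda>(x, y). F x y) z) (F x y) < \<epsilon>"
        using F_cont e unfolding continuous_on_iff by (metis UNIV_I case_prod_conv)
      \<comment> \<open>Below this diameter, members that are nonzero at \<open>x\<close> and at \<open>y\<close> have
        disjoint supports and \<open>F\<close> varies by less than \<open>\<epsilon>\<close> on them.\<close>
      define r where "r = min (d / 2) (dist x y / 2)"
      have r: "0 < r" using d xy by (simp add: r_def)
      have "\<forall>\<^sub>F N in sequentially. 1 / real (Suc N) < r"
        using LIMSEQ_Suc[OF lim_1_over_n] r by (intro order_tendstoD(2)[where y = 0]) auto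
      then have "\<forall>\<^sub>F N in sequentially. ennreal (F x y - \<epsilon>) \<le> (\<Sum>k. ennreal (c N k) * a N k x y)"
      proof eventually_elim
        case (elim N)
        have "ennreal (F x y - \<epsilon>) * a N k x y \<le> ennreal (c N k) * a N k x y" for k
        proof (cases "a N k x y = 0")
          case False
          let ?i = "fst (prod_decode k)" and ?j = "snd (prod_decode k)"
          have nz: "w N ?i x \<noteq> 0" "w N ?j y \<noteq> 0" using False by (auto simp: a_def)
          have near: "dist x' x < r" if "w N ?i x' \<noteq> 0" for x' using w(3)[OF that nz(1)] elim by simp
          have near': "dist y' y < r" if "w N ?j y' \<noteq> 0" for y' using w(3)[OF that nz(2)] elim by simp
          have "disj N k"
            unfolding disj_def
          proof (rule allI, rule ccontr)
            fix z assume "w N ?i z * w N ?j z \<noteq> 0"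
            then have "dist z x < r" "dist z y < r" using near near' by auto
            then have "dist x y < 2 * r" by (smt (verit) dist_commute dist_triangle)
            then show False by (simp add: r_def)
          qed
          moreover have "F x y - \<epsilon> \<le> Inf (S N k)"
          proof (rule cInf_greatest)
            show "S N k \<noteq> {}" using nz by (auto simp: S_def)
            fix s assume "s \<in> S N k"
            then obtain x' y' where s: "s = F x' y'" "w N ?i x' \<noteq> 0" "w N ?j y' \<noteq> 0" by (auto simp: S_def)
            have "dist (x', y') (x, y) \<le> dist x' x + dist y' y"
              unfolding dist_Pair_Pair by (rule sqrt_sum_squares_le_sum) auto
            also have "\<dots> < d" using near[OF s(2)] near'[OF s(3)] by (simp add: r_def)
            finally have "dist (F x' y') (F x y) < \<epsilon>" using d(2)[of "(x', y')"] by simp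
            then show "F x y - \<epsilon> \<le> s" unfolding s(1) dist_real_def by linarith
          qed
          ultimately show ?thesis by (auto simp: c_def intro!: mult_right_mono ennreal_leI)
        qed simp
        then have "(\<Sum>k. ennreal (F x y - \<epsilon>) * a N k x y) \<le> (\<Sum>k. ennreal (c N k) * a N k x y)"
          by (intro suminf_le summableI)
        then show ?case by (simp add: a1)
      qed
      then show ?thesis by (rule Liminf_bounded)
    qed
    have "(\<lambda>n. ennreal (F x y - 1 / real (Suc n))) \<longlonglongrightarrow> ennreal (F x y - 0)"
      by (intro tendsto_ennrealI tendsto_intros LIMSEQ_Suc[OF lim_1_over_n])
    then show ?thesis by (intro LIMSEQ_le_const2) (auto intro!: low')
  qed
  have "(\<integral>\<^sup>+(x, y). ennreal (F x y) \<partial>J) \<le> (\<integral>\<^sup>+z. liminf (\<lambda>N. (\<lambda>(x, y). \<Sum>k. ennreal (c N k) * a N k x y) z) \<partial>J)"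
    using low by (intro nn_integral_mono) (auto simp: space_J diag_def)
  also have "\<dots> \<le> liminf (\<lambda>N. \<integral>\<^sup>+(x, y). (\<Sum>k. ennreal (c N k) * a N k x y) \<partial>J)"
  proof (rule nn_integral_liminf)
    fix N
    show "(\<lambda>(x, y). \<Sum>k. ennreal (c N k) * a N k x y) \<in> borel_measurable J"
      using am[THEN meas_J] unfolding case_prod_beta' by measurable
  qed
  also have "\<dots> \<le> ?R" by (rule Liminf_le) (use est in auto)
  finally show ?thesis .
qed

end

section \<open>Local uniform continuity of the semigroup in time\<close>

locale hardy_stein_setting = jump_dirichlet_form m K D Q J
  for m :: "'a::{metric_space, second_countable_topology} measure" and K D Q J +
  fixes p :: real
  assumes p: "1 < p"
    and full_supp: "measure_supp m = UNIV"
    and smoothing: "\<And>t g. 0 < t \<Longrightarrow> g \<in> Lp p m \<Longrightarrow> continuous_on UNIV (kernel_op K t g)"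
begin

lemma p_pos: "0 < p" using p by simp

text \<open>A nonempty open set has positive measure because \<open>m\<close> has full support.\<close>

lemma everywhere_le:
  fixes u w :: "'a \<Rightarrow> real"
  assumes u: "continuous_on UNIV u" and w: "continuous_on UNIV w" and ae: "AE x in m. u x \<le> w x"
  shows "u x \<le> w x"
proof (rule ccontr)
  assume "\<not> u x \<le> w x"
  let ?U = "{x. w x < u x}"
  have "open ?U" by (intro open_Collect_less u w)
  moreover have "x \<in> ?U" using \<open>\<not> u x \<le> w x\<close> by simp
  moreover have "x \<in> measure_supp m" using full_supp by simp
  ultimately have "0 < emeasure m ?U" unfolding measure_supp_def by blast
  moreover have "emeasure m ?U = 0"
  proof -
    have "?U \<in> sets m" using \<open>open ?U\<close> by (simp add: sets_m)
    then show ?thesis using ae by (subst (asm) AE_iff_measurable[of ?U]) (auto simp: not_le)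
  qed
  ultimately show False by simp
qed

lemma everywhere_eq:
  fixes u w :: "'a \<Rightarrow> real"
  assumes u: "continuous_on UNIV u" and w: "continuous_on UNIV w" and ae: "AE x in m. u x = w x"
  shows "u x = w x"
  by (intro antisym everywhere_le u w) (use ae in \<open>auto elim: eventually_mono\<close>)

lemma P_mono:
  assumes t: "0 < t" and f: "f \<in> Lp p m" and g: "g \<in> Lp p m" and ae: "AE x in m. f x \<le> g x"
  shows "P t f x \<le> P t g x"
  using t f g by (intro everywhere_le smoothing P_mono_AE[OF p _ f g ae]) auto

text \<open>Almost-everywhere statements about \<open>P t\<close> become pointwise by smoothing. The
truncations \<open>min \<bar>f\<bar> n\<close> have well-defined integrals that stay below
\<open>P t \<bar>f\<bar> x\<close> at every \<open>x\<close>, so the value of the Bochner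
integral is not a default value.\<close>

lemma integrable_kernel:
  assumes t: "0 < t" and f: "f \<in> Lp p m"
  shows "integrable (K t x) f"
proof -
  have t0: "0 \<le> t" using t by simp
  have fm [measurable]: "f \<in> borel_measurable borel" using f by (rule Lp_meas)
  define g where "g n y = min \<bar>f y\<bar> (real n)" for n y
  have gm [measurable]: "g n \<in> borel_measurable borel" for n unfolding g_def by measurable
  have aL: "(\<lambda>y. \<bar>f y\<bar>) \<in> Lp p m" by (rule Lp_le[OF p_pos f]) auto
  have gL: "g n \<in> Lp p m" for n by (rule Lp_le[OF p_pos f gm]) (auto simp: g_def)
  have g0: "0 \<le> g n y" "g n y \<le> real n" for n y by (auto simp: g_def)
  have "(SUP n. ennreal (g n y)) = ennreal \<bar>f y\<bar>" for y
  proof (rule antisym)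
    show "(SUP n. ennreal (g n y)) \<le> ennreal \<bar>f y\<bar>" by (intro SUP_least ennreal_leI) (auto simp: g_def)
    obtain j where "\<bar>f y\<bar> \<le> real j" using real_arch_simple by blast
    then have "g j y = \<bar>f y\<bar>" by (auto simp: g_def)
    then show "ennreal \<bar>f y\<bar> \<le> (SUP n. ennreal (g n y))" by (metis SUP_upper UNIV_I)
  qed
  then have "(\<integral>\<^sup>+y. ennreal \<bar>f y\<bar> \<partial>K t x) = (\<integral>\<^sup>+y. (SUP n. ennreal (g n y)) \<partial>K t x)" by simp
  also have "\<dots> = (SUP n. \<integral>\<^sup>+y. ennreal (g n y) \<partial>K t x)"
    by (intro nn_integral_monotone_convergence_SUP) (auto simp: incseq_def le_fun_def g_def meas_K_iff[OF t0] intro!: ennreal_leI)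
  also have "\<dots> \<le> ennreal (P t (\<lambda>y. \<bar>f y\<bar>) x)"
  proof (rule SUP_least)
    fix n
    have "(\<integral>\<^sup>+y. ennreal (g n y) \<partial>K t x) = ennreal (P t (g n) x)"
      using P_bounded_nn(1)[OF t0 gm g0] by simp
    also have "\<dots> \<le> ennreal (P t (\<lambda>y. \<bar>f y\<bar>) x)"
      by (intro ennreal_leI P_mono[OF t gL aL]) (auto simp: g_def)
    finally show "(\<integral>\<^sup>+y. ennreal (g n y) \<partial>K t x) \<le> ennreal (P t (\<lambda>y. \<bar>f y\<bar>) x)" .
  qed
  also have "\<dots> < \<infinity>" by simp
  finally show ?thesis by (intro integrableI_bounded) (auto simp: meas_K_iff[OF t0])
qed

lemma SUP_powr_le_suminf:
  fixes s :: "nat \<Rightarrow> real"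
  assumes s: "\<And>k. 0 \<le> s k" and fin: "(\<Sum>k. ennreal (s k powr p)) < \<infinity>"
  shows "(SUP k. ennreal (s k)) < \<infinity>"
    and "ennreal (enn2real (SUP k. ennreal (s k)) powr p) \<le> (\<Sum>k. ennreal (s k powr p))"
proof -
  obtain T where T: "(\<Sum>k. ennreal (s k powr p)) = ennreal T" "0 \<le> T"
    using fin unfolding infinity_ennreal_def less_top_ennreal by blast
  have "s k \<le> T powr (1 / p)" for k
  proof -
    have "ennreal (s k powr p) \<le> (\<Sum>k. ennreal (s k powr p))"
      using sum_le_suminf[of "\<lambda>k. ennreal (s k powr p)" "{k}"] by (simp del: suminf_ennreal)
    then have "s k powr p \<le> T" using T by simp
    then have "(s k powr p) powr (1 / p) \<le> T powr (1 / p)" using p by (intro powr_mono2) auto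
    then show ?thesis using s p by (simp add: powr_powr)
  qed
  then have le: "(SUP k. ennreal (s k)) \<le> ennreal (T powr (1 / p))" by (intro SUP_least ennreal_leI)
  then show "(SUP k. ennreal (s k)) < \<infinity>" by (rule le_less_trans) simp
  have "enn2real (SUP k. ennreal (s k)) \<le> T powr (1 / p)"
    using le by (intro enn2real_leI) auto
  then have "enn2real (SUP k. ennreal (s k)) powr p \<le> (T powr (1 / p)) powr p" using p by (intro powr_mono2) auto
  also have "\<dots> = T" using T(2) p by (cases "T = 0") (auto simp: powr_powr)
  finally show "ennreal (enn2real (SUP k. ennreal (s k)) powr p) \<le> (\<Sum>k. ennreal (s k powr p))"
    unfolding T by (rule ennreal_leI)
qed

text \<open>A gliding hump. If functions \<open>g k\<close> of rapidly decreasing energy kept \<open>P t (g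
k) (x k) > \<epsilon>\<close> on \<open>C\<close>, then the supremum of \<open>2 ^ k * g
k\<close> would still have finite energy, while its image under \<open>P t\<close> would be
unbounded on the compact set \<open>C\<close>, against continuity.\<close>

lemma P_uniformly_small:
  assumes t: "0 < t" and C: "compact C" and e: "0 < \<epsilon>"
  obtains \<eta> :: real where "0 < \<eta>"
    "\<And>g x. g \<in> Lp p m \<Longrightarrow> (\<And>y. 0 \<le> g y) \<Longrightarrow> energy p g \<le> ennreal \<eta> \<Longrightarrow> x \<in> C \<Longrightarrow> P t g x \<le> \<epsilon>"
proof (rule ccontr)
  assume neg: "\<not> thesis"
  have "\<exists>g x. g \<in> Lp p m \<and> (\<forall>y. 0 \<le> g y) \<and> energy p g \<le> ennreal ((1/2)^k / (2^k) powr p) \<and> x \<in> C \<and> \<epsilon> < P t g x" for k :: nat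
  proof (rule ccontr)
    assume "\<not> ?thesis"
    then show False using neg that[of "(1/2)^k / (2^k) powr p"] by (auto simp: not_less)
  qed
  then obtain g x where g: "\<And>k. g k \<in> Lp p m" "\<And>k y. 0 \<le> g k y"
    "\<And>k::nat. energy p (g k) \<le> ennreal ((1/2)^k / (2^k) powr p)" and x: "\<And>k. x k \<in> C" "\<And>k. \<epsilon> < P t (g k) (x k)"
    by metis
  define s where "s k y = 2^k * g k y" for k y
  have s0: "0 \<le> s k y" for k y using g(2) by (simp add: s_def)
  have gm [measurable]: "g k \<in> borel_measurable borel" for k using g(1) by (rule Lp_meas)
  have sm [measurable]: "s k \<in> borel_measurable borel" for k unfolding s_def by measurable
  have es: "energy p (s k) \<le> ennreal ((1/2)^k)" for k
  proof -
    have "energy p (s k) = (\<integral>\<^sup>+y. ennreal ((2^k) powr p) * ennreal (\<bar>g k y\<bar> powr p) \<partial>m)"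
      unfolding energy_def s_def by (simp add: abs_mult powr_mult ennreal_mult)
    also have "\<dots> = ennreal ((2^k) powr p) * energy p (g k)"
      unfolding energy_def by (rule nn_integral_cmult) (simp add: meas_m_iff)
    also have "\<dots> \<le> ennreal ((2^k) powr p) * ennreal ((1/2)^k / (2^k) powr p)"
      by (intro mult_left_mono g(3)) simp
    also have "\<dots> = ennreal ((1/2)^k)" by (simp add: ennreal_mult[symmetric])
    finally show ?thesis .
  qed
  have sL: "s k \<in> Lp p m" for k
    using sm le_less_trans[OF es[of k], of \<infinity>] by (simp add: Lp_iff)
  define G where "G y = enn2real (SUP k. ennreal (s k y))" for y
  have Gm [measurable]: "G \<in> borel_measurable borel" unfolding G_def by measurable
  have tot: "(\<integral>\<^sup>+y. (\<Sum>k. ennreal (s k y powr p)) \<partial>m) < \<infinity>"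
  proof -
    have "(\<integral>\<^sup>+y. (\<Sum>k. ennreal (s k y powr p)) \<partial>m) = (\<Sum>k. energy p (s k))"
      unfolding energy_def using s0 by (subst nn_integral_suminf) (auto simp: meas_m_iff)
    also have "\<dots> \<le> (\<Sum>k. ennreal ((1/2)^k))" by (intro suminf_le es summableI)
    also have "\<dots> = ennreal (\<Sum>k. (1/2)^k)" by (rule suminf_ennreal2) (auto intro!: summable_geometric)
    also have "\<dots> < \<infinity>" by simp
    finally show ?thesis .
  qed
  have ae: "AE y in m. (\<Sum>k. ennreal (s k y powr p)) < \<infinity>"
  proof -
    have "AE y in m. (\<Sum>k. ennreal (s k y powr p)) \<noteq> \<infinity>"
    proof (rule nn_integral_PInf_AE)
      show "(\<lambda>y. \<Sum>k. ennreal (s k y powr p)) \<in> borel_measurable m" unfolding meas_m_iff by measurable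
      show "(\<integral>\<^sup>+y. (\<Sum>k. ennreal (s k y powr p)) \<partial>m) \<noteq> \<infinity>" using tot by (rule less_imp_neq)
    qed
    then show ?thesis by (simp only: infinity_ennreal_def top.not_eq_extremum)
  qed
  \<comment> \<open>A supremum needs no triangle inequality: its \<open>p\<close>-th power is at most the sum of the
    \<open>p\<close>-th powers.\<close>
  have "energy p G \<le> (\<integral>\<^sup>+y. (\<Sum>k. ennreal (s k y powr p)) \<partial>m)"
    unfolding energy_def
  proof (rule nn_integral_mono_AE)
    show "AE y in m. ennreal (\<bar>G y\<bar> powr p) \<le> (\<Sum>k. ennreal (s k y powr p))"
      using ae
    proof eventually_elim
      case (elim y)
      have "\<bar>G y\<bar> = G y" by (simp add: G_def)
      then show ?case using SUP_powr_le_suminf(2)[OF s0 elim] by (simp only: G_def)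
    qed
  qed
  from le_less_trans[OF this tot] have GL: "G \<in> Lp p m" using Gm by (simp add: Lp_iff)
  have sG: "AE y in m. s k y \<le> G y" for k
    using ae
  proof eventually_elim
    case (elim y)
    have "(SUP k. ennreal (s k y)) < \<infinity>" using SUP_powr_le_suminf(1)[OF s0 elim] .
    then have "ennreal (s k y) \<le> ennreal (G y)"
      unfolding G_def by (auto intro: SUP_upper)
    then show ?case by (simp add: G_def)
  qed
  have "bounded ((P t G) ` C)"
    by (intro compact_imp_bounded compact_continuous_image C continuous_on_subset[OF smoothing[OF t GL]]) simp
  then obtain B where B: "\<And>x. x \<in> C \<Longrightarrow> \<bar>P t G x\<bar> \<le> B" by (auto simp: bounded_iff)
  have "2^k * \<epsilon> < B" for k
  proof -
    have "2^k * \<epsilon> < 2^k * P t (g k) (x k)" using x by simp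
    also have "\<dots> = P t (s k) (x k)" by (simp add: kernel_op_def s_def)
    also have "\<dots> \<le> P t G (x k)" by (rule P_mono[OF t sL GL sG])
    also have "\<dots> \<le> B" using B[OF x(1)[of k]] by simp
    finally show ?thesis .
  qed
  moreover obtain k where "B / \<epsilon> < 2^k" using real_arch_pow[of 2 "B/\<epsilon>"] by auto
  ultimately show False using e by (metis less_asym pos_divide_less_eq)
qed

text \<open>By the semigroup law the increment in time is \<open>P t\<close> applied to \<open>P (h n) f -
f\<close>, which has small energy.\<close>

lemma P_locally_uniform:
  assumes f: "f \<in> Lp p m" and h: "\<And>n. 0 < h n" and lim: "(\<lambda>n. energy p (\<lambda>x. P (h n) f x - f x)) \<longlonglongrightarrow> 0"
    and t: "0 < t" and C: "compact C" and e: "0 < \<epsilon>"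
  shows "\<forall>\<^sub>F n in sequentially. \<forall>x\<in>C. \<bar>P (t + h n) f x - P t f x\<bar> \<le> \<epsilon>"
proof -
  obtain \<eta> where eta: "0 < \<eta>"
    "\<And>g x. g \<in> Lp p m \<Longrightarrow> (\<And>y. 0 \<le> g y) \<Longrightarrow> energy p g \<le> ennreal \<eta> \<Longrightarrow> x \<in> C \<Longrightarrow> P t g x \<le> \<epsilon>"
    using P_uniformly_small[OF t C e] by blast
  have "\<forall>\<^sub>F n in sequentially. energy p (\<lambda>x. P (h n) f x - f x) < ennreal \<eta>"
    using order_tendstoD(2)[OF lim, of "ennreal \<eta>"] eta(1) by simp
  then show ?thesis
  proof (eventually_elim, intro ballI)
    fix n x assume small: "energy p (\<lambda>x. P (h n) f x - f x) < ennreal \<eta>" and x: "x \<in> C"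
    have h0: "0 \<le> h n" "0 \<le> t" "0 < t + h n" using h[of n] t by auto
    have PL: "P (h n) f \<in> Lp p m" by (rule P_Lp[OF p h0(1) f])
    define d where "d y = P (h n) f y - f y" for y
    have dL: "d \<in> Lp p m" unfolding d_def by (rule Lp_diff[OF p_pos PL f])
    have aL: "(\<lambda>y. \<bar>d y\<bar>) \<in> Lp p m" by (rule Lp_le[OF p_pos dL]) (use Lp_meas[OF dL] in auto)
    have "P (t + h n) f x - P t f x = P t (P (h n) f) x - P t f x"
      using everywhere_eq[OF smoothing[OF h0(3) f] smoothing[OF t PL] semigroup_Lp[OF p h0(2) h0(1) f]] by simp
    also have "P t (P (h n) f) x - P t f x = P t d x"
      unfolding kernel_op_def[of K t] d_def
      by (rule Bochner_Integration.integral_diff[OF integrable_kernel[OF t PL] integrable_kernel[OF t f], symmetric])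
    finally have "P (t + h n) f x - P t f x = P t d x" .
    also have "\<bar>\<dots>\<bar> \<le> P t (\<lambda>y. \<bar>d y\<bar>) x" by (simp add: kernel_op_def integral_abs_bound)
    also have "\<dots> \<le> \<epsilon>"
    proof (rule eta(2)[OF aL _ _ x])
      have "energy p (\<lambda>y. \<bar>d y\<bar>) = energy p (\<lambda>y. P (h n) f y - f y)" by (simp add: energy_def d_def)
      then show "energy p (\<lambda>y. \<bar>d y\<bar>) \<le> ennreal \<eta>" using small by simp
    qed simp
    finally show "\<bar>P (t + h n) f x - P t f x\<bar> \<le> \<epsilon>" .
  qed
qed

section \<open>Difference quotients of the p-energy at a fixed time\<close>

definition jump_energy :: "('a \<Rightarrow> real) \<Rightarrow> ennreal" where
  "jump_energy u = (\<integral>\<^sup>+(x, y). ennreal (bregman p (u x) (u y)) \<partial>J)"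

text \<open>By \<open>joint_bregman_eq_energy_diff\<close> this is the difference quotient of the
\<open>p\<close>-energy over a step of length \<open>h\<close>.\<close>

definition loss :: "('a \<Rightarrow> real) \<Rightarrow> real \<Rightarrow> ennreal" where
  "loss u h = rate h (\<lambda>x y. ennreal (bregman p (P h u x) (u y)))"

lemma joint_bregman_eq_energy_diff:
  assumes "0 < h" "u \<in> Lp p m"
  shows "joint h (\<lambda>x y. ennreal (bregman p (P h u x) (u y))) = energy p u - energy p (P h u)"
proof -
  have "joint h (\<lambda>x y. ennreal (bregman p (P h u x) (u y))) + energy p (P h u) = energy p u"
    using joint_bregman_energy[of p h u] assms p by simp
  moreover have "energy p (P h u) \<noteq> \<infinity>" using P_Lp[of p h u] assms p by (auto simp: Lp_iff)
  ultimately show ?thesis by (metis ennreal_add_diff_cancel_right infinity_ennreal_def)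
qed

text \<open>The difference quotients dominate the jump energy in the limit; uniform continuity of the
divergence on bounded sets transfers the local uniform convergence of \<open>P (t + h n)
f\<close> to the integrands.\<close>

lemma jump_energy_le_liminf:
  assumes f: "f \<in> Lp p m" and h: "\<And>n. 0 < h n" "h \<longlonglongrightarrow> 0"
    and lim: "(\<lambda>n. energy p (\<lambda>x. P (h n) f x - f x)) \<longlonglongrightarrow> 0" and t: "0 < t"
  shows "jump_energy (P t f) \<le> liminf (\<lambda>n. loss (P t f) (h n))"
proof -
  let ?u = "P t f"
  have uL: "?u \<in> Lp p m" using P_Lp[of p t f] p t f by simp
  have uc: "continuous_on UNIV ?u" by (rule smoothing[OF t f])
  have shift: "P (t + h n) f x = P (h n) ?u x" for n x
  proof (rule everywhere_eq)
    show "continuous_on UNIV (P (t + h n) f)" using smoothing[of "t + h n" f] t h(1)[of n] f by auto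
    show "continuous_on UNIV (P (h n) ?u)" by (rule smoothing[OF h(1) uL])
    show "AE x in m. P (t + h n) f x = P (h n) ?u x"
      using semigroup_Lp[OF p _ _ f, of "h n" t] h(1)[of n] t by (simp add: add.commute)
  qed
  have Pc: "continuous_on UNIV (P (h n) ?u)" for n by (rule smoothing[OF h(1) uL])
  have "jump_energy ?u \<le> liminf (\<lambda>n. rate (h n) (\<lambda>x y. ennreal (bregman p (P (h n) ?u x) (?u y))))"
    unfolding jump_energy_def
  proof (rule rate_liminf[OF _ _ _ h])
    show "continuous_on UNIV (\<lambda>(x, y). bregman p (?u x) (?u y))"
      unfolding case_prod_beta'
      by (intro continuous_on_bregman[OF p] continuous_on_compose2[OF uc] continuous_intros) auto
    show "0 \<le> bregman p (?u x) (?u y)" for x y by (rule bregman_nonneg[OF p])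
    show "(\<lambda>(x, y). bregman p (P (h n) ?u x) (?u y)) \<in> borel_measurable borel" for n
      unfolding case_prod_beta'
      by (intro borel_measurable_continuous_onI continuous_on_bregman[OF p] continuous_on_compose2[OF uc]
          continuous_on_compose2[OF Pc] continuous_intros) auto
    fix C :: "'a set" and \<epsilon> :: real assume C: "compact C" and e: "0 < \<epsilon>"
    have "bounded (?u ` C)"
      by (intro compact_imp_bounded compact_continuous_image C continuous_on_subset[OF uc]) simp
    then obtain R where R: "\<And>x. x \<in> C \<Longrightarrow> \<bar>?u x\<bar> \<le> R" by (auto simp: bounded_iff)
    let ?S = "cball 0 (R + 1) \<times> cball 0 (R + 1) :: (real \<times> real) set"
    have "uniformly_continuous_on ?S (\<lambda>z. bregman p (fst z) (snd z))"
      by (intro compact_uniformly_continuous compact_Times compact_cball continuous_on_bregman[OF p] continuous_intros)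
    then obtain \<delta> where d: "0 < \<delta>"
      "\<And>z z'. z \<in> ?S \<Longrightarrow> z' \<in> ?S \<Longrightarrow> dist z' z < \<delta> \<Longrightarrow> dist (bregman p (fst z') (snd z')) (bregman p (fst z) (snd z)) < \<epsilon>"
      using e by (rule uniformly_continuous_onE) blast
    define \<delta>' where "\<delta>' = min (\<delta> / 2) 1"
    have d': "0 < \<delta>'" using d by (simp add: \<delta>'_def)
    show "\<forall>\<^sub>F n in sequentially. \<forall>x\<in>C. \<forall>y\<in>C. bregman p (?u x) (?u y) - \<epsilon> \<le> bregman p (P (h n) ?u x) (?u y)"
      using P_locally_uniform[OF f h(1) lim t C d']
    proof (eventually_elim, intro ballI)
      fix n x y assume un: "\<forall>x\<in>C. \<bar>P (t + h n) f x - ?u x\<bar> \<le> \<delta>'" and x: "x \<in> C" and y: "y \<in> C"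
      have n: "\<bar>P (h n) ?u x - ?u x\<bar> \<le> \<delta>'" using un x unfolding shift by blast
      have "\<bar>P (h n) ?u x - ?u x\<bar> < \<delta>" using n d(1) by (simp add: \<delta>'_def)
      moreover have "\<bar>P (h n) ?u x\<bar> \<le> R + 1"
      proof -
        have "\<bar>P (h n) ?u x - ?u x\<bar> \<le> 1" using n by (simp add: \<delta>'_def)
        then show ?thesis using R[OF x] by linarith
      qed
      ultimately have "dist (bregman p (P (h n) ?u x) (?u y)) (bregman p (?u x) (?u y)) < \<epsilon>"
        using d(2)[of "(?u x, ?u y)" "(P (h n) ?u x, ?u y)"] R[OF x] R[OF y]
        by (simp add: dist_Pair_Pair dist_real_def)
      then show "bregman p (?u x) (?u y) - \<epsilon> \<le> bregman p (P (h n) ?u x) (?u y)"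
        by (simp add: dist_real_def)
    qed
  qed
  then show ?thesis by (simp add: loss_def)
qed

lemma signed_half_L2:
  assumes "u \<in> Lp p m" shows "(\<lambda>x. signed_powr (u x) (p / 2)) \<in> Lp 2 m"
proof -
  have [measurable]: "u \<in> borel_measurable borel" by (rule Lp_meas[OF assms])
  have "\<bar>signed_powr (u x) (p / 2)\<bar> powr 2 = \<bar>u x\<bar> powr p" for x
    by (simp add: powr2_eq signed_powr_half_squared)
  then have "energy 2 (\<lambda>x. signed_powr (u x) (p / 2)) = energy p u" by (simp add: energy_def)
  then show ?thesis using assms by (simp add: Lp_iff)
qed

text \<open>The value \<open>signed_powr (P h u x) (p / 2)\<close> is a competitor in the variance of
\<open>signed_powr u (p / 2)\<close>, and with this choice the squared distance is bounded by
the divergence that appears in the energy balance.\<close>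

lemma approx_form_le_loss:
  assumes h: "0 < h" and u: "u \<in> Lp p m"
  shows "ennreal (min 1 (p - 1) * approx_form m P (2 * h) (\<lambda>x. signed_powr (u x) (p / 2)) (\<lambda>x. signed_powr (u x) (p / 2)))
    \<le> loss u h"
proof -
  let ?v = "\<lambda>x. signed_powr (u x) (p / 2)"
  let ?c = "min 1 (p - 1) / 2"
  have c: "0 \<le> ?c" using p by simp
  have h0: "0 \<le> h" using h by simp
  have vL: "?v \<in> Lp 2 m" by (rule signed_half_L2[OF u])
  have [measurable]: "u \<in> borel_measurable borel" by (rule Lp_meas[OF u])
  note [measurable] = P_meas[OF h0 Lp_meas[OF u]]
  let ?w = "\<lambda>x. signed_powr (P h u x) (p / 2)"
  have m: "(\<lambda>(x, y). ennreal ((?v y - ?w x)\<^sup>2)) \<in> borel_measurable borel"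
    unfolding borel_pair[symmetric] by measurable
  have "ennreal (?c * defect ?v (2 * h)) = ennreal ?c * ennreal (defect ?v (2 * h))"
    using c by (rule ennreal_mult')
  also have "\<dots> \<le> ennreal ?c * joint h (\<lambda>x y. ennreal ((?v y - ?w x)\<^sup>2))"
    by (intro mult_left_mono joint_square_ge_defect[OF h0 vL]) simp
  also have "\<dots> = joint h (\<lambda>x y. ennreal ?c * ennreal ((?v y - ?w x)\<^sup>2))"
    by (rule joint_cmult[OF h0 m, symmetric])
  also have "\<dots> \<le> joint h (\<lambda>x y. ennreal (bregman p (P h u x) (u y)))"
    unfolding joint_def using bregman_bounds(1)[OF p] c
    by (intro nn_integral_mono) (simp add: ennreal_mult'[symmetric] ennreal_leI)
  finally have "ennreal (1 / h) * ennreal (?c * defect ?v (2 * h)) \<le> loss u h"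
    unfolding loss_def rate_def by (intro mult_left_mono) auto
  moreover have "ennreal (1 / h) * ennreal (?c * defect ?v (2 * h)) = ennreal (1 / h * (?c * defect ?v (2 * h)))"
    using h by (intro ennreal_mult'[symmetric]) simp
  moreover have "1 / h * (?c * defect ?v (2 * h)) = min 1 (p - 1) * approx_form m P (2 * h) ?v ?v"
    using h vL by (simp add: approx_form_defect)
  ultimately show ?thesis by simp
qed

lemma loss_le_rate_bregman:
  assumes h: "0 < h" and u: "u \<in> Lp p m"
  shows "loss u h \<le> rate h (\<lambda>x y. ennreal (bregman p (u x) (u y)))"
  unfolding loss_def rate_def using h joint_bregman_mean_le[OF p _ u, of h u] by (intro mult_left_mono) auto

lemma rate_square_eq:
  assumes h: "0 < h" and v: "v \<in> Lp 2 m" and c: "0 \<le> c"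
  shows "rate h (\<lambda>x y. ennreal (c * (v y - v x)\<^sup>2)) = ennreal (2 * c * approx_form m P h v v)"
proof -
  have h0: "0 \<le> h" using h by simp
  have [measurable]: "v \<in> borel_measurable borel" by (rule Lp_meas[OF v])
  have m: "(\<lambda>(x, y). ennreal ((v y - v x)\<^sup>2)) \<in> borel_measurable borel"
    unfolding borel_pair[symmetric] by measurable
  have "joint h (\<lambda>x y. ennreal (c * (v y - v x)\<^sup>2)) = ennreal c * joint h (\<lambda>x y. ennreal ((v y - v x)\<^sup>2))"
    unfolding ennreal_mult'[OF c] by (rule joint_cmult[OF h0 m])
  also have "\<dots> = ennreal (c * (2 * defect v h))"
    unfolding joint_square_eq_defect[OF h0 v] by (rule ennreal_mult'[OF c, symmetric])
  finally have "rate h (\<lambda>x y. ennreal (c * (v y - v x)\<^sup>2)) = ennreal (1 / h * (c * (2 * defect v h)))"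
    unfolding rate_def using h by (simp add: ennreal_mult'[symmetric])
  also have "1 / h * (c * (2 * defect v h)) = 2 * c * approx_form m P h v v"
    using h v by (simp add: approx_form_defect)
  finally show ?thesis .
qed

text \<open>Here the competitor is \<open>u x\<close> in place of the mean.\<close>

lemma loss_le_approx_form:
  assumes h: "0 < h" and u: "u \<in> Lp p m"
  shows "loss u h \<le> ennreal (2 * (2 * max 1 (p - 1)) *
    approx_form m P h (\<lambda>x. signed_powr (u x) (p / 2)) (\<lambda>x. signed_powr (u x) (p / 2)))"
proof -
  let ?v = "\<lambda>x. signed_powr (u x) (p / 2)"
  have "loss u h \<le> rate h (\<lambda>x y. ennreal (bregman p (u x) (u y)))" by (rule loss_le_rate_bregman[OF assms])
  also have "\<dots> \<le> rate h (\<lambda>x y. ennreal (2 * max 1 (p - 1) * (?v y - ?v x)\<^sup>2))"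
    by (intro rate_mono ennreal_leI bregman_bounds(2)[OF p])
  also have "\<dots> = ennreal (2 * (2 * max 1 (p - 1)) * approx_form m P h ?v ?v)"
    by (rule rate_square_eq[OF h signed_half_L2[OF u]]) simp
  finally show ?thesis .
qed

lemma approx_form_le_liminf_loss:
  assumes u: "u \<in> Lp p m" and h: "\<And>n. 0 < h n" "h \<longlonglongrightarrow> 0" and s: "0 < s"
  shows "ennreal (min 1 (p - 1) * approx_form m P s (\<lambda>x. signed_powr (u x) (p / 2)) (\<lambda>x. signed_powr (u x) (p / 2)))
    \<le> liminf (\<lambda>n. loss u (h n))"
proof -
  let ?v = "\<lambda>x. signed_powr (u x) (p / 2)"
  have vL: "?v \<in> Lp 2 m" by (rule signed_half_L2[OF u])
  have "(\<lambda>n. ennreal (min 1 (p - 1) * (approx_form m P s ?v ?v / (1 + 2 * h n / s))))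
     \<longlonglongrightarrow> ennreal (min 1 (p - 1) * (approx_form m P s ?v ?v / (1 + 2 * 0 / s)))"
    using s by (intro tendsto_ennrealI tendsto_intros h) auto
  then have "ennreal (min 1 (p - 1) * approx_form m P s ?v ?v)
     = liminf (\<lambda>n. ennreal (min 1 (p - 1) * (approx_form m P s ?v ?v / (1 + 2 * h n / s))))"
    by (simp add: lim_imp_Liminf)
  also have "\<dots> \<le> liminf (\<lambda>n. loss u (h n))"
  proof (intro Liminf_mono always_eventually allI)
    fix n
    have "ennreal (min 1 (p - 1) * (approx_form m P s ?v ?v / (1 + 2 * h n / s)))
      \<le> ennreal (min 1 (p - 1) * approx_form m P (2 * h n) ?v ?v)"
      using approx_form_rate_le[OF _ s vL, of "2 * h n"] h(1)[of n] p by (intro ennreal_leI mult_left_mono) auto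
    also have "\<dots> \<le> loss u (h n)" by (rule approx_form_le_loss[OF h(1) u])
    finally show "ennreal (min 1 (p - 1) * (approx_form m P s ?v ?v / (1 + 2 * h n / s))) \<le> loss u (h n)" .
  qed
  finally show ?thesis .
qed

text \<open>Both comparisons pass through the approximating form of \<open>signed_powr u (p / 2)\<close>,
which grows, up to a factor that tends to 1, as its time decreases to 0.\<close>

lemma loss_dominated:
  assumes u: "u \<in> Lp p m" and h: "\<And>n. 0 < h n" "h \<longlonglongrightarrow> 0" and s: "0 < s"
  shows "loss u s \<le> ennreal (4 * max 1 (p - 1) / min 1 (p - 1)) * liminf (\<lambda>n. loss u (h n))"
proof -
  let ?v = "\<lambda>x. signed_powr (u x) (p / 2)"
  have c: "0 < min 1 (p - 1)" using p by simp
  have "loss u s \<le> ennreal (2 * (2 * max 1 (p - 1)) * approx_form m P s ?v ?v)"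
    by (rule loss_le_approx_form[OF s u])
  also have "2 * (2 * max 1 (p - 1)) * approx_form m P s ?v ?v
      = (4 * max 1 (p - 1) / min 1 (p - 1)) * (min 1 (p - 1) * approx_form m P s ?v ?v)"
    using c by (simp only: times_divide_eq_left) simp
  also have "ennreal \<dots> = ennreal (4 * max 1 (p - 1) / min 1 (p - 1)) * ennreal (min 1 (p - 1) * approx_form m P s ?v ?v)"
    using c by (intro ennreal_mult' divide_nonneg_nonneg) auto
  also have "\<dots> \<le> ennreal (4 * max 1 (p - 1) / min 1 (p - 1)) * liminf (\<lambda>n. loss u (h n))"
    by (intro mult_left_mono approx_form_le_liminf_loss[OF u h s]) simp
  finally show ?thesis .
qed

lemma signed_half_in_domain:
  assumes u: "u \<in> Lp p m" and h: "\<And>n. 0 < h n" "h \<longlonglongrightarrow> 0" and fin: "liminf (\<lambda>n. loss u (h n)) < \<infinity>"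
  shows "(\<lambda>x. signed_powr (u x) (p / 2)) \<in> D"
proof -
  let ?v = "\<lambda>x. signed_powr (u x) (p / 2)"
  have c: "0 < min 1 (p - 1)" using p by simp
  obtain B where B: "liminf (\<lambda>n. loss u (h n)) = ennreal B" "0 \<le> B"
    using fin by (cases "liminf (\<lambda>n. loss u (h n))") auto
  show ?thesis unfolding D_eq
  proof (rule form_domainI[OF signed_half_L2[OF u], of "B / min 1 (p - 1)"])
    fix s :: real assume "0 < s"
    then have "min 1 (p - 1) * approx_form m P s ?v ?v \<le> B"
      using approx_form_le_liminf_loss[OF u h] B by (metis ennreal_le_iff)
    then show "approx_form m P s ?v ?v \<le> B / min 1 (p - 1)" using c by (subst pos_le_divide_eq) (auto simp: mult.commute)
  qed
qed

text \<open>The lower bound is \<open>jump_energy_le_liminf\<close>. For the upper bound, \<open>q\<close>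
majorises the divergence \<open>b\<close> and its integrals converge because \<open>v\<close> is
in the domain; Fatou for \<open>q - b\<close> then bounds the integrals of \<open>b\<close> from
above.\<close>

lemma loss_tendsto_jump_energy:
  assumes f: "f \<in> Lp p m" and h: "\<And>n. 0 < h n" "h \<longlonglongrightarrow> 0"
    and lim: "(\<lambda>n. energy p (\<lambda>x. P (h n) f x - f x)) \<longlonglongrightarrow> 0" and t: "0 < t"
    and fin: "liminf (\<lambda>n. loss (P t f) (h n)) < \<infinity>"
  shows "(\<lambda>n. loss (P t f) (h n)) \<longlonglongrightarrow> jump_energy (P t f)"
proof -
  let ?u = "P t f" and ?C = "2 * max 1 (p - 1)"
  define v where "v x = signed_powr (P t f x) (p / 2)" for x
  have uL: "?u \<in> Lp p m" using P_Lp[of p t f] p t f by simp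
  have uc: "continuous_on UNIV ?u" by (rule smoothing[OF t f])
  have vD: "v \<in> D" unfolding v_def by (rule signed_half_in_domain[OF uL h fin])
  have vL: "v \<in> Lp 2 m" by (rule D_L2[OF vD])
  have vc: "continuous_on UNIV v" unfolding v_def using p by (intro continuous_on_signed_powr uc) simp
  have C: "0 \<le> ?C" by simp
  define q where "q x y = ?C * (v y - v x)\<^sup>2" for x y
  define b where "b x y = bregman p (?u x) (?u y)" for x y
  have b0: "0 \<le> b x y" "b x y \<le> q x y" for x y
    unfolding b_def q_def v_def using bregman_nonneg[OF p] bregman_bounds(2)[OF p] by auto
  have bc: "continuous_on UNIV (\<lambda>(x, y). b x y)"
    unfolding b_def case_prod_beta'
    by (intro continuous_on_bregman[OF p] continuous_on_compose2[OF uc] continuous_intros) auto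
  have qc: "continuous_on UNIV (\<lambda>(x, y). q x y)"
    unfolding q_def case_prod_beta' by (intro continuous_intros continuous_on_compose2[OF vc]) auto
  have dc: "continuous_on UNIV (\<lambda>(x, y). q x y - b x y)"
    using continuous_on_diff[OF qc bc] by (simp add: case_prod_beta')
  note bm = borel_measurable_continuous_onI[OF bc] and dm = borel_measurable_continuous_onI[OF dc]
  define X where "X n = rate (h n) (\<lambda>x y. ennreal (b x y))" for n
  define T where "T n = rate (h n) (\<lambda>x y. ennreal (q x y - b x y))" for n
  define z where "z = ennreal (2 * ?C * Q v v)"
  have hF: "filterlim h (at_right 0) sequentially"
    using h by (rule filterlim_at_right_0_sequence)
  have XT: "X n + T n = ennreal (2 * ?C * approx_form m P (h n) v v)" for n
  proof -
    have h0: "0 \<le> h n" using h(1)[of n] by simp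
    have "rate (h n) (\<lambda>x y. ennreal (q x y)) = X n + T n"
    proof -
      have m: "(\<lambda>(x, y). ennreal (b x y)) \<in> borel_measurable borel" "(\<lambda>(x, y). ennreal (q x y - b x y)) \<in> borel_measurable borel"
        using measurable_compose[OF bm measurable_ennreal] measurable_compose[OF dm measurable_ennreal]
        by (simp_all add: case_prod_beta')
      have "joint (h n) (\<lambda>x y. ennreal (q x y)) = joint (h n) (\<lambda>x y. ennreal (b x y) + ennreal (q x y - b x y))"
        using b0 by (simp add: ennreal_plus[symmetric] del: ennreal_plus)
      also have "\<dots> = joint (h n) (\<lambda>x y. ennreal (b x y)) + joint (h n) (\<lambda>x y. ennreal (q x y - b x y))"
        by (rule joint_add[OF h0 m])
      finally show ?thesis unfolding rate_def X_def T_def by (simp add: distrib_left)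
    qed
    then show ?thesis unfolding q_def using rate_square_eq[OF h(1) vL C] by metis
  qed
  have "(\<lambda>n. ennreal (2 * ?C * approx_form m P (h n) v v)) \<longlonglongrightarrow> z"
    unfolding z_def by (intro tendsto_ennrealI tendsto_intros filterlim_compose[OF Q_lim[OF vD vD] hF])
  moreover have "jump_energy ?u + (\<integral>\<^sup>+(x, y). ennreal (q x y - b x y) \<partial>J) = z"
  proof -
    have "jump_energy ?u + (\<integral>\<^sup>+(x, y). ennreal (q x y - b x y) \<partial>J) = (\<integral>\<^sup>+(x, y). ennreal (q x y) \<partial>J)"
      unfolding jump_energy_def b_def[symmetric] case_prod_beta'
      using meas_J[OF bm] meas_J[OF dm] b0
      by (subst nn_integral_add[symmetric]) (auto simp: case_prod_beta' ennreal_plus[symmetric] simp del: ennreal_plus)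
    also have "\<dots> = (\<integral>\<^sup>+z. ennreal (?C * (case z of (x, y) \<Rightarrow> (v y - v x) * (v y - v x))) \<partial>J)"
      by (simp add: q_def case_prod_beta' power2_eq_square)
    also have "\<dots> = ennreal (\<integral>z. ?C * (case z of (x, y) \<Rightarrow> (v y - v x) * (v y - v x)) \<partial>J)"
      using form_jump(1)[OF vD vD vc vc]
      by (intro nn_integral_eq_integral integrable_mult_right) (auto simp: case_prod_beta')
    also have "\<dots> = z"
    proof -
      have "(\<integral>z. (case z of (x, y) \<Rightarrow> (v y - v x) * (v y - v x)) \<partial>J) = 2 * Q v v"
        using form_jump(2)[OF vD vD vc vc] by (simp add: case_prod_beta')
      then have *: "(\<integral>z. ?C * (case z of (x, y) \<Rightarrow> (v y - v x) * (v y - v x)) \<partial>J) = ?C * (2 * Q v v)"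
        by (simp only: integral_mult_right_zero)
      have "?C * (2 * Q v v) = 2 * ?C * Q v v" by (simp only: mult_ac)
      then show ?thesis unfolding z_def * by (rule arg_cong)
    qed
    finally show ?thesis .
  qed
  moreover have "(\<integral>\<^sup>+(x, y). ennreal (q x y - b x y) \<partial>J) \<le> liminf T"
    unfolding T_def
  proof (rule rate_liminf[OF dc _ dm h])
    show "0 \<le> q x y - b x y" for x y using b0(2)[of x y] by simp
    show "\<forall>\<^sub>F n in sequentially. \<forall>x\<in>C. \<forall>y\<in>C. q x y - b x y - \<epsilon> \<le> q x y - b x y" if "0 < \<epsilon>" for C and \<epsilon> :: real
      using that by (intro always_eventually) auto
  qed
  ultimately have "limsup X \<le> jump_energy ?u"
    using eq_refl[OF XT] by (intro limsup_le_of_complement[where Z = "\<lambda>n. ennreal (2 * ?C * approx_form m P (h n) v v)"]) (auto simp: z_def)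
  moreover have "limsup (\<lambda>n. loss ?u (h n)) \<le> limsup X"
    unfolding X_def b_def by (intro Limsup_mono always_eventually allI loss_le_rate_bregman[OF h(1) uL])
  ultimately have up: "limsup (\<lambda>n. loss ?u (h n)) \<le> jump_energy ?u" by simp
  have low: "jump_energy ?u \<le> liminf (\<lambda>n. loss ?u (h n))" by (rule jump_energy_le_liminf[OF f h lim t])
  show ?thesis
  proof (rule Liminf_eq_Limsup)
    have "liminf (\<lambda>n. loss ?u (h n)) \<le> limsup (\<lambda>n. loss ?u (h n))" by (rule Liminf_le_Limsup) simp
    then show "liminf (\<lambda>n. loss ?u (h n)) = jump_energy ?u" "limsup (\<lambda>n. loss ?u (h n)) = jump_energy ?u"
      using up low by auto
  qed simp
qed

end

section \<open>Integration in time\<close>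

text \<open>A substitute for the triangle inequality of the \<open>p\<close>-norm: nonnegativity of the
divergence bounds \<open>\<bar>a\<bar> powr p - \<bar>b\<bar> powr p\<close> by \<open>p *
\<bar>a\<bar> powr (p - 1) * \<bar>b - a\<bar>\<close>, and the two factors are separated
according to whether \<open>\<bar>b - a\<bar>\<close> exceeds \<open>\<delta> *
\<bar>a\<bar>\<close>.\<close>

lemma powr_le_powr_add_diff:
  fixes a b :: real
  assumes p: "1 < p" and d: "0 < \<delta>"
  shows "\<bar>a\<bar> powr p \<le> \<bar>b\<bar> powr p + p * \<delta> * \<bar>a\<bar> powr p + p * \<delta> powr (1 - p) * \<bar>b - a\<bar> powr p"
proof -
  have y: "\<bar>a\<bar> powr (p - 1) * \<bar>b - a\<bar> \<le> \<delta> * \<bar>a\<bar> powr p + \<delta> powr (1 - p) * \<bar>b - a\<bar> powr p"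
  proof (cases "\<bar>b - a\<bar> \<le> \<delta> * \<bar>a\<bar>")
    case True
    have "\<bar>a\<bar> powr (p - 1) * \<bar>b - a\<bar> \<le> \<bar>a\<bar> powr (p - 1) * (\<delta> * \<bar>a\<bar>)" using True by (intro mult_left_mono) auto
    also have "\<dots> = \<delta> * \<bar>a\<bar> powr p" by (cases "a = 0") (auto simp: powr_diff)
    finally show ?thesis by (simp add: add_increasing2)
  next
    case False
    let ?d = "\<bar>b - a\<bar>"
    have dp: "0 < ?d" using False d by (smt (verit) mult_nonneg_nonneg)
    have "\<bar>a\<bar> \<le> ?d / \<delta>" using False d by (simp add: field_simps)
    then have "\<bar>a\<bar> powr (p - 1) \<le> (?d / \<delta>) powr (p - 1)" using p by (intro powr_mono2) auto
    then have "\<bar>a\<bar> powr (p - 1) * ?d \<le> (?d / \<delta>) powr (p - 1) * ?d" by (intro mult_right_mono) auto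
    also have "\<dots> = \<delta> powr (1 - p) * ?d powr p"
      using dp d by (simp add: powr_divide powr_diff)
    finally show ?thesis using d by (simp add: add_increasing)
  qed
  have "- (signed_powr a (p - 1) * (b - a)) \<le> \<bar>a\<bar> powr (p - 1) * \<bar>b - a\<bar>"
  proof -
    have "- (signed_powr a (p - 1) * (b - a)) \<le> \<bar>signed_powr a (p - 1) * (b - a)\<bar>" by simp
    also have "\<dots> \<le> \<bar>a\<bar> powr (p - 1) * \<bar>b - a\<bar>" by (simp add: signed_powr_def abs_mult sgn_if)
    finally show ?thesis .
  qed
  with y have "p * - (signed_powr a (p - 1) * (b - a)) \<le> p * (\<delta> * \<bar>a\<bar> powr p + \<delta> powr (1 - p) * \<bar>b - a\<bar> powr p)"
    using p by (intro mult_left_mono) auto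
  then show ?thesis using bregman_nonneg[OF p, of a b] by (simp add: bregman_def algebra_simps)
qed

text \<open>Cutting the half-line into intervals of length \<open>h\<close> and translating them to the
first one leaves a telescoping series.\<close>

lemma nn_integral_telescope:
  fixes \<phi> :: "real \<Rightarrow> real"
  assumes anti: "\<And>s t. 0 \<le> s \<Longrightarrow> s \<le> t \<Longrightarrow> \<phi> t \<le> \<phi> s" and lim: "(\<phi> \<longlongrightarrow> 0) at_top"
    and meas: "\<phi> \<in> borel_measurable borel" and h: "0 < h"
  shows "(\<integral>\<^sup>+t\<in>{0..}. ennreal (\<phi> t - \<phi> (t + h)) \<partial>lborel) = (\<integral>\<^sup>+t\<in>{0..<h}. ennreal (\<phi> t) \<partial>lborel)"
proof -
  note [measurable] = meas
  let ?d = "\<lambda>t. ennreal (\<phi> t - \<phi> (t + h))"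
  let ?I = "\<lambda>k::nat. {real k * h..<real (Suc k) * h}"
  have ind: "(\<Sum>k. indicator (?I k) t) = (indicator {0..} t :: ennreal)" for t
  proof (cases "0 \<le> t")
    case True
    define n where "n = nat \<lfloor>t / h\<rfloor>"
    have n: "real n \<le> t / h" "t / h < real n + 1" using True h by (auto simp: n_def)
    then have tn: "t \<in> ?I n" using h by (auto simp: field_simps)
    have "t \<notin> ?I k" if "k \<noteq> n" for k
    proof
      assume "t \<in> ?I k"
      then have "real k \<le> t / h" "t / h < real k + 1" using h by (auto simp: field_simps)
      then have "real k < real n + 1" "real n < real k + 1" using n by linarith+
      then show False using that by linarith
    qed
    then have "(\<Sum>k. indicator (?I k) t) = (\<Sum>k\<in>{n}. indicator (?I k) t :: ennreal)"
      by (intro suminf_finite) (auto simp: indicator_def)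
    then show ?thesis using tn True by (simp add: indicator_def)
  next
    case False
    have "indicator (?I k) t = (0 :: ennreal)" for k
    proof -
      have "0 \<le> real k * h" using h by simp
      then show ?thesis using False by (auto simp: indicator_def)
    qed
    then show ?thesis using False by simp
  qed
  have "(\<integral>\<^sup>+t\<in>{0..}. ?d t \<partial>lborel) = (\<integral>\<^sup>+t. (\<Sum>k. ?d t * indicator (?I k) t) \<partial>lborel)"
    by (simp only: ennreal_suminf_cmult ind)
  also have "\<dots> = (\<Sum>k. \<integral>\<^sup>+t. ?d t * indicator (?I k) t \<partial>lborel)"
    by (rule nn_integral_suminf) measurable
  also have "\<dots> = (\<Sum>k. \<integral>\<^sup>+t. ?d (real k * h + t) * indicator {0..<h} t \<partial>lborel)"
  proof (intro suminf_cong)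
    fix k
    have "(\<integral>\<^sup>+t. ?d t * indicator (?I k) t \<partial>lborel) = (\<integral>\<^sup>+t. ?d (real k * h + 1 * t) * indicator (?I k) (real k * h + 1 * t) \<partial>lborel)"
      by (subst nn_integral_real_affine[where t = "real k * h" and c = 1]) auto
    also have "\<dots> = (\<integral>\<^sup>+t. ?d (real k * h + t) * indicator {0..<h} t \<partial>lborel)"
      by (intro nn_integral_cong) (auto simp: indicator_def algebra_simps)
    finally show "(\<integral>\<^sup>+t. ?d t * indicator (?I k) t \<partial>lborel) = (\<integral>\<^sup>+t. ?d (real k * h + t) * indicator {0..<h} t \<partial>lborel)" .
  qed
  also have "\<dots> = (\<integral>\<^sup>+t. (\<Sum>k. ?d (real k * h + t) * indicator {0..<h} t) \<partial>lborel)"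
    by (rule nn_integral_suminf[symmetric]) measurable
  also have "\<dots> = (\<integral>\<^sup>+t\<in>{0..<h}. ennreal (\<phi> t) \<partial>lborel)"
  proof (intro nn_integral_cong)
    fix t
    show "(\<Sum>k. ?d (real k * h + t) * indicator {0..<h} t) = ennreal (\<phi> t) * indicator {0..<h} t"
    proof (cases "t \<in> {0..<h}")
      case True
      have top: "filterlim (\<lambda>k. real k * h + t) at_top sequentially"
        using filterlim_tendsto_add_at_top[OF tendsto_const[of t]
            filterlim_tendsto_pos_mult_at_top[OF tendsto_const[of h] h filterlim_real_sequentially]]
        by (simp add: ac_simps)
      have "(\<lambda>k. \<phi> (real k * h + t) - \<phi> (real (Suc k) * h + t)) sums (\<phi> (real 0 * h + t) - 0)"
        by (rule telescope_sums'[OF filterlim_compose[OF lim top]])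
      moreover have "real (Suc k) * h + t = real k * h + t + h" for k by (simp add: algebra_simps)
      ultimately have "(\<lambda>k. \<phi> (real k * h + t) - \<phi> (real k * h + t + h)) sums \<phi> t" by (simp add: ac_simps)
      then have "(\<Sum>k. ?d (real k * h + t)) = ennreal (\<phi> t)"
        using True h by (intro suminf_ennreal_eq) (auto intro!: anti)
      then show ?thesis using True by simp
    qed simp
  qed
  finally show ?thesis .
qed

context hardy_stein_setting
begin

text \<open>Lower semicontinuity at time 0; with contractivity it gives convergence of the energies along
\<open>h\<close>.\<close>

lemma energy_le_liminf_P:
  assumes f: "f \<in> Lp p m" and h: "\<And>n. 0 < h n"
    and lim: "(\<lambda>n. energy p (\<lambda>x. P (h n) f x - f x)) \<longlonglongrightarrow> 0"
  shows "energy p f \<le> liminf (\<lambda>n. energy p (P (h n) f))"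
proof -
  have fm [measurable]: "f \<in> borel_measurable borel" by (rule Lp_meas[OF f])
  have Pm [measurable]: "P (h n) f \<in> borel_measurable borel" for n
    using h[of n] by (intro P_meas) auto
  obtain e where e: "energy p f = ennreal e" "0 \<le> e" using f by (cases "energy p f") (auto simp: Lp_iff)
  let ?L = "liminf (\<lambda>n. energy p (P (h n) f))"
  show ?thesis
  proof (rule ennreal_le_epsilon)
    fix \<epsilon> :: real assume eps: "0 < \<epsilon>"
    define \<delta> where "\<delta> = \<epsilon> / (2 * p * (e + 1))"
    have pe: "0 < 2 * p * (e + 1)" using e p by (intro mult_pos_pos) auto
    have d: "0 < \<delta>" using eps pe by (simp add: \<delta>_def)
    have "2 * p * (e + 1) * \<delta> = \<epsilon>" using pe nonzero_mult_div_cancel_left[of "2 * p * (e + 1)" \<epsilon>]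
      unfolding \<delta>_def times_divide_eq_right by linarith
    moreover have "0 < p * \<delta>" using d p by simp
    ultimately have de: "p * \<delta> * e \<le> \<epsilon> / 2" by (simp add: algebra_simps)
    let ?c = "ennreal (p * \<delta> powr (1 - p))"
    have le: "energy p f \<le> energy p (P (h n) f) + ennreal (p * \<delta>) * energy p f + ?c * energy p (\<lambda>x. P (h n) f x - f x)" for n
    proof -
      have "energy p f \<le> (\<integral>\<^sup>+x. ennreal (\<bar>P (h n) f x\<bar> powr p) + ennreal (p * \<delta>) * ennreal (\<bar>f x\<bar> powr p)
          + ?c * ennreal (\<bar>P (h n) f x - f x\<bar> powr p) \<partial>m)"
        unfolding energy_def using p d powr_le_powr_add_diff[OF p d]
        by (intro nn_integral_mono) (simp add: ennreal_mult[symmetric] ennreal_plus[symmetric] ennreal_leI del: ennreal_plus)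
      also have "\<dots> = energy p (P (h n) f) + ennreal (p * \<delta>) * energy p f + ?c * energy p (\<lambda>x. P (h n) f x - f x)"
        unfolding energy_def by (simp add: nn_integral_add nn_integral_cmult meas_m_iff)
      finally show ?thesis .
    qed
    have "ennreal (p * \<delta>) * energy p f = ennreal (p * \<delta> * e)"
      unfolding e(1) using d p by (intro ennreal_mult'[symmetric]) simp
    also have "\<dots> \<le> ennreal (\<epsilon> / 2)" using de by (intro ennreal_leI)
    finally have 1: "ennreal (p * \<delta>) * energy p f \<le> ennreal (\<epsilon> / 2)" .
    have "(\<lambda>n. ?c * energy p (\<lambda>x. P (h n) f x - f x)) \<longlonglongrightarrow> ?c * 0"
      by (intro ennreal_tendsto_cmult lim) simp
    then have "\<forall>\<^sub>F n in sequentially. ?c * energy p (\<lambda>x. P (h n) f x - f x) < ennreal (\<epsilon> / 2)"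
      using eps by (intro order_tendstoD(2)) auto
    then have "\<forall>\<^sub>F n in sequentially. energy p f - ennreal \<epsilon> \<le> energy p (P (h n) f)"
    proof eventually_elim
      case (elim n)
      have "energy p f \<le> energy p (P (h n) f) + ennreal (\<epsilon> / 2) + ennreal (\<epsilon> / 2)"
        using elim 1 by (intro order_trans[OF le[of n]] add_mono) auto
      also have "\<dots> = ennreal \<epsilon> + energy p (P (h n) f)"
        using eps by (simp add: ennreal_plus[symmetric] add.assoc add.commute del: ennreal_plus)
      finally show ?case by (simp add: ennreal_minus_le_iff)
    qed
    then have "energy p f - ennreal \<epsilon> \<le> ?L" by (rule Liminf_bounded)
    then show "energy p f \<le> ?L + ennreal \<epsilon>" by (simp add: ennreal_minus_le_iff add.commute)
  qed
qed

theorem hardy_stein: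
  assumes stable: "strongly_stable p m P" and f: "f \<in> Lp p m"
  shows "energy p f = (\<integral>\<^sup>+t\<in>{0..}. jump_energy (P t f) \<partial>lborel)"
proof -
  obtain h where h: "\<And>n. 0 < h n" "h \<longlonglongrightarrow> 0" and lim: "(\<lambda>n. energy p (\<lambda>x. P (h n) f x - f x)) \<longlonglongrightarrow> 0"
    using strong_continuity_sequence[OF p f] by blast
  \<comment> \<open>The value at negative times only makes \<open>\<phi>\<close> monotone, hence measurable, on the
    whole line.\<close>
  define \<phi> where "\<phi> t = (if 0 \<le> t then enn2real (energy p (P t f)) else enn2real (energy p f))" for t
  have PL: "P t f \<in> Lp p m" if "0 \<le> t" for t by (rule P_Lp[OF p that f])
  have e_phi: "energy p (P t f) = ennreal (\<phi> t)" if "0 \<le> t" for t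
    using PL[OF that] that by (simp add: \<phi>_def Lp_iff less_top)
  have phi0: "0 \<le> \<phi> t" for t by (simp add: \<phi>_def)
  have f_fin: "energy p f \<noteq> top" using f by (simp add: Lp_iff less_top)
  have phi_f: "ennreal (\<phi> t) \<le> energy p f" if "0 \<le> t" for t
    unfolding e_phi[OF that, symmetric] by (rule energy_P_le[OF p that f])
  have anti: "\<phi> t \<le> \<phi> s" if "s \<le> t" for s t
  proof -
    consider "0 \<le> s" | "s < 0" "0 \<le> t" | "s < 0" "t < 0" by linarith
    then show ?thesis
    proof cases
      case 1
      have "energy p (P t f) = energy p (P (t - s) (P s f))"
        unfolding energy_def using semigroup_Lp[OF p _ 1 f, of "t - s"] that
        by (intro nn_integral_cong_AE) (auto elim!: eventually_mono)
      also have "\<dots> \<le> energy p (P s f)" using that by (intro energy_P_le[OF p _ PL[OF 1]]) simp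
      finally show ?thesis using e_phi[OF 1] e_phi[of t] 1 that phi0 by simp
    next
      case 2
      then have "\<phi> s = enn2real (energy p f)" by (simp add: \<phi>_def)
      moreover have "\<phi> t \<le> enn2real (energy p f)"
        using phi_f[OF 2(2)] f_fin phi0 by (metis enn2real_ennreal enn2real_mono top.not_eq_extremum)
      ultimately show ?thesis by simp
    qed (simp add: \<phi>_def)
  qed
  have phi_meas [measurable]: "\<phi> \<in> borel_measurable borel"
  proof -
    have "mono (\<lambda>t. - \<phi> t)" using anti by (auto intro!: monoI)
    then have "(\<lambda>t. - \<phi> t) \<in> borel_measurable borel" by (rule borel_measurable_mono)
    then have "(\<lambda>t. - (- \<phi> t)) \<in> borel_measurable borel" by measurable
    then show ?thesis by simp
  qed
  have phi_lim: "(\<phi> \<longlongrightarrow> 0) at_top"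
  proof -
    have "((\<lambda>T. Lp_norm p m (P T f)) \<longlongrightarrow> 0) at_top" using stable f by (simp add: strongly_stable_def)
    then have "((\<lambda>T. Lp_norm p m (P T f) powr p) \<longlongrightarrow> 0) at_top"
      using p by (intro tendsto_zero_powrI[where b = p]) (auto simp: Lp_norm_def)
    moreover have "\<forall>\<^sub>F T in at_top. Lp_norm p m (P T f) powr p = \<phi> T"
      using eventually_ge_at_top[of 0]
    proof eventually_elim
      case (elim T)
      have "Lp_norm p m (P T f) powr p = (\<integral>x. \<bar>P T f x\<bar> powr p \<partial>m)"
        using p unfolding Lp_norm_def by (simp add: powr_powr)
      also have "\<dots> = \<phi> T"
        using elim PL[OF elim] unfolding \<phi>_def energy_def
        by (subst integral_eq_nn_integral) (auto simp: Lp_def)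
      finally show ?case .
    qed
    ultimately show ?thesis by (rule Lim_transform_eventually)
  qed
  define a where "a n t = ennreal (1 / h n) * ennreal (\<phi> t - \<phi> (t + h n))" for n t
  have am [measurable]: "a n \<in> borel_measurable borel" for n unfolding a_def by measurable
  have a_loss: "loss (P t f) (h n) = a n t" if t: "0 < t" for n t
  proof -
    have t0: "0 \<le> t" "0 \<le> t + h n" "0 \<le> h n" using t h(1)[of n] by auto
    have "energy p (P (t + h n) f) = energy p (P (h n) (P t f))"
      unfolding energy_def using semigroup_Lp[OF p t0(3) t0(1) f]
      by (intro nn_integral_cong_AE) (auto elim!: eventually_mono simp: add.commute)
    then have "energy p (P (h n) (P t f)) = ennreal (\<phi> (t + h n))" using e_phi[OF t0(2)] by simp
    then show ?thesis
      unfolding loss_def rate_def joint_bregman_eq_energy_diff[OF h(1) PL[OF t0(1)]] a_def e_phi[OF t0(1)]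
      using phi0 by (simp add: ennreal_minus)
  qed
  have a_int: "(\<integral>\<^sup>+t\<in>{0..}. a n t \<partial>lborel) = ennreal (1 / h n) * (\<integral>\<^sup>+t\<in>{0..<h n}. ennreal (\<phi> t) \<partial>lborel)" for n
  proof -
    have "(\<integral>\<^sup>+t\<in>{0..}. a n t \<partial>lborel) = (\<integral>\<^sup>+t. ennreal (1 / h n) * (ennreal (\<phi> t - \<phi> (t + h n)) * indicator {0..} t) \<partial>lborel)"
      by (simp add: a_def mult.assoc)
    also have "\<dots> = ennreal (1 / h n) * (\<integral>\<^sup>+t\<in>{0..}. ennreal (\<phi> t - \<phi> (t + h n)) \<partial>lborel)"
      by (rule nn_integral_cmult) measurable
    also have "(\<integral>\<^sup>+t\<in>{0..}. ennreal (\<phi> t - \<phi> (t + h n)) \<partial>lborel) = (\<integral>\<^sup>+t\<in>{0..<h n}. ennreal (\<phi> t) \<partial>lborel)"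
      by (rule nn_integral_telescope[OF anti phi_lim phi_meas h(1)])
    finally show ?thesis .
  qed
  have mean_c: "ennreal (1 / h n) * (\<integral>\<^sup>+t\<in>{0..<h n}. c \<partial>lborel) = c" for n and c :: ennreal
    using h(1)[of n] by (simp add: nn_integral_cmult_indicator mult.left_commute[of c] mult.assoc ennreal_mult'[symmetric]) 
       (simp add: mult.left_commute mult.commute ennreal_mult'[symmetric])
  have a_le: "(\<integral>\<^sup>+t\<in>{0..}. a n t \<partial>lborel) \<le> energy p f" for n
  proof -
    have "(\<integral>\<^sup>+t\<in>{0..}. a n t \<partial>lborel) \<le> ennreal (1 / h n) * (\<integral>\<^sup>+t\<in>{0..<h n}. energy p f \<partial>lborel)"
      unfolding a_int using phi_f by (intro mult_left_mono nn_integral_mono) (auto simp: indicator_def)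
    then show ?thesis unfolding mean_c .
  qed
  have a_ge: "energy p (P (h n) f) \<le> (\<integral>\<^sup>+t\<in>{0..}. a n t \<partial>lborel)" for n
  proof -
    have "energy p (P (h n) f) = ennreal (1 / h n) * (\<integral>\<^sup>+t\<in>{0..<h n}. ennreal (\<phi> (h n)) \<partial>lborel)"
      unfolding mean_c using e_phi[of "h n"] h(1)[of n] by simp
    also have "\<dots> \<le> (\<integral>\<^sup>+t\<in>{0..}. a n t \<partial>lborel)"
      unfolding a_int using anti by (intro mult_left_mono nn_integral_mono) (auto simp: indicator_def ennreal_leI)
    finally show ?thesis .
  qed
  have a_lim: "(\<lambda>n. \<integral>\<^sup>+t\<in>{0..}. a n t \<partial>lborel) \<longlonglongrightarrow> energy p f"
  proof (rule Liminf_eq_Limsup)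
    let ?A = "\<lambda>n. \<integral>\<^sup>+t\<in>{0..}. a n t \<partial>lborel"
    have 1: "energy p f \<le> liminf ?A"
      by (rule order_trans[OF energy_le_liminf_P[OF f h(1) lim]]) (intro Liminf_mono always_eventually allI a_ge)
    have 2: "limsup ?A \<le> energy p f" by (intro Limsup_bounded always_eventually allI a_le)
    have 3: "liminf ?A \<le> limsup ?A" by (rule Liminf_le_Limsup) simp
    show "liminf ?A = energy p f" "limsup ?A = energy p f" using 1 2 3 by auto
  qed simp
  define A where "A t = liminf (\<lambda>n. a n t)" for t
  have Am [measurable]: "A \<in> borel_measurable borel" unfolding A_def by measurable
  \<comment> \<open>Fatou's lemma in \<open>t\<close>: the lower limit of the difference quotients is integrable.\<close>
  have A_fin: "(\<integral>\<^sup>+t\<in>{0..}. A t \<partial>lborel) \<le> energy p f"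
  proof -
    have "(\<integral>\<^sup>+t\<in>{0..}. A t \<partial>lborel) \<le> (\<integral>\<^sup>+t. liminf (\<lambda>n. a n t * indicator {0..} t) \<partial>lborel)"
      unfolding A_def by (intro nn_integral_mono) (auto simp: indicator_def)
    also have "\<dots> \<le> liminf (\<lambda>n. \<integral>\<^sup>+t\<in>{0..}. a n t \<partial>lborel)"
      by (rule nn_integral_liminf) measurable
    also have "\<dots> = energy p f" using a_lim by (simp add: lim_imp_Liminf)
    finally show ?thesis .
  qed
  have "AE t in lborel. A t * indicator {0..} t \<noteq> \<infinity>"
    using A_fin f_fin by (intro nn_integral_PInf_AE) (auto simp: top_unique)
  moreover have "AE t in lborel. t \<noteq> (0 :: real)" by (rule AE_lborel_singleton)
  ultimately have ae: "AE t in lborel. 0 \<le> t \<longrightarrow> 0 < t \<and> A t < \<infinity>"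
    by eventually_elim (auto simp: indicator_def less_top)
  have conv: "(\<lambda>n. a n t) \<longlonglongrightarrow> A t" "A t = jump_energy (P t f)" if t: "0 < t" "A t < \<infinity>" for t
  proof -
    have "(\<lambda>n. loss (P t f) (h n)) \<longlonglongrightarrow> jump_energy (P t f)"
      using t by (intro loss_tendsto_jump_energy[OF f h lim t(1)]) (simp add: a_loss A_def)
    then have "(\<lambda>n. a n t) \<longlonglongrightarrow> jump_energy (P t f)" by (simp add: a_loss[OF t(1)])
    then show "(\<lambda>n. a n t) \<longlonglongrightarrow> A t" "A t = jump_energy (P t f)"
      by (simp_all add: A_def lim_imp_Liminf)
  qed
  let ?c = "ennreal (4 * max 1 (p - 1) / min 1 (p - 1))"
  have "(\<lambda>n. \<integral>\<^sup>+t\<in>{0..}. a n t \<partial>lborel) \<longlonglongrightarrow> (\<integral>\<^sup>+t\<in>{0..}. A t \<partial>lborel)"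
  proof (rule nn_integral_dominated_convergence[where w = "\<lambda>t. ?c * (A t * indicator {0..} t)"])
    show "AE t in lborel. a n t * indicator {0..} t \<le> ?c * (A t * indicator {0..} t)" for n
      using ae
    proof eventually_elim
      case (elim t)
      show ?case
      proof (cases "0 \<le> t")
        case True
        then have t: "0 < t" using elim by simp
        have "a n t \<le> ?c * A t"
          using loss_dominated[OF PL[OF True] h h(1)[of n]] by (simp add: a_loss[OF t] A_def)
        then show ?thesis using True by (simp add: indicator_def)
      qed simp
    qed
    show "(\<integral>\<^sup>+t. ?c * (A t * indicator {0..} t) \<partial>lborel) < \<infinity>"
    proof -
      have "(\<integral>\<^sup>+t\<in>{0..}. A t \<partial>lborel) < top"
        using A_fin f_fin by (metis le_less_trans top.not_eq_extremum)
      moreover have "(\<integral>\<^sup>+t. ?c * (A t * indicator {0..} t) \<partial>lborel) = ?c * (\<integral>\<^sup>+t\<in>{0..}. A t \<partial>lborel)"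
        by (rule nn_integral_cmult) measurable
      ultimately show ?thesis by (simp add: ennreal_mult_less_top)
    qed
    show "AE t in lborel. (\<lambda>n. a n t * indicator {0..} t) \<longlonglongrightarrow> A t * indicator {0..} t"
      using ae by eventually_elim (use conv in \<open>auto simp: indicator_def\<close>)
  qed measurable
  with a_lim have "energy p f = (\<integral>\<^sup>+t\<in>{0..}. A t \<partial>lborel)" by (rule LIMSEQ_unique)
  also have "\<dots> = (\<integral>\<^sup>+t\<in>{0..}. jump_energy (P t f) \<partial>lborel)"
  proof (rule nn_integral_cong_AE)
    show "AE t in lborel. A t * indicator {0..} t = jump_energy (P t f) * indicator {0..} t"
      using ae by eventually_elim (use conv in \<open>auto simp: indicator_def\<close>)
  qed
  finally show ?thesis .
qed

end

theorem theorem1p1: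
  fixes m :: "'a::{metric_space, second_countable_topology} measure"
    and D :: "('a \<Rightarrow> real) set"
    and \<E> :: "('a \<Rightarrow> real) \<Rightarrow> ('a \<Rightarrow> real) \<Rightarrow> real"
    and J :: "('a \<times> 'a) measure"
    and K :: "real \<Rightarrow> 'a \<Rightarrow> 'a measure"
    and P :: "real \<Rightarrow> ('a \<Rightarrow> real) \<Rightarrow> 'a \<Rightarrow> real"
    and p :: real
    and f :: "'a \<Rightarrow> real"
  assumes "locally compact (UNIV :: 'a set)"
    and "radon_measure_on UNIV m"
    and "measure_supp m = UNIV"
    and "1 < p"
    and "dirichlet_form m D \<E>"
    and "regular_form m D \<E>"
    and "jumping_measure J"
    and "pure_jump_form m D \<E> J"
    and "sub_markov_kernels K"
    and "P = kernel_op K"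
    and "associated_semigroup m D \<E> P"
    and "conservative m P"
    and "\<And>t g. t > 0 \<Longrightarrow> g \<in> Lp p m \<Longrightarrow> continuous_on UNIV (P t g)"
    and "strongly_stable p m P"
    and "f \<in> Lp p m"
  shows "(\<integral>\<^sup>+x. ennreal (\<bar>f x\<bar> powr p) \<partial>m) =
    (\<integral>\<^sup>+t\<in>{0..}. (\<integral>\<^sup>+(x, y). ennreal (bregman p (P t f x) (P t f y)) \<partial>J) \<partial>lborel)"
proof -
  have P: "P = kernel_op K" by fact
  interpret sigma_finite_measure m by (rule radon_sigma_finite[OF assms(1,2)])
  interpret hardy_stein_setting m K D \<E> J p
  proof unfold_locales
    show "sets m = sets borel" by (rule radon_measure_on_UNIV_sets(1)[OF assms(2)])
    show "symmetric_markov_semigroup m (kernel_op K)"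
      using assms(11) unfolding P associated_semigroup_def by (rule conjunct1)
    show "continuous_on UNIV (kernel_op K t g)" if "0 < t" "g \<in> Lp p m" for t g
      using assms(13)[OF that] unfolding P .
  qed (use assms(1,3,4,6-9,11,12) in \<open>simp_all only: P\<close>)
  show ?thesis
    using hardy_stein[OF assms(14)[unfolded P] assms(15)] unfolding P energy_def jump_energy_def .
qed

end
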